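(* Let $\mathbf{k}$ be a differential field of characteristic $0$ with derivation $\partial$, let $G$ be a linear differential algebraic group over $\mathbf{k}$, and let $V$ be a faithful differential representation of $G$. Then every differential representation $U$ of $G$ is a subquotient of (a direct sum of) several copies of a $G$-module of the form $$V^{(i_1)}\otimes\dots\otimes V^{(i_k)}\otimes V^*\otimes\dots\otimes V^*.$$
   Context: A $\partial$-$\mathbf{k}$-algebra is a commutative $\mathbf{k}$-algebra with $1$ with a derivation $\partial$ extending that of $\mathbf{k}$. A linear differential algebraic group $G$ over $\mathbf{k}$ is a subgroup of $\mathbf{GL}_n(\mathcal{U})$ defined by differential polynomial equations over $\mathbf{k}$, where $\mathcal{U}\supset\mathbf{k}$ is a semi-universal differential field (every differentially finitely generated differential field extension of $\mathbf{k}$ embeds in $\mathcal{U}$ over $\mathbf{k}$). Its coordinate ring $A=\mathbf{k}\{G\}$ is the quotient of $\mathbf{k}\{X_{ij},1/\det\}$ (differential polynomial ring in $n^2$ differential indeterminates with $\det$ inverted) by the radical differential ideal of $G$; it is a differential Hopf algebra (a Hopf algebra whose comultiplication, counit, coinverse commute with $\partial$), and $G$ is viewed as the functor $B\mapsto G(B)=\mathrm{Hom}_{\mathbf{k}[\partial]}(A,B)$ ($\mathbf{k}$-algebra homomorphisms commuting with $\partial$) from $\partial$-$\mathbf{k}$-algebras to groups. A differential representation of $G$ is a finite dimensional $\mathbf{k}$-vector space $V$ with a morphism of group functors $G\to\mathbf{GL}(V)$, $\mathbf{GL}(V)(B)=\mathrm{Aut}_B(V\otimes B)$; equivalently an $A$-comodule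 structure $\rho:V\to V\otimes A$. It is faithful if this morphism is injective (so that, with $n=\dim V$, the induced map $\mathbf{k}\{X_{11},\dots,X_{nn},1/\det\}\to A$ is surjective). Tensor products and duals carry the usual actions. Prolongation: let $\mathbf{k}[\partial]$ be the ring of linear differential operators ($\partial a=a\partial+\partial(a)$). $V^{(p)}:=\mathbf{k}[\partial]_{\le p}\otimes_{\mathbf{k}}V$ (right $\mathbf{k}$-structure on operators of order $\le p$ for the tensor product, left one for the vector space structure), $\partial^qv:=\partial^q\otimes v$. If $V$ has basis $v_1,\dots,v_n$ and $\rho(v_j)=\sum_iv_i\otimes a_{ij}$, then $V^{(p)}$ is a $G$-module via $\rho(\partial^mv_j)=\sum_{i=1}^n\sum_{q=0}^m\binom{m}{q}\partial^qv_i\otimes\partial^{m-q}a_{ij}$ for $0\le m\le p$.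
   Formalization: The direct sum may contain modules of the stated form with different indices i_1,…,i_k and different numbers of factors V and V*; with copies of one single such module the claim fails, e.g. for G = GL_1, V standard, and U the sum of the trivial representation and V. *)

theory Defs
  imports
    "HOL-Analysis.Determinants"
    "HOL-Algebra.QuotRing"
    "HOL-Algebra.Subrings"
    "HOL-Library.Poly_Mapping"
    "HOL-Decision_Procs.Algebra_Aux"
begin

section \<open>Differential algebras\<close>

text \<open>
  The ground field is a type \<open>'k\<close> with a derivation \<open>d\<close>; a differential algebra over it is a
  ring record with a derivation and a structure map. A type of class \<^class>\<open>comm_ring_1\<close> is turned
  into a ring record by \<^const>\<open>cring_class_ops\<close>.
\<close>

record ('k, 'a) dalg = "'a ring" +
  der :: "'a \<Rightarrow> 'a"
  emb :: "'k \<Rightarrow> 'a"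

definition derivation :: "('a, 'm) ring_scheme \<Rightarrow> ('a \<Rightarrow> 'a) \<Rightarrow> bool" where
  "derivation R D \<longleftrightarrow>
     D \<in> carrier R \<rightarrow> carrier R \<and>
     (\<forall>x\<in>carrier R. \<forall>y\<in>carrier R. D (x \<oplus>\<^bsub>R\<^esub> y) = D x \<oplus>\<^bsub>R\<^esub> D y) \<and>
     (\<forall>x\<in>carrier R. \<forall>y\<in>carrier R. D (x \<otimes>\<^bsub>R\<^esub> y) = (D x \<otimes>\<^bsub>R\<^esub> y) \<oplus>\<^bsub>R\<^esub> (x \<otimes>\<^bsub>R\<^esub> D y))"

definition is_dalg :: "('k::field \<Rightarrow> 'k) \<Rightarrow> ('k, 'a) dalg \<Rightarrow> bool" where
  "is_dalg d R \<longleftrightarrow>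
     cring R \<and> derivation R (der R) \<and> emb R \<in> ring_hom cring_class_ops R \<and>
     (\<forall>c. der R (emb R c) = emb R (d c))"

text \<open>Homomorphisms are extensional, so that equal homomorphisms are equal functions.\<close>

definition dalg_hom :: "('k, 'a) dalg \<Rightarrow> ('k, 'b) dalg \<Rightarrow> ('a \<Rightarrow> 'b) set" where
  "dalg_hom R S = {f \<in> ring_hom R S \<inter> extensional (carrier R).
     (\<forall>c. f (emb R c) = emb S c) \<and> (\<forall>x\<in>carrier R. f (der R x) = der S (f x))}"

definition type_dalg :: "('a::comm_ring_1 \<Rightarrow> 'a) \<Rightarrow> ('k \<Rightarrow> 'a) \<Rightarrow> ('k, 'a) dalg" where
  "type_dalg D e = ring.extend cring_class_ops (dalg.fields D e)"


section \<open>Differential polynomials\<close>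

text \<open>
  \<open>('v, 'k) dpoly\<close> is the ring of differential polynomials in the differential indeterminates
  \<open>'v\<close>; the variable \<open>(v, q)\<close> is the \<open>q\<close>-th derivative of \<open>v\<close>.
\<close>

type_synonym ('v, 'k) dpoly = "(('v \<times> nat) \<Rightarrow>\<^sub>0 nat) \<Rightarrow>\<^sub>0 'k"

definition dp_const :: "'k \<Rightarrow> ('v, 'k::comm_ring_1) dpoly" where
  "dp_const c = Poly_Mapping.single 0 c"

definition dp_var :: "'v \<times> nat \<Rightarrow> ('v, 'k::comm_ring_1) dpoly" where
  "dp_var w = Poly_Mapping.single (Poly_Mapping.single w 1) 1"

text \<open>
  The second sum is the Leibniz rule for a monomial: for each variable \<open>(v, q)\<close> of exponent \<open>e\<close>,
  one factor \<open>(v, q)\<close> is replaced by \<open>(v, q + 1)\<close>, with multiplicity \<open>e\<close>.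
\<close>

definition dp_der :: "('k \<Rightarrow> 'k) \<Rightarrow> ('v, 'k::comm_ring_1) dpoly \<Rightarrow> ('v, 'k) dpoly" where
  "dp_der d F = (\<Sum>m\<in>Poly_Mapping.keys F.
      Poly_Mapping.single m (d (Poly_Mapping.lookup F m)) +
      (\<Sum>w\<in>Poly_Mapping.keys m.
         Poly_Mapping.single
           (m - Poly_Mapping.single w 1 + Poly_Mapping.single (fst w, Suc (snd w)) 1)
           (of_nat (Poly_Mapping.lookup m w) * Poly_Mapping.lookup F m)))"

definition dp_eval ::
  "('u \<Rightarrow> 'u) \<Rightarrow> ('k \<Rightarrow> 'u) \<Rightarrow> ('v \<Rightarrow> 'u) \<Rightarrow> ('v, 'k::comm_ring_1) dpoly \<Rightarrow> 'u::comm_ring_1" where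
  "dp_eval du \<iota> x F = (\<Sum>m\<in>Poly_Mapping.keys F. \<iota> (Poly_Mapping.lookup F m) *
      (\<Prod>w\<in>Poly_Mapping.keys m. ((du ^^ snd w) (x (fst w))) ^ Poly_Mapping.lookup m w))"

text \<open>
  HOL cannot quantify over types inside a definition, so differential algebras that are
  quantified over have as carrier a set of elements of one fixed type. Every
  quotient of a differential polynomial ring in countably many indeterminates over \<open>'k\<close> lives
  there, hence, up to isomorphism, every differentially finitely generated algebra does, and
  (by cardinality, \<open>'k\<close> being infinite) every differentially finitely generated field extension.
  This loses nothing below: semi-universality only concerns such extensions, and whether
  a morphism of the functors considered is multiplicative or injective is decided on the
  differentially finitely generated algebras, because two points of \<open>G\<close> with values in \<open>B\<close> have
  values in a differentially finitely generated subalgebra of \<open>B\<close>.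
\<close>

type_synonym 'k univ = "(nat, 'k) dpoly set"


section \<open>Semi-universal differential fields\<close>

definition diff_fin_gen_field :: "('k, 'a) dalg \<Rightarrow> bool" where
  "diff_fin_gen_field L \<longleftrightarrow> (\<exists>S. finite S \<and> S \<subseteq> carrier L \<and>
     (\<forall>K. subfield K L \<and> range (emb L) \<subseteq> K \<and> S \<subseteq> K \<and> der L ` K \<subseteq> K \<longrightarrow> K = carrier L))"

definition semi_universal :: "('k::field \<Rightarrow> 'k) \<Rightarrow> ('k, 'u) dalg \<Rightarrow> bool" where
  "semi_universal d U \<longleftrightarrow> is_dalg d U \<and> field U \<and>
     (\<forall>L :: ('k, 'k univ) dalg. is_dalg d L \<and> field L \<and> diff_fin_gen_field L \<longrightarrow>
        dalg_hom L U \<noteq> {})"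


section \<open>Linear differential algebraic groups and their coordinate rings\<close>

definition lin_diff_alg_group ::
  "('u \<Rightarrow> 'u) \<Rightarrow> ('k::field \<Rightarrow> 'u) \<Rightarrow> ('u::field^'n^'n) set \<Rightarrow> bool" where
  "lin_diff_alg_group du \<iota> G \<longleftrightarrow>
     mat 1 \<in> G \<and> (\<forall>g\<in>G. \<forall>h\<in>G. g ** h \<in> G) \<and> (\<forall>g\<in>G. matrix_inv g \<in> G) \<and>
     (\<exists>S :: ('n \<times> 'n, 'k) dpoly set.
        G = {g. invertible g \<and> (\<forall>F\<in>S. dp_eval du \<iota> (\<lambda>(i, j). g $ i $ j) F = 0)})"

text \<open>
  \<open>k{X\<^sub>i\<^sub>j, 1/det}\<close> is the differential polynomial ring in the \<open>X\<^sub>i\<^sub>j\<close> (\<^term>\<open>Some (i, j)\<close>) and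
  one more indeterminate \<open>T\<close> (\<^term>\<open>None\<close>) modulo the differential ideal generated by
  \<open>T \<cdot> det X - 1\<close>. That ideal vanishes at the points \<open>(g, 1 / det g)\<close>, so the coordinate ring is
  the quotient of the polynomial ring in \<open>X\<close> and \<open>T\<close> by all differential polynomials
  vanishing at these points for \<open>g \<in> G\<close>.
\<close>

type_synonym ('n, 'k) gl_dpoly = "(('n \<times> 'n) option, 'k) dpoly"

definition gl_coord :: "'u::field^'n^'n \<Rightarrow> ('n \<times> 'n) option \<Rightarrow> 'u" where
  "gl_coord g v = (case v of None \<Rightarrow> inverse (det g) | Some (i, j) \<Rightarrow> g $ i $ j)"

definition van_ideal ::
  "('u \<Rightarrow> 'u) \<Rightarrow> ('k::field \<Rightarrow> 'u) \<Rightarrow> ('u::field^'n^'n) set \<Rightarrow> ('n, 'k) gl_dpoly set" where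
  "van_ideal du \<iota> G = {F. \<forall>g\<in>G. dp_eval du \<iota> (gl_coord g) F = 0}"

definition coord_ring ::
  "('k::field \<Rightarrow> 'k) \<Rightarrow> ('u \<Rightarrow> 'u) \<Rightarrow> ('k \<Rightarrow> 'u) \<Rightarrow> ('u::field^'n^'n) set \<Rightarrow>
    ('k, ('n, 'k) gl_dpoly set) dalg" where
  "coord_ring d du \<iota> G =
     ring.extend (cring_class_ops Quot van_ideal du \<iota> G)
       (dalg.fields
         (\<lambda>C. \<Union>F\<in>C. van_ideal du \<iota> G +>\<^bsub>cring_class_ops\<^esub> dp_der d F)
         (\<lambda>c. van_ideal du \<iota> G +>\<^bsub>cring_class_ops\<^esub> dp_const c))"

definition coord_mat ::
  "('u \<Rightarrow> 'u) \<Rightarrow> ('k::field \<Rightarrow> 'u) \<Rightarrow> ('u::field^'n^'n) set \<Rightarrow> 'n \<Rightarrow> 'n \<Rightarrow> ('n, 'k) gl_dpoly set" where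
  "coord_mat du \<iota> G i j = van_ideal du \<iota> G +>\<^bsub>cring_class_ops\<^esub> dp_var (Some (i, j), 0)"


section \<open>The group functors\<close>

text \<open>
  The group \<open>G(B) = Hom(A, B)\<close>. A point is determined by its values on the matrix \<open>x\<close> of coordinate
  functions, and multiplication of points is matrix multiplication of these values (that is, the
  comultiplication sends \<open>x\<^sub>i\<^sub>j\<close> to \<open>\<Sum>\<^sub>k x\<^sub>i\<^sub>k \<otimes> x\<^sub>k\<^sub>j\<close>).
\<close>

definition points ::
  "('k, 'a) dalg \<Rightarrow> ('n::finite \<Rightarrow> 'n \<Rightarrow> 'a) \<Rightarrow> ('k, 'b) dalg \<Rightarrow> ('a \<Rightarrow> 'b) monoid" where
  "points A x B = \<lparr>carrier = dalg_hom A B,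
     mult = (\<lambda>g h. THE l. l \<in> dalg_hom A B \<and>
       (\<forall>i j. l (x i j) = (\<Oplus>\<^bsub>B\<^esub>k\<in>UNIV. g (x i k) \<otimes>\<^bsub>B\<^esub> h (x k j)))),
     one = (THE l. l \<in> dalg_hom A B \<and>
       (\<forall>i j. l (x i j) = (if i = j then \<one>\<^bsub>B\<^esub> else \<zero>\<^bsub>B\<^esub>)))\<rparr>"

definition mat_monoid :: "'i set \<Rightarrow> ('b, 'm) ring_scheme \<Rightarrow> ('i \<times> 'i \<Rightarrow> 'b) monoid" where
  "mat_monoid I B = \<lparr>carrier = (I \<times> I \<rightarrow>\<^sub>E carrier B),
     mult = (\<lambda>M N. \<lambda>(i, j)\<in>I \<times> I. \<Oplus>\<^bsub>B\<^esub>k\<in>I. M (i, k) \<otimes>\<^bsub>B\<^esub> N (k, j)),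
     one = (\<lambda>(i, j)\<in>I \<times> I. if i = j then \<one>\<^bsub>B\<^esub> else \<zero>\<^bsub>B\<^esub>)\<rparr>"

definition GL :: "'i set \<Rightarrow> ('b, 'm) ring_scheme \<Rightarrow> ('i \<times> 'i \<Rightarrow> 'b) monoid" where
  "GL I B = units_of (mat_monoid I B)"


section \<open>Differential representations\<close>

text \<open>
  A representation on a vector space with basis \<open>(v\<^sub>i)\<close>, \<open>i \<in> basis V\<close>, is given by the elements
  \<open>coef V (i, j) = a\<^sub>i\<^sub>j\<close> of the coordinate ring \<open>A\<close> with \<open>\<rho>(v\<^sub>j) = \<Sum>\<^sub>i v\<^sub>i \<otimes> a\<^sub>i\<^sub>j\<close>. By the Yoneda lemma
  such a matrix is the same as a natural family of maps from \<open>G(B)\<close> to matrices over \<open>B\<close>, namely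
  \<open>g \<mapsto> (g(a\<^sub>i\<^sub>j))\<close>.
\<close>

record ('i, 'a) rep =
  basis :: "'i set"
  coef :: "'i \<times> 'i \<Rightarrow> 'a"

definition act :: "('i, 'a) rep \<Rightarrow> ('a \<Rightarrow> 'b) \<Rightarrow> 'i \<times> 'i \<Rightarrow> 'b" where
  "act V g = restrict (\<lambda>p. g (coef V p)) (basis V \<times> basis V)"

definition diff_rep ::
  "('k::field \<Rightarrow> 'k) \<Rightarrow> ('k, 'a) dalg \<Rightarrow> ('n::finite \<Rightarrow> 'n \<Rightarrow> 'a) \<Rightarrow> ('i, 'a) rep \<Rightarrow> bool" where
  "diff_rep d A x V \<longleftrightarrow> finite (basis V) \<and> coef V \<in> basis V \<times> basis V \<rightarrow> carrier A \<and>
     (\<forall>B :: ('k, 'k univ) dalg. is_dalg d B \<longrightarrow> act V \<in> hom (points A x B) (GL (basis V) B))"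

definition faithful_rep ::
  "('k::field \<Rightarrow> 'k) \<Rightarrow> ('k, 'a) dalg \<Rightarrow> ('n::finite \<Rightarrow> 'n \<Rightarrow> 'a) \<Rightarrow> ('i, 'a) rep \<Rightarrow> bool" where
  "faithful_rep d A x V \<longleftrightarrow>
     (\<forall>B :: ('k, 'k univ) dalg. is_dalg d B \<longrightarrow> inj_on (act V) (carrier (points A x B)))"

text \<open>The contragredient representation \<open>g \<mapsto> (g\<^sup>-\<^sup>1)\<^sup>T\<close>, in the dual basis.\<close>

definition dual_rep :: "('k, 'a) dalg \<Rightarrow> ('i, 'a) rep \<Rightarrow> ('i, 'a) rep" where
  "dual_rep A V = \<lparr>basis = basis V,
     coef = (\<lambda>(i, j).
       (inv\<^bsub>mat_monoid (basis V) A\<^esub> (restrict (coef V) (basis V \<times> basis V))) (j, i))\<rparr>"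

text \<open>The index \<open>(q, i)\<close> stands for the basis vector \<open>\<partial>\<^sup>q v\<^sub>i\<close>.\<close>

definition prolong :: "('k, 'a) dalg \<Rightarrow> nat \<Rightarrow> ('i, 'a) rep \<Rightarrow> (nat \<times> 'i, 'a) rep" where
  "prolong A p V = \<lparr>basis = {..p} \<times> basis V,
     coef = (\<lambda>((q, i), (m, j)).
       if q \<le> m then add_pow A (m choose q) ((der A ^^ (m - q)) (coef V (i, j)))
       else \<zero>\<^bsub>A\<^esub>)\<rparr>"

text \<open>
  Tensor product of a list of representations, in the basis of pure tensors of basis vectors.
  The empty tensor product is the trivial one-dimensional representation.
\<close>

primrec tensor_coef ::
  "('k, 'a) dalg \<Rightarrow> ('i, 'a) rep list \<Rightarrow> 'i list \<Rightarrow> 'i list \<Rightarrow> 'a" where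
  "tensor_coef A [] is js = \<one>\<^bsub>A\<^esub>"
| "tensor_coef A (V # Vs) is js =
     coef V (hd is, hd js) \<otimes>\<^bsub>A\<^esub> tensor_coef A Vs (tl is) (tl js)"

definition tensor_list :: "('k, 'a) dalg \<Rightarrow> ('i, 'a) rep list \<Rightarrow> ('i list, 'a) rep" where
  "tensor_list A Vs = \<lparr>basis = listset (map basis Vs),
     coef = (\<lambda>(is, js). tensor_coef A Vs is js)\<rparr>"

definition tensor ::
  "('k, 'a) dalg \<Rightarrow> ('i, 'a) rep \<Rightarrow> ('j, 'a) rep \<Rightarrow> ('i \<times> 'j, 'a) rep" where
  "tensor A V W = \<lparr>basis = basis V \<times> basis W,
     coef = (\<lambda>((i, i'), (j, j')). coef V (i, j) \<otimes>\<^bsub>A\<^esub> coef W (i', j'))\<rparr>"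

definition mixed_tensor ::
  "('k, 'a) dalg \<Rightarrow> ('i, 'a) rep \<Rightarrow> nat list \<Rightarrow> nat \<Rightarrow> ((nat \<times> 'i) list \<times> 'i list, 'a) rep" where
  "mixed_tensor A V ps l =
     tensor A (tensor_list A (map (\<lambda>p. prolong A p V) ps))
              (tensor_list A (replicate l (dual_rep A V)))"

definition direct_sum :: "('k, 'a) dalg \<Rightarrow> ('i, 'a) rep list \<Rightarrow> (nat \<times> 'i, 'a) rep" where
  "direct_sum A Vs = \<lparr>basis = (SIGMA s:{..<length Vs}. basis (Vs ! s)),
     coef = (\<lambda>((s, i), (t, j)). if s = t then coef (Vs ! s) (i, j) else \<zero>\<^bsub>A\<^esub>)\<rparr>"


section \<open>Subquotients\<close>

text \<open>
  The underlying space of \<open>V\<close> consists of the coordinate vectors supported on \<open>basis V\<close>; likewise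
  \<open>V \<otimes> A\<close> consists of extensional functions from \<open>basis V\<close> to \<open>A\<close>, and \<open>n \<otimes> \<alpha>\<close> is the function
  \<open>i \<mapsto> n\<^sub>i \<alpha>\<close>.
\<close>

definition vecs :: "('i, 'a) rep \<Rightarrow> ('i \<Rightarrow> 'k::field) set" where
  "vecs V = {v. \<forall>i. i \<notin> basis V \<longrightarrow> v i = 0}"

definition coact ::
  "('k, 'a) dalg \<Rightarrow> ('i, 'a) rep \<Rightarrow> ('i \<Rightarrow> 'k::field) \<Rightarrow> 'i \<Rightarrow> 'a" where
  "coact A V v = (\<lambda>i\<in>basis V. \<Oplus>\<^bsub>A\<^esub>j\<in>basis V. emb A (v j) \<otimes>\<^bsub>A\<^esub> coef V (i, j))"

definition tensor_sum ::
  "('k, 'a) dalg \<Rightarrow> ('i, 'a) rep \<Rightarrow> 's set \<Rightarrow> ('s \<Rightarrow> 'i \<Rightarrow> 'k::field) \<Rightarrow> ('s \<Rightarrow> 'a) \<Rightarrow> 'i \<Rightarrow> 'a" where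
  "tensor_sum A V S n \<alpha> = (\<lambda>i\<in>basis V. \<Oplus>\<^bsub>A\<^esub>s\<in>S. emb A (n s i) \<otimes>\<^bsub>A\<^esub> \<alpha> s)"

text \<open>A subcomodule: a subspace \<open>N\<close> with \<open>\<rho>(N) \<subseteq> N \<otimes> A\<close>.\<close>

definition subrep :: "('k::field, 'a) dalg \<Rightarrow> ('i, 'a) rep \<Rightarrow> ('i \<Rightarrow> 'k) set \<Rightarrow> bool" where
  "subrep A V N \<longleftrightarrow> N \<subseteq> vecs V \<and> (\<lambda>_. 0) \<in> N \<and>
     (\<forall>v\<in>N. \<forall>w\<in>N. (\<lambda>i. v i + w i) \<in> N) \<and> (\<forall>c. \<forall>v\<in>N. (\<lambda>i. c * v i) \<in> N) \<and>
     (\<forall>v\<in>N. \<exists>S \<alpha>. finite S \<and> S \<subseteq> N \<and> \<alpha> \<in> S \<rightarrow> carrier A \<and>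
        coact A V v = tensor_sum A V S (\<lambda>s. s) \<alpha>)"

text \<open>
  A homomorphism from the subcomodule \<open>N\<close> of \<open>V\<close> to \<open>W\<close>: a linear map with
  \<open>\<rho>(f v) = (f \<otimes> 1)(\<rho>(v))\<close>, where \<open>(f \<otimes> 1)(\<Sum>\<^sub>s s \<otimes> \<alpha>\<^sub>s) = \<Sum>\<^sub>s f(s) \<otimes> \<alpha>\<^sub>s\<close>.
\<close>

definition subrep_hom ::
  "('k::field, 'a) dalg \<Rightarrow> ('i, 'a) rep \<Rightarrow> ('i \<Rightarrow> 'k) set \<Rightarrow> ('j, 'a) rep \<Rightarrow>
    (('i \<Rightarrow> 'k) \<Rightarrow> 'j \<Rightarrow> 'k) \<Rightarrow> bool" where
  "subrep_hom A V N W f \<longleftrightarrow> f \<in> N \<rightarrow> vecs W \<and>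
     (\<forall>v\<in>N. \<forall>w\<in>N. f (\<lambda>i. v i + w i) = (\<lambda>j. f v j + f w j)) \<and>
     (\<forall>c. \<forall>v\<in>N. f (\<lambda>i. c * v i) = (\<lambda>j. c * f v j)) \<and>
     (\<forall>v\<in>N. \<forall>S \<alpha>. finite S \<and> S \<subseteq> N \<and> \<alpha> \<in> S \<rightarrow> carrier A \<and>
        coact A V v = tensor_sum A V S (\<lambda>s. s) \<alpha> \<longrightarrow>
        coact A W (f v) = tensor_sum A W S f \<alpha>)"

definition subquotient :: "('k::field, 'a) dalg \<Rightarrow> ('j, 'a) rep \<Rightarrow> ('i, 'a) rep \<Rightarrow> bool" where
  "subquotient A W V \<longleftrightarrow>
     (\<exists>N f. subrep A V N \<and> subrep_hom A V N W f \<and> f ` N = vecs W)"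

end

theory Submission
  imports Defs "HOL-Library.Function_Algebras"
begin

text \<open>
  Elements of the coordinate ring \<open>A\<close> are handled as functions on \<open>G\<close>. Let \<open>R \<subseteq> A\<close> be the
  differential algebra generated by the matrix coefficients of \<open>V\<close> and of its dual, that is, the
  span of the coefficients of the mixed tensor modules. The point is that all coefficients \<open>u\<^sub>i\<^sub>j\<close>
  of \<open>U\<close> lie in \<open>R\<close>; then \<open>U\<close> is a quotient of a submodule of a sum of mixed tensor modules, both
  being mapped to powers of \<open>A\<close> by rows of their matrices.

  Faithfulness says that \<open>A\<close> is an epimorphic extension of \<open>R\<close>: \<open>f \<otimes> 1 = 1 \<otimes> f\<close> in \<open>A \<otimes>\<^bsub>R\<^esub> A\<close> for all
  \<open>f \<in> A\<close>. At a generic point of \<open>R\<close> this forces every \<open>f\<close> to be a fraction, so some \<open>c \<noteq> 0\<close> in \<open>R\<close>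
  has all \<open>c u\<^sub>i\<^sub>j\<close> in \<open>R\<close>. The \<open>c\<close> with this property form an ideal stable under translations by
  \<open>G\<close>, which therefore contains \<open>1\<close>.

  Functions on \<open>G\<close> that are linearly independent over \<open>k\<close> remain so over the universal field; this
  replaces tensor products of coordinate rings. It rests on the fact that \<open>u \<otimes> 1 - 1 \<otimes> u\<close> is not
  nilpotent for an element \<open>u\<close> outside the base field in characteristic \<open>0\<close>.
\<close>

section \<open>Derivations and differential polynomials\<close>

text \<open>Faithfulness is assumed only as injectivity on points, which amounts to an epimorphism
  of differential algebras, and epimorphisms need not be onto: localisations are epimorphisms too.
  So fractions are all that this hypothesis can give at first, and the group structure has to remove
  the denominators. Since \<open>G\<close> may be disconnected, neither \<open>A\<close> nor
  \<open>R\<close> need be a domain, and fractions are available only locally at one point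
  \<open>g0\<close>. Translates by points of \<open>G\<close> have coefficients in the universal
  field, which is why spans over that field appear and have to be brought back to \<open>k\<close>.
  The hypotheses on representations speak only of differential algebras with carrier in
  \<open>'k univ\<close>. Hence every algebra to which they are applied (the one generated by the
  coordinates of two points, a copy of \<open>A\<close>, the tensor square of \<open>A\<close> over
  \<open>R\<close>) is realised as a quotient of differential polynomials in indeterminates numbered
  by \<open>nat\<close>.\<close>

locale comm_derivation =
  fixes D :: "'a::comm_ring_1 \<Rightarrow> 'a"
  assumes add: "D (x + y) = D x + D y"
    and mult: "D (x * y) = D x * y + x * D y"
begin

lemma zero: "D 0 = 0"
  using add[of 0 0] by simp

lemma one: "D 1 = 0"
  using mult[of 1 1] by simp

lemma uminus: "D (- x) = - D x"
  using add[of x "- x"] by (simp add: zero add_eq_0_iff)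

lemma diff: "D (x - y) = D x - D y"
  using add[of x "- y"] by (simp add: uminus)

lemma sum: "D (sum f S) = (\<Sum>s\<in>S. D (f s))"
  by (induction S rule: infinite_finite_induct) (simp_all add: zero add)

lemma of_nat: "D (of_nat n) = 0"
  by (induction n) (simp_all add: zero add one)

lemma of_nat_mult: "D (of_nat n * x) = of_nat n * D x"
  by (simp add: mult of_nat)

lemma funpow_add: "(D ^^ n) (x + y) = (D ^^ n) x + (D ^^ n) y"
  by (induction n) (simp_all add: add)

lemma funpow_zero: "(D ^^ n) 0 = 0"
  by (induction n) (simp_all add: zero)

lemma funpow_sum: "(D ^^ n) (sum f S) = (\<Sum>s\<in>S. (D ^^ n) (f s))"
  by (induction S rule: infinite_finite_induct) (simp_all add: funpow_zero funpow_add)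

lemma funpow_mult:
  "(D ^^ n) (x * y) = (\<Sum>k\<le>n. of_nat (n choose k) * ((D ^^ k) x * (D ^^ (n - k)) y))"
proof (induction n)
  case 0
  then show ?case by simp
next
  case (Suc n)
  let ?t = "\<lambda>k. (D ^^ k) x * (D ^^ (Suc n - k)) y"
  have "(D ^^ Suc n) (x * y) =
      (\<Sum>k\<le>n. of_nat (n choose k) * D ((D ^^ k) x * (D ^^ (n - k)) y))"
    by (simp add: Suc.IH sum of_nat_mult)
  also have "\<dots> = (\<Sum>k\<le>n. of_nat (n choose k) * ?t (Suc k) + of_nat (n choose k) * ?t k)"
    by (rule sum.cong) (simp_all add: mult Suc_diff_le distrib_left)
  also have "\<dots> = (\<Sum>k\<le>n. of_nat (n choose k) * ?t (Suc k)) + (\<Sum>k\<le>Suc n. of_nat (n choose k) * ?t k)"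
    by (simp add: sum.distrib binomial_eq_0)
  also have "(\<Sum>k\<le>Suc n. of_nat (n choose k) * ?t k) =
      ?t 0 + (\<Sum>k\<le>n. of_nat (n choose Suc k) * ?t (Suc k))"
    by (subst sum.atMost_Suc_shift) simp
  also have "(\<Sum>k\<le>n. of_nat (n choose k) * ?t (Suc k)) +
      (?t 0 + (\<Sum>k\<le>n. of_nat (n choose Suc k) * ?t (Suc k))) =
      ?t 0 + (\<Sum>k\<le>n. of_nat (Suc n choose Suc k) * ?t (Suc k))"
    by (simp add: sum.distrib distrib_right)
  also have "\<dots> = (\<Sum>k\<le>Suc n. of_nat (Suc n choose k) * ?t k)"
    by (subst sum.atMost_Suc_shift) simp
  finally show ?case .
qed

end

lemma comm_derivation_iff: "derivation cring_class_ops D \<longleftrightarrow> comm_derivation D"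
  by (auto simp: derivation_def comm_derivation_def class_simps)

section \<open>Evaluation of differential polynomials\<close>

definition monom_eval :: "('w \<Rightarrow> 'a::comm_ring_1) \<Rightarrow> ('w \<Rightarrow>\<^sub>0 nat) \<Rightarrow> 'a" where
  "monom_eval y m = (\<Prod>w\<in>Poly_Mapping.keys m. y w ^ Poly_Mapping.lookup m w)"

lemma monom_eval_superset:
  assumes "finite S" "Poly_Mapping.keys m \<subseteq> S"
  shows "monom_eval y m = (\<Prod>w\<in>S. y w ^ Poly_Mapping.lookup m w)"
  unfolding monom_eval_def
  by (rule prod.mono_neutral_left) (use assms in \<open>auto simp: in_keys_iff\<close>)

lemma monom_eval_zero [simp]: "monom_eval y 0 = 1"
  by (simp add: monom_eval_def)

lemma monom_eval_single [simp]: "monom_eval y (Poly_Mapping.single w n) = y w ^ n"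
  by (cases "n = 0") (simp_all add: monom_eval_def)

lemma monom_eval_add: "monom_eval y (m + m') = monom_eval y m * monom_eval y m'"
proof -
  let ?S = "Poly_Mapping.keys m \<union> Poly_Mapping.keys m'"
  have "monom_eval y (m + m') = (\<Prod>w\<in>?S. y w ^ Poly_Mapping.lookup (m + m') w)"
    by (rule monom_eval_superset) (auto dest: subsetD[OF Poly_Mapping.keys_add])
  then show ?thesis
    by (simp add: monom_eval_superset[of ?S] lookup_add power_add prod.distrib)
qed

lemma poly_mapping_sum_single:
  fixes F :: "'a \<Rightarrow>\<^sub>0 'b::comm_monoid_add"
  shows "F = (\<Sum>m\<in>Poly_Mapping.keys F. Poly_Mapping.single m (Poly_Mapping.lookup F m))"
proof (rule poly_mapping_eqI)
  fix k
  show "Poly_Mapping.lookup F k =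
    Poly_Mapping.lookup (\<Sum>m\<in>Poly_Mapping.keys F. Poly_Mapping.single m (Poly_Mapping.lookup F m)) k"
    by (cases "k \<in> Poly_Mapping.keys F")
      (auto simp: lookup_sum lookup_single when_def in_keys_iff sum.delta)
qed

lemma poly_mapping_add_induct [case_names zero single add]:
  fixes F :: "'a \<Rightarrow>\<^sub>0 'b::comm_monoid_add"
  assumes "P 0" "\<And>m c. P (Poly_Mapping.single m c)" "\<And>F G. P F \<Longrightarrow> P G \<Longrightarrow> P (F + G)"
  shows "P F"
proof -
  have "P (\<Sum>m\<in>S. Poly_Mapping.single m (Poly_Mapping.lookup F m))" if "finite S" for S
    using that by induction (simp_all add: assms)
  from this[of "Poly_Mapping.keys F"] show ?thesis
    by (simp flip: poly_mapping_sum_single)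
qed

lemma dp_const_zero [simp]: "dp_const 0 = 0"
  by (simp add: dp_const_def)

lemma dp_const_one [simp]: "dp_const 1 = 1"
  by (simp add: dp_const_def)

lemma dp_const_add: "dp_const (a + b) = dp_const a + dp_const b"
  by (simp add: dp_const_def single_add)

lemma dp_const_mult: "dp_const (a * b) = dp_const a * dp_const b"
  by (simp add: dp_const_def mult_single)

lemma dp_var_power: "(dp_var w :: ('v, 'k::comm_ring_1) dpoly) ^ n = Poly_Mapping.single (Poly_Mapping.single w n) 1"
proof (induction n)
  case (Suc n)
  have "(dp_var w :: ('v, 'k) dpoly) ^ Suc n = dp_var w * Poly_Mapping.single (Poly_Mapping.single w n) 1"
    by (simp add: Suc.IH)
  also have "\<dots> = Poly_Mapping.single (Poly_Mapping.single w 1 + Poly_Mapping.single w n) 1"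
    by (simp add: dp_var_def mult_single)
  finally show ?case by (simp flip: single_add)
qed simp

text \<open>All derivatives of the indeterminates count as variables, so no case for the derivation
  arises: an identity between ring homomorphisms reduces to constants and variables.\<close>

lemma dpoly_induct [case_names const var add mult]:
  assumes const: "\<And>c. P (dp_const c)" and var: "\<And>w. P (dp_var w)"
    and add: "\<And>F G. P F \<Longrightarrow> P G \<Longrightarrow> P (F + G)" and mult: "\<And>F G. P F \<Longrightarrow> P G \<Longrightarrow> P (F * G)"
  shows "P F"
proof -
  have monom: "P (Poly_Mapping.single m 1)" for m
  proof (induction m rule: poly_mapping_add_induct)
    case zero
    then show ?case using const[of 1] by simp
  next
    case (single w n)
    have "P (dp_var w ^ n)"
      by (induction n) (use const[of 1] in \<open>simp_all add: var mult\<close>)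
    then show ?case by (simp add: dp_var_power)
  next
    case (add m m')
    then show ?case using mult[OF add] by (simp add: mult_single)
  qed
  show ?thesis
  proof (induction F rule: poly_mapping_add_induct)
    case zero
    then show ?case using const[of 0] by simp
  next
    case (single m c)
    show ?case using mult[OF const[of c] monom[of m]] by (simp add: dp_const_def mult_single)
  next
    case (add F G)
    then show ?case by (rule assms)
  qed
qed

locale ring_embedding =
  fixes \<iota> :: "'k::comm_ring_1 \<Rightarrow> 'a::comm_ring_1"
  assumes hom_add: "\<iota> (a + b) = \<iota> a + \<iota> b"
    and hom_mult: "\<iota> (a * b) = \<iota> a * \<iota> b"
    and hom_one: "\<iota> 1 = 1"
begin

lemma hom_zero: "\<iota> 0 = 0"
  using hom_add[of 0 0] by simp

lemma hom_uminus: "\<iota> (- a) = - \<iota> a"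
  using hom_add[of a "- a"] by (simp add: hom_zero add_eq_0_iff)

lemma hom_diff: "\<iota> (a - b) = \<iota> a - \<iota> b"
  using hom_add[of a "- b"] by (simp add: hom_uminus)

lemma hom_sum: "\<iota> (sum f S) = (\<Sum>s\<in>S. \<iota> (f s))"
  by (induction S rule: infinite_finite_induct) (simp_all add: hom_zero hom_add)

lemma hom_prod: "\<iota> (prod f S) = (\<Prod>s\<in>S. \<iota> (f s))"
  by (induction S rule: infinite_finite_induct) (simp_all add: hom_one hom_mult)

lemma hom_of_nat: "\<iota> (of_nat n) = of_nat n"
  by (induction n) (simp_all add: hom_zero hom_add hom_one)

end

locale diff_ext = d: comm_derivation d + du: comm_derivation du + ring_embedding \<iota>
  for d :: "'k::comm_ring_1 \<Rightarrow> 'k" and du :: "'u::comm_ring_1 \<Rightarrow> 'u" and \<iota> +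
  assumes compat: "du (\<iota> c) = \<iota> (d c)"
begin

abbreviation "ev \<equiv> dp_eval du \<iota>"

lemma ev_eq: "ev x F = (\<Sum>m\<in>Poly_Mapping.keys F. \<iota> (Poly_Mapping.lookup F m) *
    monom_eval (\<lambda>w. (du ^^ snd w) (x (fst w))) m)"
  by (simp add: dp_eval_def monom_eval_def)

lemma ev_zero: "ev x 0 = 0"
  by (simp add: ev_eq)

lemma ev_single: "ev x (Poly_Mapping.single m c) = \<iota> c * monom_eval (\<lambda>w. (du ^^ snd w) (x (fst w))) m"
  by (cases "c = 0") (simp_all add: ev_eq hom_zero)

lemma ev_add: "ev x (F + G) = ev x F + ev x G"
  unfolding ev_eq by (rule setsum_keys_plus_distrib) (simp_all add: hom_zero hom_add distrib_right)

lemma ev_mult: "ev x (F * G) = ev x F * ev x G"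
proof (induction F rule: poly_mapping_add_induct)
  case (single m c)
  show ?case
  proof (induction G rule: poly_mapping_add_induct)
    case (single m' c')
    show ?case by (simp add: mult_single ev_single monom_eval_add hom_mult mult_ac)
  qed (simp_all add: ev_zero ev_add distrib_left)
qed (simp_all add: ev_zero ev_add distrib_right)

lemma ev_const [simp]: "ev x (dp_const c) = \<iota> c"
  by (simp add: dp_const_def ev_single)

lemma ev_var [simp]: "ev x (dp_var w) = (du ^^ snd w) (x (fst w))"
  by (simp add: dp_var_def ev_single hom_one)

lemma ring_embedding_ev: "ring_embedding (ev x)"
  using ev_const[of x 1] by unfold_locales (simp_all add: ev_add ev_mult hom_one)

sublocale ev: ring_embedding "ev x" for x
  by (rule ring_embedding_ev)

end

section \<open>The derivation on differential polynomials\<close>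

lemma dp_der_zero: "dp_der d 0 = 0"
  by (simp add: dp_der_def)

context comm_derivation
begin

lemma dp_der_add: "dp_der D (F + G) = dp_der D F + dp_der D G"
proof -
  let ?t = "\<lambda>m c. Poly_Mapping.single m (D c) +
      (\<Sum>w\<in>Poly_Mapping.keys m. Poly_Mapping.single
           (m - Poly_Mapping.single w 1 + Poly_Mapping.single (fst w, Suc (snd w)) 1)
           (of_nat (Poly_Mapping.lookup m w) * c))"
  have "(\<Sum>m\<in>Poly_Mapping.keys (F + G). ?t m (Poly_Mapping.lookup (F + G) m)) =
    (\<Sum>m\<in>Poly_Mapping.keys F. ?t m (Poly_Mapping.lookup F m)) +
    (\<Sum>m\<in>Poly_Mapping.keys G. ?t m (Poly_Mapping.lookup G m))"
    by (rule setsum_keys_plus_distrib)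
      (simp_all add: zero add single_add distrib_left sum.distrib add_ac)
  then show ?thesis by (simp add: dp_der_def)
qed

lemma dp_der_single: "dp_der D (Poly_Mapping.single m c) = Poly_Mapping.single m (D c) +
      (\<Sum>w\<in>Poly_Mapping.keys m. Poly_Mapping.single
           (m - Poly_Mapping.single w 1 + Poly_Mapping.single (fst w, Suc (snd w)) 1)
           (of_nat (Poly_Mapping.lookup m w) * c))"
  by (cases "c = 0") (simp_all add: dp_der_def zero)

lemma dp_der_mult_single:
  "dp_der D (Poly_Mapping.single m c * Poly_Mapping.single m' c') =
    dp_der D (Poly_Mapping.single m c) * Poly_Mapping.single m' c' +
    Poly_Mapping.single m c * dp_der D (Poly_Mapping.single m' c')"
proof -
  let ?S = "Poly_Mapping.keys m \<union> Poly_Mapping.keys m'"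
  let ?t = "\<lambda>m w. m - Poly_Mapping.single w 1 + Poly_Mapping.single (fst w, Suc (snd w)) (1::nat)"
  let ?s = "\<lambda>m c S. (\<Sum>w\<in>S. Poly_Mapping.single (?t m w) (of_nat (Poly_Mapping.lookup m w) * c))"
  have ext: "?s n b (Poly_Mapping.keys n) = ?s n b S"
    if "finite S" "Poly_Mapping.keys n \<subseteq> S" for S n b
    by (rule sum.mono_neutral_left) (use that in \<open>auto simp: in_keys_iff\<close>)
  \<comment> \<open>Subtraction of exponents is truncated. The two exponents can differ only if
    \<open>w\<close> does not occur in \<open>n\<close>, and then the coefficient is zero.\<close>
  have split: "Poly_Mapping.single (?t (n + n') w) (of_nat (Poly_Mapping.lookup n w) * b) =
      Poly_Mapping.single (?t n w + n') (of_nat (Poly_Mapping.lookup n w) * b)" for n n' w b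
  proof (cases "Poly_Mapping.lookup n w = 0")
    case False
    then have "n + n' - Poly_Mapping.single w 1 = n - Poly_Mapping.single w 1 + n'"
      by (intro poly_mapping_eqI) (auto simp: lookup_add lookup_minus lookup_single when_def)
    then show ?thesis by (simp add: add_ac)
  qed simp
  have "?s (m + m') (c * c') (Poly_Mapping.keys (m + m')) = ?s (m + m') (c * c') ?S"
    by (rule ext) (auto dest: subsetD[OF Poly_Mapping.keys_add])
  also have "\<dots> = (\<Sum>w\<in>?S. Poly_Mapping.single (?t (m + m') w) (of_nat (Poly_Mapping.lookup m w) * (c * c')) +
      Poly_Mapping.single (?t (m' + m) w) (of_nat (Poly_Mapping.lookup m' w) * (c * c')))"
    by (simp add: lookup_add distrib_right single_add add.commute)
  also have "\<dots> = (\<Sum>w\<in>?S. Poly_Mapping.single (?t m w) (of_nat (Poly_Mapping.lookup m w) * c) * Poly_Mapping.single m' c' +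
      Poly_Mapping.single m c * Poly_Mapping.single (?t m' w) (of_nat (Poly_Mapping.lookup m' w) * c'))"
    by (simp only: split) (simp add: mult_single mult_ac add_ac)
  also have "\<dots> = ?s m c ?S * Poly_Mapping.single m' c' + Poly_Mapping.single m c * ?s m' c' ?S"
    by (simp add: sum.distrib sum_distrib_left sum_distrib_right)
  also have "\<dots> = ?s m c (Poly_Mapping.keys m) * Poly_Mapping.single m' c' +
      Poly_Mapping.single m c * ?s m' c' (Poly_Mapping.keys m')"
    using ext[of ?S m c] ext[of ?S m' c'] by simp
  finally show ?thesis
    by (simp add: mult_single dp_der_single mult single_add distrib_left distrib_right add_ac)
qed

lemma comm_derivation_dp_der: "comm_derivation (dp_der D)"
proof
  fix F G :: "('v, 'a) dpoly"
  show "dp_der D (F + G) = dp_der D F + dp_der D G" by (rule dp_der_add)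
  show "dp_der D (F * G) = dp_der D F * G + F * dp_der D G"
  proof (induction F rule: poly_mapping_add_induct)
    case (single m c)
    show ?case
    proof (induction G rule: poly_mapping_add_induct)
      case (single m' c')
      show ?case by (rule dp_der_mult_single)
    qed (simp_all add: dp_der_zero dp_der_add distrib_left add_ac)
  qed (simp_all add: dp_der_zero dp_der_add distrib_right add_ac)
qed

lemma dp_der_const [simp]: "dp_der D (dp_const c) = dp_const (D c)"
  by (simp add: dp_const_def dp_der_single)

lemma dp_der_var [simp]: "dp_der D (dp_var (v, q)) = dp_var (v, Suc q)"
  by (simp add: dp_var_def dp_der_single one)

lemma dp_der_funpow_var [simp]: "(dp_der D ^^ n) (dp_var (v, q)) = dp_var (v, n + q)"
  by (induction n) simp_all

lemma diff_ext_dp_const: "diff_ext D (dp_der D) dp_const"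
proof -
  interpret p: comm_derivation "dp_der D" by (rule comm_derivation_dp_der)
  show ?thesis by unfold_locales (simp_all add: dp_const_add dp_const_mult)
qed

end

text \<open>Substitution is evaluation with values in another ring of differential polynomials, so
  all evaluation lemmas apply to it, and \<open>ev_subst\<close> is the composition law.\<close>

abbreviation dp_subst :: "('k \<Rightarrow> 'k) \<Rightarrow> ('v \<Rightarrow> ('w, 'k::comm_ring_1) dpoly) \<Rightarrow> ('v, 'k) dpoly \<Rightarrow> ('w, 'k) dpoly" where
  "dp_subst d \<equiv> dp_eval (dp_der d) dp_const"

context diff_ext
begin

lemma ev_der: "ev x (dp_der d F) = du (ev x F)"
proof (induction F rule: dpoly_induct)
  case (const c)
  then show ?case by (simp add: compat)
next
  case (var w)
  then show ?case by (cases w) simp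
next
  case (add F G)
  then show ?case by (simp add: ev_add d.dp_der_add du.add)
next
  case (mult F G)
  interpret p: comm_derivation "dp_der d" by (rule d.comm_derivation_dp_der)
  from mult show ?case by (simp add: ev_add ev_mult p.mult du.mult)
qed

lemma ev_der_funpow: "ev x ((dp_der d ^^ n) F) = (du ^^ n) (ev x F)"
  by (induction n) (simp_all add: ev_der)

lemma ev_subst: "ev x (dp_subst d z F) = ev (\<lambda>v. ev x (z v)) F"
proof -
  interpret p: diff_ext d "dp_der d" dp_const by (rule d.diff_ext_dp_const)
  show ?thesis
    by (induction F rule: dpoly_induct)
      (simp_all add: ev_add ev_mult p.ev_add p.ev_mult ev_der_funpow)
qed

end

section \<open>Prime differential ideals\<close>

definition is_ideal :: "'a::comm_ring_1 set \<Rightarrow> bool" where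
  "is_ideal I \<longleftrightarrow> 0 \<in> I \<and> (\<forall>a\<in>I. \<forall>b\<in>I. a + b \<in> I) \<and> (\<forall>a\<in>I. \<forall>r. r * a \<in> I)"

lemma is_ideal_zero: "is_ideal I \<Longrightarrow> 0 \<in> I"
  and is_ideal_add: "is_ideal I \<Longrightarrow> a \<in> I \<Longrightarrow> b \<in> I \<Longrightarrow> a + b \<in> I"
  and is_ideal_mult: "is_ideal I \<Longrightarrow> a \<in> I \<Longrightarrow> r * a \<in> I"
  and is_ideal_mult_right: "is_ideal I \<Longrightarrow> a \<in> I \<Longrightarrow> a * r \<in> I"
  by (auto simp: is_ideal_def mult.commute)

lemma is_ideal_uminus: "is_ideal I \<Longrightarrow> a \<in> I \<Longrightarrow> - a \<in> I"
  using is_ideal_mult[of I a "-1"] by simp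

lemma is_ideal_diff: "is_ideal I \<Longrightarrow> a \<in> I \<Longrightarrow> b \<in> I \<Longrightarrow> a - b \<in> I"
  using is_ideal_add[of I a "- b"] is_ideal_uminus[of I b] by simp

lemma is_ideal_sum: "is_ideal I \<Longrightarrow> (\<And>s. s \<in> S \<Longrightarrow> f s \<in> I) \<Longrightarrow> sum f S \<in> I"
  by (induction S rule: infinite_finite_induct) (auto intro: is_ideal_zero is_ideal_add)

lemma is_ideal_union_chain:
  assumes "\<C> \<noteq> {}" "subset.chain \<A> \<C>" "\<And>I. I \<in> \<A> \<Longrightarrow> is_ideal I"
  shows "is_ideal (\<Union>\<C>)"
proof -
  have ideal: "is_ideal I" if "I \<in> \<C>" for I
    using assms that by (auto simp: subset.chain_def)
  have "a + b \<in> \<Union>\<C>" if "a \<in> I" "I \<in> \<C>" "b \<in> J" "J \<in> \<C>" for a b I J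
  proof -
    have "I \<subseteq> J \<or> J \<subseteq> I"
      using assms(2) that by (auto simp: subset.chain_def)
    then show ?thesis
      using that is_ideal_add[OF ideal[of I], of a b] is_ideal_add[OF ideal[of J], of a b] by blast
  qed
  then show ?thesis
    using assms(1) ideal unfolding is_ideal_def by (meson UnionE UnionI ex_in_conv)
qed

text \<open>Krull's argument: if neither factor lies in \<open>P\<close>, the ideals generated by
  \<open>P\<close> and either factor meet \<open>M\<close>, and the product of the two elements
  found lies both in \<open>M\<close> and in \<open>P\<close>.\<close>

lemma maximal_ideal_avoiding_prime:
  assumes P: "is_ideal P" "P \<inter> M = {}"
    and max: "\<And>Q. is_ideal Q \<Longrightarrow> P \<subseteq> Q \<Longrightarrow> Q \<inter> M = {} \<Longrightarrow> Q = P"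
    and M: "\<And>a b. a \<in> M \<Longrightarrow> b \<in> M \<Longrightarrow> a * b \<in> M"
    and ab: "a * b \<in> P"
  shows "a \<in> P \<or> b \<in> P"
proof (rule ccontr)
  have meet: "\<exists>p\<in>P. \<exists>r. p + r * c \<in> M" if "c \<notin> P" for c
  proof -
    let ?Q = "{p + r * c |p r. p \<in> P}"
    have "is_ideal ?Q"
      unfolding is_ideal_def
    proof (intro conjI ballI allI)
      have "0 = 0 + 0 * c" by simp
      then show "0 \<in> ?Q" using is_ideal_zero[OF P(1)] by blast
    next
      fix x y assume "x \<in> ?Q" "y \<in> ?Q"
      then obtain p r p' r' where "x = p + r * c" "y = p' + r' * c" "p \<in> P" "p' \<in> P" by auto
      then have "x + y = (p + p') + (r + r') * c" "p + p' \<in> P"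
        by (simp_all add: is_ideal_add[OF P(1)] algebra_simps)
      then show "x + y \<in> ?Q" by blast
    next
      fix x s assume "x \<in> ?Q"
      then obtain p r where "x = p + r * c" "p \<in> P" by auto
      then have "s * x = s * p + (s * r) * c" "s * p \<in> P"
        by (simp_all add: is_ideal_mult[OF P(1)] distrib_left mult.assoc)
      then show "s * x \<in> ?Q" by blast
    qed
    moreover have "P \<subseteq> ?Q"
    proof
      fix p assume "p \<in> P"
      moreover have "p = p + 0 * c" by simp
      ultimately show "p \<in> ?Q" by blast
    qed
    moreover have "c = 0 + 1 * c" by simp
    then have "c \<in> ?Q" using is_ideal_zero[OF P(1)] by blast
    ultimately have "?Q \<inter> M \<noteq> {}" using max[of ?Q] that by blast
    then show ?thesis by auto
  qed
  assume "\<not> (a \<in> P \<or> b \<in> P)"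
  then obtain p r p' r' where p: "p \<in> P" "p' \<in> P" and "p + r * a \<in> M" "p' + r' * b \<in> M"
    using meet by meson
  then have "(p + r * a) * (p' + r' * b) \<in> M" by (intro M)
  moreover have "(p + r * a) * (p' + r' * b) = (p' + r' * b) * p + ((r * a) * p' + (r * r') * (a * b))"
    by (simp add: algebra_simps)
  then have "(p + r * a) * (p' + r' * b) \<in> P"
    using p ab by (simp add: is_ideal_add[OF P(1)] is_ideal_mult[OF P(1)])
  ultimately show False using P(2) by blast
qed

text \<open>
  In characteristic zero the largest differential ideal \<open>{a. \<forall>n. D\<^sup>n a \<in> P}\<close> inside a prime ideal
  \<open>P\<close> is prime: if \<open>D\<^sup>i a\<close> and \<open>D\<^sup>j b\<close> are the first derivatives outside \<open>P\<close>, then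
  \<open>D\<^sup>i\<^sup>+\<^sup>j (a b)\<close> is a positive multiple of \<open>D\<^sup>i a \<cdot> D\<^sup>j b\<close> modulo \<open>P\<close>.
\<close>

lemma (in comm_derivation) ex_prime_diff_ideal_avoiding:
  assumes I: "is_ideal I" "\<And>a. a \<in> I \<Longrightarrow> D a \<in> I" "I \<inter> M = {}"
    and M: "1 \<in> M" "\<And>a b. a \<in> M \<Longrightarrow> b \<in> M \<Longrightarrow> a * b \<in> M"
    and char: "\<And>n. n > 0 \<Longrightarrow> \<exists>c. of_nat n * c = (1 :: 'a)"
  shows "\<exists>P. is_ideal P \<and> (\<forall>a\<in>P. D a \<in> P) \<and> I \<subseteq> P \<and> P \<inter> M = {} \<and>
    (\<forall>a b. a * b \<in> P \<longrightarrow> a \<in> P \<or> b \<in> P)"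
proof -
  let ?A = "{J. is_ideal J \<and> I \<subseteq> J \<and> J \<inter> M = {}}"
  have "\<exists>P\<in>?A. \<forall>X\<in>?A. P \<subseteq> X \<longrightarrow> X = P"
  proof (rule subset_Zorn_nonempty)
    show "?A \<noteq> {}" using I by blast
    fix \<C> assume \<C>: "\<C> \<noteq> {}" "subset.chain ?A \<C>"
    then have "is_ideal (\<Union>\<C>)" by (rule is_ideal_union_chain) auto
    then show "\<Union>\<C> \<in> ?A" using \<C> unfolding subset.chain_def by fast
  qed
  then obtain P where P: "is_ideal P" "I \<subseteq> P" "P \<inter> M = {}"
    and max: "\<And>Q. is_ideal Q \<Longrightarrow> P \<subseteq> Q \<Longrightarrow> Q \<inter> M = {} \<Longrightarrow> Q = P"
    by auto
  have prime: "a \<in> P \<or> b \<in> P" if "a * b \<in> P" for a b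
    using maximal_ideal_avoiding_prime[OF P(1,3) max M(2) that] .
  define Q where "Q = {a. \<forall>n. (D ^^ n) a \<in> P}"
  have "is_ideal Q"
    unfolding is_ideal_def Q_def
    by (auto simp: funpow_zero funpow_add funpow_mult P(1)
        intro!: is_ideal_zero is_ideal_add is_ideal_sum is_ideal_mult)
  moreover have "D a \<in> Q" if "a \<in> Q" for a
  proof -
    have "(D ^^ n) (D a) \<in> P" for n
      using that unfolding Q_def by (metis (mono_tags, lifting) comp_apply funpow_Suc_right mem_Collect_eq)
    then show ?thesis by (simp add: Q_def)
  qed
  moreover have "I \<subseteq> Q"
  proof
    fix a assume "a \<in> I"
    then have "(D ^^ n) a \<in> I" for n by (induction n) (auto intro: I)
    then show "a \<in> Q" using P(2) by (auto simp: Q_def)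
  qed
  moreover have "Q \<subseteq> P" unfolding Q_def by (auto dest: spec[of _ 0])
  then have "Q \<inter> M = {}" using P by blast
  moreover have "a \<in> Q \<or> b \<in> Q" if "a * b \<in> Q" for a b
  proof (rule ccontr)
    assume not: "\<not> (a \<in> Q \<or> b \<in> Q)"
    define i where "i = (LEAST n. (D ^^ n) a \<notin> P)"
    define j where "j = (LEAST n. (D ^^ n) b \<notin> P)"
    have "\<exists>n. (D ^^ n) a \<notin> P" "\<exists>n. (D ^^ n) b \<notin> P"
      using not by (auto simp: Q_def)
    then have i: "(D ^^ i) a \<notin> P" and j: "(D ^^ j) b \<notin> P"
      using LeastI_ex[of "\<lambda>n. (D ^^ n) a \<notin> P"] LeastI_ex[of "\<lambda>n. (D ^^ n) b \<notin> P"]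
      unfolding i_def j_def by auto
    have i_less: "(D ^^ n) a \<in> P" if "n < i" for n
      using not_less_Least[OF that[unfolded i_def]] by blast
    have j_less: "(D ^^ n) b \<in> P" if "n < j" for n
      using not_less_Least[OF that[unfolded j_def]] by blast
    let ?t = "\<lambda>k. of_nat (i + j choose k) * ((D ^^ k) a * (D ^^ (i + j - k)) b)"
    have "?t k \<in> P" if "k \<in> {..i + j} - {i}" for k
    proof -
      have "k < i \<or> i + j - k < j" using that by auto
      then have "(D ^^ k) a * (D ^^ (i + j - k)) b \<in> P"
        using is_ideal_mult_right[OF P(1) i_less] is_ideal_mult[OF P(1) j_less] by blast
      then show ?thesis by (rule is_ideal_mult[OF P(1)])
    qed
    then have "sum ?t ({..i + j} - {i}) \<in> P" by (intro is_ideal_sum[OF P(1)])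
    moreover have "(D ^^ (i + j)) (a * b) = ?t i + sum ?t ({..i + j} - {i})"
      unfolding funpow_mult by (rule sum.remove) auto
    moreover have "(D ^^ (i + j)) (a * b) \<in> P" using that by (simp add: Q_def)
    ultimately have "?t i + sum ?t ({..i + j} - {i}) - sum ?t ({..i + j} - {i}) \<in> P"
      by (intro is_ideal_diff[OF P(1)]) simp_all
    then have "?t i \<in> P" by simp
    moreover obtain c where "of_nat (i + j choose i) * c = (1 :: 'a)"
      using char[of "i + j choose i"] by auto
    then have "c * ?t i = (D ^^ i) a * (D ^^ j) b"
      by (simp add: mult.assoc[symmetric] mult.commute[of c])
    ultimately have "(D ^^ i) a * (D ^^ j) b \<in> P"
      using is_ideal_mult[OF P(1), of "?t i" c] by simp
    then show False using prime i j by blast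
  qed
  ultimately show ?thesis by blast
qed

section \<open>Linear algebra\<close>

text \<open>
  \<open>N\<close> plays the role of the kernel of \<open>\<mu>\<close>: a maximal \<open>B\<close>-submodule no \<open>\<theta>\<close>-unit multiple of \<open>x\<close>
  lies in. Its maximality makes \<open>x\<close> span the quotient, up to \<open>\<theta>\<close>-units.
\<close>

lemma semilinear_functional:
  fixes \<theta> :: "'r::comm_ring_1 \<Rightarrow> 'u::field"
  assumes \<theta>: "\<And>f g. f \<in> B \<Longrightarrow> g \<in> B \<Longrightarrow> \<theta> (f * g) = \<theta> f * \<theta> g"
      "\<And>f g. f \<in> B \<Longrightarrow> g \<in> B \<Longrightarrow> \<theta> (f + g) = \<theta> f + \<theta> g" "\<theta> 1 = 1"
    and B: "1 \<in> B" "\<And>f. f \<in> B \<Longrightarrow> - f \<in> B" "\<And>f g. f \<in> B \<Longrightarrow> g \<in> B \<Longrightarrow> f + g \<in> B"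
      "\<And>f g. f \<in> B \<Longrightarrow> g \<in> B \<Longrightarrow> f * g \<in> B"
    and tors: "\<And>f. f \<in> B \<Longrightarrow> \<theta> f = 0 \<Longrightarrow> \<exists>s\<in>B. \<theta> s \<noteq> 0 \<and> s * f = 0"
    and x: "\<And>s. s \<in> B \<Longrightarrow> \<theta> s \<noteq> 0 \<Longrightarrow> s * x \<notin> B"
  obtains \<mu> where "\<And>a b. \<mu> (a + b) = \<mu> a + \<mu> b" "\<And>f a. f \<in> B \<Longrightarrow> \<mu> (f * a) = \<theta> f * \<mu> a"
    "\<mu> 1 = 0" "\<mu> x = 1"
proof -
  have B0: "0 \<in> B" using B(3)[OF B(1) B(2)[OF B(1)]] by simp
  have \<theta>0: "\<theta> 0 = 0" using \<theta>(2)[OF B0 B0] by (metis add_0 add_right_cancel)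
  have \<theta>m: "\<theta> (f - g) = \<theta> f - \<theta> g" if "f \<in> B" "g \<in> B" for f g
    using \<theta>(2)[OF that(1) B(2)[OF that(2)]] \<theta>(2)[OF that(2) B(2)[OF that(2)]]
    by (simp add: \<theta>0 add_eq_0_iff)
  define submod where "submod N \<longleftrightarrow> B \<subseteq> N \<and> (\<forall>a\<in>N. \<forall>b\<in>N. a + b \<in> N) \<and>
    (\<forall>a\<in>N. \<forall>f\<in>B. f * a \<in> N) \<and> (\<forall>s\<in>B. \<theta> s \<noteq> 0 \<longrightarrow> s * x \<notin> N)" for N
  have "\<exists>N\<in>{N. submod N}. \<forall>X\<in>{N. submod N}. N \<subseteq> X \<longrightarrow> X = N"
  proof (rule subset_Zorn_nonempty)
    have "submod B" by (simp add: submod_def B x)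
    then show "{N. submod N} \<noteq> {}" by blast
    fix \<C> assume \<C>: "\<C> \<noteq> {}" "subset.chain {N. submod N} \<C>"
    then have sub: "submod N" if "N \<in> \<C>" for N using that by (auto simp: subset.chain_def)
    have "a + b \<in> \<Union>\<C>" if "a \<in> N" "N \<in> \<C>" "b \<in> N'" "N' \<in> \<C>" for a b N N'
    proof -
      have "N \<subseteq> N' \<or> N' \<subseteq> N" using \<C> that by (auto simp: subset.chain_def)
      then obtain N'' where "N'' \<in> \<C>" "a \<in> N''" "b \<in> N''" using \<open>a \<in> N\<close> \<open>b \<in> N'\<close> \<open>N \<in> \<C>\<close> \<open>N' \<in> \<C>\<close> by blast
      then show ?thesis using sub[of N''] by (auto simp: submod_def)
    qed
    moreover have "f * a \<in> \<Union>\<C>" if "a \<in> N" "N \<in> \<C>" "f \<in> B" for a f N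
    proof (rule UnionI[of N])
      show "f * a \<in> N" using sub[of N] that by (simp add: submod_def)
    qed fact
    moreover have "s * x \<notin> N" if "s \<in> B" "\<theta> s \<noteq> 0" "N \<in> \<C>" for s N
      using sub[of N] that by (auto simp: submod_def)
    moreover obtain N where "N \<in> \<C>" using \<C>(1) by blast
    then have "B \<subseteq> \<Union>\<C>" using sub[of N] by (auto simp: submod_def)
    ultimately have "submod (\<Union>\<C>)" unfolding submod_def by (intro conjI ballI impI) blast+
    then show "\<Union>\<C> \<in> {N. submod N}" by simp
  qed
  then obtain N where N: "submod N" and max: "\<And>X. submod X \<Longrightarrow> N \<subseteq> X \<Longrightarrow> X = N" by blast
  have N_B: "f \<in> N" if "f \<in> B" for f using N that by (auto simp: submod_def)
  have N_add: "a + b \<in> N" if "a \<in> N" "b \<in> N" for a b using N that by (auto simp: submod_def)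
  have N_mult: "f * a \<in> N" if "a \<in> N" "f \<in> B" for a f using N that by (auto simp: submod_def)
  have N_x: "s * x \<notin> N" if "s \<in> B" "\<theta> s \<noteq> 0" for s using N that by (auto simp: submod_def)
  have N_minus: "a - b \<in> N" if "a \<in> N" "b \<in> N" for a b
    using N_add[OF that(1) N_mult[OF that(2) B(2)[OF B(1)]]] by simp
  \<comment> \<open>\<open>coeff a s f\<close> says that \<open>a\<close> equals the fraction
    \<open>f / s\<close> times \<open>x\<close> modulo \<open>N\<close>; the value of the functional
    at \<open>a\<close> will be \<open>\<theta> f / \<theta> s\<close>.\<close>
  define coeff where "coeff a s f \<longleftrightarrow> s \<in> B \<and> f \<in> B \<and> \<theta> s \<noteq> 0 \<and> s * a - f * x \<in> N" for a s f
  have ex: "\<exists>s f. coeff a s f" for a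
  proof (cases "a \<in> N")
    case True
    then show ?thesis
      by (intro exI[of _ 1] exI[of _ 0]) (simp add: coeff_def \<theta> B B0)
  next
    case False
    let ?X = "{m + f * a |m f. m \<in> N \<and> f \<in> B}"
    have NX: "N \<subseteq> ?X"
    proof
      fix m assume "m \<in> N"
      moreover have "m = m + 0 * a" by simp
      ultimately show "m \<in> ?X" using B0 by blast
    qed
    have "a = 0 + 1 * a" by simp
    then have aX: "a \<in> ?X" using B(1) N_B[OF B0] by blast
    \<comment> \<open>\<open>?X\<close> contains \<open>B\<close> and is closed under the
      operations, so by maximality of \<open>N\<close> it can fail to be admissible only by
      containing some \<open>s * x\<close> with \<open>\<theta> s\<close> nonzero. This relates
      \<open>a\<close> to \<open>x\<close>.\<close>
    have "\<not> submod ?X" using max[OF _ NX] aX False by blast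
    moreover have "y + z \<in> ?X" if yz: "y \<in> ?X" "z \<in> ?X" for y z
    proof -
      obtain m f m' f' where "y = m + f * a" "z = m' + f' * a" "m \<in> N" "m' \<in> N" "f \<in> B" "f' \<in> B"
        using yz by auto
      then have "y + z = (m + m') + (f + f') * a" "m + m' \<in> N" "f + f' \<in> B"
        by (simp_all add: N_add B algebra_simps)
      then show ?thesis by blast
    qed
    moreover have "g * y \<in> ?X" if y: "y \<in> ?X" "g \<in> B" for y g
    proof -
      obtain m f where "y = m + f * a" "m \<in> N" "f \<in> B" using y by auto
      then have "g * y = g * m + (g * f) * a" "g * m \<in> N" "g * f \<in> B"
        using y by (simp_all add: N_mult B distrib_left mult.assoc)
      then show ?thesis by blast
    qed
    moreover have "B \<subseteq> ?X" using NX N_B by blast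
    ultimately obtain s where s: "s \<in> B" "\<theta> s \<noteq> 0" "s * x \<in> ?X"
      unfolding submod_def by blast
    then obtain m f where m: "s * x = m + f * a" "m \<in> N" "f \<in> B" by auto
    \<comment> \<open>Otherwise \<open>tors\<close> gives a \<open>\<theta>\<close>-unit
      \<open>t\<close> with \<open>t * f = 0\<close>, and \<open>t * s * x = t * m\<close> would lie
      in \<open>N\<close>.\<close>
    have "\<theta> f \<noteq> 0"
    proof
      assume "\<theta> f = 0"
      then obtain t where t: "t \<in> B" "\<theta> t \<noteq> 0" "t * f = 0" using tors m by blast
      have "(t * s) * x = t * m + (t * f) * a"
        by (simp add: mult.assoc m(1) distrib_left)
      then have "(t * s) * x \<in> N" using t m by (simp add: N_mult)
      then show False using N_x[of "t * s"] t s by (simp add: B \<theta>)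
    qed
    then have "coeff a f s"
      using m s N_mult[OF m(2) B(2)[OF B(1)]] by (simp add: coeff_def)
    then show ?thesis by blast
  qed
  have unique: "\<theta> f / \<theta> s = \<theta> f' / \<theta> s'" if c: "coeff a s f" "coeff a s' f'" for a s f s' f'
  proof -
    have "s' * (s * a - f * x) - s * (s' * a - f' * x) \<in> N"
      using c by (auto simp: coeff_def intro!: N_minus N_mult)
    moreover have "s' * (s * a - f * x) - s * (s' * a - f' * x) = (s * f' - s' * f) * x"
      by (simp add: algebra_simps)
    moreover have "s * f' - s' * f \<in> B"
      using c B(3)[of "s * f'" "- (s' * f)"] by (simp add: coeff_def B)
    ultimately have "\<theta> (s * f' - s' * f) = 0" using N_x by metis
    then show ?thesis
      using c by (simp add: coeff_def \<theta>m \<theta> B field_simps)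
  qed
  define \<mu> where "\<mu> a = (SOME v. \<exists>s f. coeff a s f \<and> v = \<theta> f / \<theta> s)" for a
  have \<mu>: "\<mu> a = \<theta> f / \<theta> s" if "coeff a s f" for a s f
    unfolding \<mu>_def
  proof (rule some_equality)
    show "\<exists>s' f'. coeff a s' f' \<and> \<theta> f / \<theta> s = \<theta> f' / \<theta> s'" using that by blast
    fix v assume "\<exists>s' f'. coeff a s' f' \<and> v = \<theta> f' / \<theta> s'"
    then show "v = \<theta> f / \<theta> s" using unique that by blast
  qed
  show thesis
  proof
    fix a b
    obtain s f s' f' where c: "coeff a s f" "coeff b s' f'" using ex by blast
    have "s' * (s * a - f * x) + s * (s' * b - f' * x) \<in> N"
      using c by (auto simp: coeff_def intro!: N_add N_mult)
    moreover have "s' * (s * a - f * x) + s * (s' * b - f' * x) =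
        (s * s') * (a + b) - (s' * f + s * f') * x"
      by (simp add: algebra_simps)
    ultimately have "coeff (a + b) (s * s') (s' * f + s * f')"
      using c by (simp add: coeff_def B \<theta>)
    then show "\<mu> (a + b) = \<mu> a + \<mu> b"
      using c by (simp add: \<mu>[OF c(1)] \<mu>[OF c(2)] \<mu>) (simp add: coeff_def \<theta> B field_simps)
  next
    fix g a assume g: "g \<in> B"
    obtain s f where c: "coeff a s f" using ex by blast
    have "g * (s * a - f * x) \<in> N" using c g by (auto simp: coeff_def intro!: N_mult)
    moreover have "g * (s * a - f * x) = s * (g * a) - (g * f) * x"
      by (simp add: algebra_simps)
    ultimately have "coeff (g * a) s (g * f)" using c g by (simp add: coeff_def B)
    then show "\<mu> (g * a) = \<theta> g * \<mu> a"
      using c g by (simp add: \<mu>[OF c] \<mu>) (simp add: coeff_def \<theta>)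
  next
    have "coeff 1 1 0" by (simp add: coeff_def B0 B \<theta> N_B)
    then show "\<mu> 1 = 0" by (simp add: \<mu> \<theta>0)
    have "coeff x 1 1" by (simp add: coeff_def B \<theta> N_B B0)
    then show "\<mu> x = 1" by (simp add: \<mu> \<theta>)
  qed
qed

text \<open>
  Inner derivations are derivations of the ring of endomorphisms, so that a nilpotent one, of exact
  order \<open>n + 1 \<ge> 2\<close>, would satisfy \<open>(ad\<^sup>n a) \<circ> v \<circ> (ad\<^sup>n a) = 0\<close> for all scalars \<open>v\<close>.
\<close>

definition ad_scale :: "'u::field \<Rightarrow> ('u \<Rightarrow> 'u) \<Rightarrow> 'u \<Rightarrow> 'u" where
  "ad_scale u \<phi> = (\<lambda>v. u * \<phi> v - \<phi> (u * v))"

definition linear_over :: "('k \<Rightarrow> 'u::field) \<Rightarrow> ('u \<Rightarrow> 'u) \<Rightarrow> bool" where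
  "linear_over \<iota> \<phi> \<longleftrightarrow> (\<forall>a b. \<phi> (a + b) = \<phi> a + \<phi> b) \<and> (\<forall>c a. \<phi> (\<iota> c * a) = \<iota> c * \<phi> a)"

lemma linear_over_ad_scale: "linear_over \<iota> \<phi> \<Longrightarrow> linear_over \<iota> (ad_scale u \<phi>)"
  by (simp add: linear_over_def ad_scale_def distrib_left right_diff_distrib mult.left_commute[of u])

lemma linear_over_ad_scale_funpow: "linear_over \<iota> \<phi> \<Longrightarrow> linear_over \<iota> ((ad_scale u ^^ n) \<phi>)"
  by (induction n) (auto intro: linear_over_ad_scale)

lemma ad_scale_apply: "ad_scale u \<phi> w = u * \<phi> w - \<phi> (u * w)"
  by (simp add: ad_scale_def)

lemma ad_scale_funpow_mult: "(ad_scale u ^^ n) (\<lambda>w. v * \<phi> w) = (\<lambda>w. v * (ad_scale u ^^ n) \<phi> w)"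
  by (induction n) (simp_all add: ad_scale_apply fun_eq_iff right_diff_distrib mult.left_commute)

text \<open>Leibniz rule for the derivation \<open>ad_scale u\<close> on the composite of
  \<open>e\<close> and \<open>b\<close>. Its second iterate kills \<open>e\<close>, so only the
  first two terms survive. For \<open>n = 0\<close> the truncated \<open>n - 1\<close> is harmless
  because of the factor \<open>of_nat n\<close>.\<close>

lemma ad_scale_funpow_comp:
  assumes e: "\<And>a b. e (a + b) = e a + e b" and z: "z = ad_scale u e" "ad_scale u z = (\<lambda>_. 0)"
  shows "(ad_scale u ^^ n) (\<lambda>w. e (b w)) =
    (\<lambda>w. e ((ad_scale u ^^ n) b w) + of_nat n * z ((ad_scale u ^^ (n - 1)) b w))"
proof (induction n)
  case 0
  then show ?case by simp
next
  case (Suc n)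
  have e_diff: "e (a - b) = e a - e b" for a b
    using e[of "a - b" b] by simp
  then have z_diff: "z (a - b) = z a - z b" for a b
    by (simp add: z(1) ad_scale_def right_diff_distrib)
  have uz: "u * z a = z (u * a)" for a
    using fun_cong[OF z(2), of a] by (simp add: ad_scale_def)
  have ue: "u * e a = z a + e (u * a)" for a by (simp add: z(1) ad_scale_def)
  show ?case
  proof (cases n)
    case 0
    then show ?thesis by (auto simp: ad_scale_def e_diff ue algebra_simps)
  next
    case (Suc m)
    let ?m = "(ad_scale u ^^ m) b" and ?n = "(ad_scale u ^^ n) b"
    have IH: "(ad_scale u ^^ Suc n) (\<lambda>w. e (b w)) =
        ad_scale u (\<lambda>w. e (?n w) + of_nat n * z (?m w))"
      using Suc.IH by (simp add: \<open>n = Suc m\<close>)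
    have bn: "?n w = u * ?m w - ?m (u * w)" for w
      by (simp add: Suc ad_scale_def)
    have "(ad_scale u ^^ Suc n) (\<lambda>w. e (b w)) w =
        e ((ad_scale u ^^ Suc n) b w) + of_nat (Suc n) * z (?n w)" for w
    proof -
      have "(ad_scale u ^^ Suc n) (\<lambda>w. e (b w)) w =
          u * (e (?n w) + of_nat n * z (?m w)) - (e (?n (u * w)) + of_nat n * z (?m (u * w)))"
        by (simp only: IH ad_scale_apply)
      also have "\<dots> = (u * e (?n w) - e (?n (u * w))) + of_nat n * (u * z (?m w) - z (?m (u * w)))"
        by (simp only: algebra_simps)
      also have "u * z (?m w) - z (?m (u * w)) = z (?n w)"
        by (simp only: uz bn z_diff)
      also have "u * e (?n w) - e (?n (u * w)) = e (u * ?n w - ?n (u * w)) + z (?n w)"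
        by (simp only: ue e_diff) simp
      also have "u * ?n w - ?n (u * w) = (ad_scale u ^^ Suc n) b w"
        by (simp add: ad_scale_def)
      finally show ?thesis by (simp add: distrib_right)
    qed
    then show ?thesis by (simp add: fun_eq_iff)
  qed
qed

lemma ad_scale_not_nilpotent:
  fixes \<iota> :: "'k::field \<Rightarrow> 'u::field" and u :: 'u
  assumes "ring_embedding \<iota>" and u: "u \<notin> range \<iota>" and char: "\<And>n. n > 0 \<Longrightarrow> (of_nat n :: 'u) \<noteq> 0"
  shows "\<exists>\<phi>. linear_over \<iota> \<phi> \<and> (ad_scale u ^^ n) \<phi> \<noteq> (\<lambda>_. 0)"
proof (rule ccontr)
  interpret ring_embedding \<iota> by fact
  assume "\<not> ?thesis"
  then have ex: "\<exists>n. \<forall>\<phi>. linear_over \<iota> \<phi> \<longrightarrow> (ad_scale u ^^ n) \<phi> = (\<lambda>_. 0)" by blast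
  define N where "N = (LEAST n. \<forall>\<phi>. linear_over \<iota> \<phi> \<longrightarrow> (ad_scale u ^^ n) \<phi> = (\<lambda>_. 0))"
  have N: "(ad_scale u ^^ N) \<phi> = (\<lambda>_. 0)" if "linear_over \<iota> \<phi>" for \<phi>
    using LeastI_ex[OF ex] that unfolding N_def by blast
  have inverse_\<iota>: "inverse (\<iota> c) = \<iota> (inverse c)" for c
  proof (cases "c = 0")
    case False
    then show ?thesis
      by (intro inverse_unique) (simp add: hom_one flip: hom_mult)
  qed (simp add: hom_zero)
  \<comment> \<open>A linear map separating \<open>u\<close> from the base field. Its image under
    \<open>ad_scale u\<close> takes the value \<open>-1\<close> at \<open>1\<close>, so the exact
    order of nilpotency would be at least two.\<close>
  obtain \<phi>1 where \<phi>1: "linear_over \<iota> \<phi>1" "\<phi>1 1 = 0" "\<phi>1 u = 1"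
  proof (rule semilinear_functional[of "range \<iota>" "\<lambda>a. a" u])
    show "s * u \<notin> range \<iota>" if "s \<in> range \<iota>" "s \<noteq> 0" for s
    proof
      assume "s * u \<in> range \<iota>"
      moreover have "inverse s \<in> range \<iota>" using that by (auto simp: inverse_\<iota>)
      moreover have "u = inverse s * (s * u)" using that by simp
      ultimately have "u \<in> range \<iota>" by (metis (no_types, lifting) hom_mult image_iff rangeI)
      then show False using u by simp
    qed
  next
    fix \<mu> :: "'u \<Rightarrow> 'u"
    assume "\<And>a b. \<mu> (a + b) = \<mu> a + \<mu> b" "\<And>f a. f \<in> range \<iota> \<Longrightarrow> \<mu> (f * a) = f * \<mu> a"
      "\<mu> 1 = 0" "\<mu> u = 1"
    then show thesis using that[of \<mu>] by (auto simp: linear_over_def)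
  next
    show "1 \<in> range \<iota>" by (metis hom_one rangeI)
    show "\<exists>s\<in>range \<iota>. s \<noteq> 0 \<and> s * f = 0" if "f = 0" for f :: 'u
      using that by (auto intro!: exI[of _ 1] simp: hom_one)
    show "- f \<in> range \<iota>" if "f \<in> range \<iota>" for f using that by (auto simp flip: hom_uminus)
    show "f + g \<in> range \<iota>" "f * g \<in> range \<iota>" if "f \<in> range \<iota>" "g \<in> range \<iota>" for f g
      using that by (auto simp flip: hom_add hom_mult)
  qed simp_all
  have "ad_scale u \<phi>1 1 \<noteq> 0" by (simp add: ad_scale_def \<phi>1)
  moreover have "\<phi>1 u \<noteq> 0" by (simp add: \<phi>1)
  ultimately have nz: "(ad_scale u ^^ n) \<phi>1 \<noteq> (\<lambda>_. 0)" if "n = 0 \<or> n = Suc 0" for n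
    using that by (auto simp: fun_eq_iff)
  have "\<not> (N = 0 \<or> N = Suc 0)"
  proof
    assume "N = 0 \<or> N = Suc 0"
    from nz[OF this] N[OF \<phi>1(1)] show False by (rule notE)
  qed
  then have "N \<noteq> 0" "N \<noteq> Suc 0" by simp_all
  then obtain m where m: "N = Suc (Suc m)" by (metis not0_implies_Suc)
  then have "Suc m < N" by simp
  from not_less_Least[OF this[unfolded N_def]]
  have "\<not> (\<forall>\<phi>. linear_over \<iota> \<phi> \<longrightarrow> (ad_scale u ^^ Suc m) \<phi> = (\<lambda>_. 0))" .
  then obtain a where a: "linear_over \<iota> a" "(ad_scale u ^^ Suc m) a \<noteq> (\<lambda>_. 0)" by blast
  define e where "e = (ad_scale u ^^ m) a"
  define z where "z = (ad_scale u ^^ Suc m) a"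
  have z: "z = ad_scale u e" "ad_scale u z = (\<lambda>_. 0)"
    using N[OF a(1)] by (simp_all add: e_def z_def m)
  have e: "linear_over \<iota> e" unfolding e_def by (rule linear_over_ad_scale_funpow[OF a(1)])
  then have e_add: "e (x + y) = e x + e y" for x y by (simp add: linear_over_def)
  have e0: "e 0 = 0" using e_add[of 0 0] by (metis add_0 add_right_cancel)
  \<comment> \<open>Apply the vanishing of the \<open>N\<close>-th iterate to \<open>e\<close>
    composed with \<open>v * a\<close>. In the Leibniz rule the term with the \<open>N\<close>-th
    iterate of \<open>a\<close> vanishes, and \<open>N\<close> times \<open>z (v * z w)\<close>
    remains; \<open>N\<close> is invertible in characteristic zero.\<close>
  have zz: "z (v * z w) = 0" for v w
  proof -
    have lin: "linear_over \<iota> (\<lambda>w. v * a w)" using a(1) by (auto simp: linear_over_def algebra_simps)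
    then have "linear_over \<iota> (\<lambda>w. e (v * a w))"
      using e unfolding linear_over_def by metis
    from N[OF this] have "(\<lambda>w. e ((ad_scale u ^^ N) (\<lambda>w. v * a w) w) +
        of_nat N * z ((ad_scale u ^^ (N - 1)) (\<lambda>w. v * a w) w)) = (\<lambda>_. 0)"
      by (subst (asm) ad_scale_funpow_comp[OF e_add z])
    then have "e ((ad_scale u ^^ N) (\<lambda>w. v * a w) w) +
        of_nat N * z ((ad_scale u ^^ (N - 1)) (\<lambda>w. v * a w) w) = 0"
      by (rule fun_cong)
    moreover have "(ad_scale u ^^ (N - 1)) (\<lambda>w. v * a w) w = v * z w"
      by (simp only: ad_scale_funpow_mult z_def m diff_Suc_1)
    ultimately have "of_nat N * z (v * z w) = 0"
      by (simp only: N[OF lin] e0 add_0_left)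
    then show ?thesis using char[of N] by (simp add: m)
  qed
  obtain w where w: "z w \<noteq> 0" using a(2) by (auto simp: z_def fun_eq_iff)
  have "z v = 0" for v using zz[of "v / z w" w] w by simp
  then show False using w by simp
qed

section \<open>Finite combinations of point evaluations\<close>

definition eval_comb :: "(('x \<Rightarrow> 'u::field) \<Rightarrow> 'u) \<Rightarrow> bool" where
  "eval_comb L \<longleftrightarrow> (\<exists>H w. finite H \<and> (\<forall>f. L f = (\<Sum>h\<in>H. w h * f h)))"

lemma eval_comb_zero: "eval_comb (\<lambda>_. 0)"
  by (auto simp: eval_comb_def intro!: exI[of _ "{}"])

lemma eval_comb_point: "eval_comb (\<lambda>f. c * f h)"
  by (auto simp: eval_comb_def intro!: exI[of _ "{h}"] exI[of _ "\<lambda>_. c"])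

lemma eval_comb_scale:
  assumes "eval_comb L"
  shows "eval_comb (\<lambda>f. c * L f)"
proof -
  obtain H w where "finite H" "\<And>f. L f = (\<Sum>h\<in>H. w h * f h)" using assms by (auto simp: eval_comb_def)
  then show ?thesis
    by (auto simp: eval_comb_def sum_distrib_left mult.assoc intro!: exI[of _ H] exI[of _ "\<lambda>h. c * w h"])
qed

lemma eval_comb_add:
  assumes "eval_comb L" "eval_comb L'"
  shows "eval_comb (\<lambda>f. L f + L' f)"
proof -
  obtain H w where H: "finite H" "\<And>f. L f = (\<Sum>h\<in>H. w h * f h)"
    using assms(1) by (auto simp: eval_comb_def)
  obtain H' w' where H': "finite H'" "\<And>f. L' f = (\<Sum>h\<in>H'. w' h * f h)"
    using assms(2) by (auto simp: eval_comb_def)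
  let ?v = "\<lambda>h. (if h \<in> H then w h else 0) + (if h \<in> H' then w' h else 0)"
  have ext: "(\<Sum>h\<in>K. v h * f h) = (\<Sum>h\<in>H \<union> H'. (if h \<in> K then v h else 0) * f h)"
    if "K \<subseteq> H \<union> H'" for K v and f :: "'a \<Rightarrow> 'b"
    by (rule sum.mono_neutral_cong_left) (use H(1) H'(1) that in auto)
  have "L f + L' f = (\<Sum>h\<in>H \<union> H'. ?v h * f h)" for f
    unfolding H(2) H'(2) distrib_right sum.distrib by (subst (1 2) ext) auto
  then show ?thesis
    unfolding eval_comb_def using H(1) H'(1) by (intro exI[of _ "H \<union> H'"] exI[of _ ?v]) simp
qed

lemma eval_comb_sum:
  assumes "\<And>e. e \<in> E \<Longrightarrow> eval_comb (L e)"
  shows "eval_comb (\<lambda>f. \<Sum>e\<in>E. L e f)"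
  using assms by (induction E rule: infinite_finite_induct) (auto intro: eval_comb_zero eval_comb_add)

lemma eval_comb_diff: "eval_comb L \<Longrightarrow> eval_comb L' \<Longrightarrow> eval_comb (\<lambda>f. L f - L' f)"
  using eval_comb_add[of L "\<lambda>f. (-1) * L' f"] eval_comb_scale[of L' "-1"] by simp

lemma eval_comb_linear:
  assumes "eval_comb L"
  shows "L (\<lambda>h. \<Sum>e\<in>E. c e * f e h) = (\<Sum>e\<in>E. c e * L (f e))"
proof -
  obtain H w where "\<And>f. L f = (\<Sum>h\<in>H. w h * f h)" using assms by (auto simp: eval_comb_def)
  then show ?thesis
    by (simp add: sum_distrib_left mult.left_commute) (rule sum.swap)
qed

text \<open>Gaussian elimination: by independence the residue \<open>r (q a)\<close> of the new
  function modulo the old ones is nonzero at some point \<open>h\<close>. The value of the residue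
  at \<open>h\<close>, normalised, is the new functional, and the old functionals are corrected by
  multiples of it. Coefficients in an expansion by independent functions can thus be read off from
  finitely many values.\<close>

lemma dual_eval_combs:
  fixes q :: "'e \<Rightarrow> 'x \<Rightarrow> 'u::field"
  assumes "finite E"
    and "\<And>c. (\<And>h. (\<Sum>e\<in>E. c e * q e h) = 0) \<Longrightarrow> (\<And>e. e \<in> E \<Longrightarrow> c e = 0)"
  shows "\<exists>L. \<forall>e\<in>E. eval_comb (L e) \<and> (\<forall>e'\<in>E. L e (q e') = (if e = e' then 1 else 0))"
  using assms
proof (induction E rule: finite_induct)
  case empty
  then show ?case by simp
next
  case (insert a E)
  have "c e = 0" if "\<And>h. (\<Sum>e\<in>E. c e * q e h) = 0" "e \<in> E" for c e
  proof -
    have "(\<Sum>e\<in>insert a E. (if e = a then 0 else c e) * q e h) = 0" for h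
    proof -
      have "(\<Sum>e\<in>E. (if e = a then 0 else c e) * q e h) = (\<Sum>e\<in>E. c e * q e h)"
        by (rule sum.cong) (use insert.hyps in auto)
      then show ?thesis using that(1)[of h] insert.hyps by simp
    qed
    then have "(if e = a then 0 else c e) = 0"
      using insert.prems[of "\<lambda>e. if e = a then 0 else c e" e] that by blast
    then show ?thesis using that insert.hyps by (auto split: if_splits)
  qed
  then obtain L where L: "\<And>e. e \<in> E \<Longrightarrow> eval_comb (L e)"
      "\<And>e e'. e \<in> E \<Longrightarrow> e' \<in> E \<Longrightarrow> L e (q e') = (if e = e' then 1 else 0)"
    using insert.IH by blast
  define r where "r f h = f h - (\<Sum>e\<in>E. L e f * q e h)" for f h
  have "\<exists>h. r (q a) h \<noteq> 0"
  proof (rule ccontr)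
    assume not_ex: "\<not> ?thesis"
    have "(\<Sum>e\<in>insert a E. (if e = a then 1 else - L e (q a)) * q e h) = 0" for h
    proof -
      have "(\<Sum>e\<in>E. (if e = a then 1 else - L e (q a)) * q e h) = (\<Sum>e\<in>E. - (L e (q a) * q e h))"
        by (rule sum.cong) (use insert.hyps in auto)
      moreover have "r (q a) h = 0" using not_ex by blast
      ultimately show ?thesis using insert.hyps by (simp add: r_def sum_negf)
    qed
    then have "(if a = a then 1 else - L a (q a)) = 0"
      using insert.prems[of "\<lambda>e. if e = a then 1 else - L e (q a)" a] by blast
    then show False by simp
  qed
  then obtain h where h: "r (q a) h \<noteq> 0" by blast
  define L0 where "L0 f = inverse (r (q a) h) * r f h" for f
  have L0: "eval_comb L0"
  proof -
    have "eval_comb (\<lambda>f. \<Sum>e\<in>E. q e h * L e f)"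
      by (intro eval_comb_sum eval_comb_scale L(1))
    then have "eval_comb (\<lambda>f. inverse (r (q a) h) * (1 * f h - (\<Sum>e\<in>E. q e h * L e f)))"
      by (intro eval_comb_scale eval_comb_diff eval_comb_point)
    moreover have "L0 = (\<lambda>f. inverse (r (q a) h) * (1 * f h - (\<Sum>e\<in>E. q e h * L e f)))"
      by (simp add: fun_eq_iff L0_def r_def mult.commute[of "L _ _"])
    ultimately show ?thesis by simp
  qed
  have rq: "r (q e) h = 0" if "e \<in> E" for e
  proof -
    have "(\<Sum>e'\<in>E. L e' (q e) * q e' h) = (\<Sum>e'\<in>E. if e' = e then q e' h else 0)"
      by (rule sum.cong) (use that L in auto)
    then show ?thesis using that insert.hyps by (simp add: r_def)
  qed
  define L' where "L' e f = (if e = a then L0 f else L e f - L e (q a) * L0 f)" for e f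
  have "eval_comb (L' e)" if "e \<in> insert a E" for e
  proof (cases "e = a")
    case True
    then have "L' e = L0" by (simp add: L'_def fun_eq_iff)
    then show ?thesis using L0 by simp
  next
    case False
    then have "L' e = (\<lambda>f. L e f - L e (q a) * L0 f)" by (simp add: L'_def fun_eq_iff)
    moreover have "eval_comb (L e)" using False that by (intro L(1)) simp
    ultimately show ?thesis using eval_comb_diff[OF _ eval_comb_scale[OF L0]] by simp
  qed
  moreover have "L' e (q e') = (if e = e' then 1 else 0)" if "e \<in> insert a E" "e' \<in> insert a E" for e e'
    using that insert.hyps h by (auto simp: L'_def L0_def rq L(2))
  ultimately show ?case by blast
qed

section \<open>Points of prime differential ideals\<close>

lemma type_dalg_simps [simp]:
  "carrier (type_dalg D e) = UNIV" "mult (type_dalg D e) = (*)" "one (type_dalg D e) = 1"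
  "zero (type_dalg D e) = 0" "add (type_dalg D e) = (+)" "der (type_dalg D e) = D"
  "emb (type_dalg D e) = e"
  by (simp_all add: type_dalg_def ring.extend_def dalg.fields_def cring_class_ops_def)

lemma dp_subst_var:
  assumes "comm_derivation d"
  shows "dp_subst d (\<lambda>v. dp_var (v, 0)) F = F"
proof -
  interpret comm_derivation d by fact
  interpret p: diff_ext d "dp_der d" dp_const by (rule diff_ext_dp_const)
  show ?thesis
    by (induction F rule: dpoly_induct) (auto simp: p.ev_add p.ev_mult)
qed

section \<open>The differential field of fractions of a prime differential ideal\<close>

locale prime_diff_ideal = comm_derivation d for d :: "'k::field \<Rightarrow> 'k" +
  fixes P :: "(nat, 'k) dpoly set"
  assumes ideal: "is_ideal P" and der_closed: "F \<in> P \<Longrightarrow> dp_der d F \<in> P"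
    and prime: "F * H \<in> P \<Longrightarrow> F \<in> P \<or> H \<in> P" and one_notin: "1 \<notin> P"
begin

text \<open>
  The field of fractions of the quotient by \<open>P\<close> has to live in \<^typ>\<open>'k univ\<close>: a fraction is the
  set of codes of its representatives, where \<open>p / q\<close> has the code \<open>p + X\<^sub>0 q\<close>, with the
  indeterminates of \<open>p\<close> and \<open>q\<close> shifted by one.
\<close>

definition code :: "(nat, 'k) dpoly \<Rightarrow> (nat, 'k) dpoly \<Rightarrow> (nat, 'k) dpoly" where
  "code p q = dp_subst d (\<lambda>n. dp_var (Suc n, 0)) p +
     dp_var (0, 0) * dp_subst d (\<lambda>n. dp_var (Suc n, 0)) q"

lemma code_inject: "code p q = code p' q' \<longleftrightarrow> p = p' \<and> q = q'"
proof -
  interpret p: diff_ext d "dp_der d" dp_const by (rule diff_ext_dp_const)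
  \<comment> \<open>Replacing the indeterminate numbered \<open>0\<close> by \<open>c\<close> and
    undoing the shift turns a code into \<open>p + c * q\<close>; the values at \<open>c = 0\<close>
    and \<open>c = 1\<close> determine \<open>p\<close> and \<open>q\<close>.\<close>
  define dec where "dec c = dp_subst d (\<lambda>n. case n of 0 \<Rightarrow> c | Suc n \<Rightarrow> dp_var (n, 0))" for c :: "(nat, 'k) dpoly"
  have "dec c (code p q) = p + c * q" for c p q
    by (simp add: dec_def code_def p.ev_add p.ev_mult p.ev_subst dp_subst_var comm_derivation_axioms)
  from this[of 0] this[of 1] show ?thesis
    by (metis add_left_cancel mult_1 mult_zero_left add_0_right)
qed

definition Fr :: "(nat, 'k) dpoly \<Rightarrow> (nat, 'k) dpoly \<Rightarrow> 'k univ" where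
  "Fr p q = {code p' q' |p' q'. q' \<notin> P \<and> p * q' - p' * q \<in> P}"

lemma mult_notin: "F \<notin> P \<Longrightarrow> H \<notin> P \<Longrightarrow> F * H \<notin> P"
  using prime by blast

lemma Fr_eq_iff:
  assumes "q \<notin> P" "q' \<notin> P"
  shows "Fr p q = Fr p' q' \<longleftrightarrow> p * q' - p' * q \<in> P"
proof
  assume "Fr p q = Fr p' q'"
  moreover have "code p q \<in> Fr p q"
    unfolding Fr_def using assms is_ideal_zero[OF ideal]
    by (intro CollectI exI[of _ p] exI[of _ q]) simp
  ultimately have "p' * q - p * q' \<in> P" by (auto simp: Fr_def code_inject)
  from is_ideal_uminus[OF ideal this] show "p * q' - p' * q \<in> P" by simp
next
  have trans: "p' * s - r * q' \<in> P" if "p * q' - p' * q \<in> P" "p * s - r * q \<in> P" "q \<notin> P" for p q p' q' r s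
  proof -
    have "q' * (p * s - r * q) - s * (p * q' - p' * q) \<in> P"
      by (intro is_ideal_diff[OF ideal is_ideal_mult[OF ideal that(2)]] is_ideal_mult[OF ideal that(1)])
    moreover have "q' * (p * s - r * q) - s * (p * q' - p' * q) = q * (p' * s - r * q')"
      by (simp add: algebra_simps)
    ultimately show ?thesis using prime that by metis
  qed
  assume *: "p * q' - p' * q \<in> P"
  have "p' * q - p * q' \<in> P" using is_ideal_uminus[OF ideal *] by simp
  then show "Fr p q = Fr p' q'"
    using trans[OF *] trans[of p' q p q'] assms unfolding Fr_def by blast
qed

lemma Fr_eqI: "q \<notin> P \<Longrightarrow> q' \<notin> P \<Longrightarrow> p * q' = p' * q \<Longrightarrow> Fr p q = Fr p' q'"
  by (simp add: Fr_eq_iff is_ideal_zero[OF ideal])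

definition num_den :: "'k univ \<Rightarrow> (nat, 'k) dpoly \<times> (nat, 'k) dpoly" where
  "num_den C = (SOME (p, q). q \<notin> P \<and> C = Fr p q)"

abbreviation "num C \<equiv> fst (num_den C)"
abbreviation "den C \<equiv> snd (num_den C)"

lemma num_den_Fr:
  assumes "q \<notin> P"
  shows "den (Fr p q) \<notin> P" "p * den (Fr p q) - num (Fr p q) * q \<in> P"
proof -
  have "case num_den (Fr p q) of (r, s) \<Rightarrow> s \<notin> P \<and> Fr p q = Fr r s"
    unfolding num_den_def by (rule someI[of _ "(p, q)"]) (simp add: assms)
  then show "den (Fr p q) \<notin> P" "p * den (Fr p q) - num (Fr p q) * q \<in> P"
    using assms Fr_eq_iff by (auto simp: case_prod_beta)
qed

text \<open>The operations use arbitrarily chosen representatives; \<open>mult_frac\<close>,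
  \<open>add_frac\<close> and \<open>der_frac\<close> show that the choice does not matter.\<close>

definition frac :: "('k, 'k univ) dalg" where
  "frac = \<lparr>carrier = {Fr p q |p q. q \<notin> P},
     mult = (\<lambda>C D. Fr (num C * num D) (den C * den D)), one = Fr 1 1,
     zero = Fr 0 1, add = (\<lambda>C D. Fr (num C * den D + num D * den C) (den C * den D)),
     der = (\<lambda>C. Fr (dp_der d (num C) * den C - num C * dp_der d (den C)) (den C * den C)),
     emb = (\<lambda>c. Fr (dp_const c) 1)\<rparr>"

lemma carrier_frac: "C \<in> carrier frac \<longleftrightarrow> (\<exists>p q. q \<notin> P \<and> C = Fr p q)"
  by (auto simp: frac_def)

lemma Fr_carrier: "q \<notin> P \<Longrightarrow> Fr p q \<in> carrier frac"
  by (auto simp: carrier_frac)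

lemma one_frac: "\<one>\<^bsub>frac\<^esub> = Fr 1 1"
  and zero_frac: "\<zero>\<^bsub>frac\<^esub> = Fr 0 1"
  and emb_frac: "emb frac c = Fr (dp_const c) 1"
  by (simp_all add: frac_def)

lemma mult_frac:
  assumes "q \<notin> P" "q' \<notin> P"
  shows "Fr p q \<otimes>\<^bsub>frac\<^esub> Fr p' q' = Fr (p * p') (q * q')"
proof -
  define r s r' s' where "r = num (Fr p q)" "s = den (Fr p q)" "r' = num (Fr p' q')" "s' = den (Fr p' q')"
  note rs = num_den_Fr[OF assms(1), of p, folded r_s_r'_s'_def] num_den_Fr[OF assms(2), of p', folded r_s_r'_s'_def]
  have "- (q' * r' * (p * s - r * q)) - p * s * (p' * s' - r' * q') \<in> P"
    by (intro is_ideal_diff[OF ideal is_ideal_uminus[OF ideal is_ideal_mult[OF ideal rs(2)]]]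
        is_ideal_mult[OF ideal rs(4)])
  moreover have "- (q' * r' * (p * s - r * q)) - p * s * (p' * s' - r' * q') =
      (r * r') * (q * q') - (p * p') * (s * s')"
    by (simp add: algebra_simps)
  ultimately show ?thesis
    using assms rs by (simp add: frac_def Fr_eq_iff mult_notin flip: r_s_r'_s'_def)
qed

lemma add_frac:
  assumes "q \<notin> P" "q' \<notin> P"
  shows "Fr p q \<oplus>\<^bsub>frac\<^esub> Fr p' q' = Fr (p * q' + p' * q) (q * q')"
proof -
  define r s r' s' where "r = num (Fr p q)" "s = den (Fr p q)" "r' = num (Fr p' q')" "s' = den (Fr p' q')"
  note rs = num_den_Fr[OF assms(1), of p, folded r_s_r'_s'_def] num_den_Fr[OF assms(2), of p', folded r_s_r'_s'_def]
  have "- (q' * s' * (p * s - r * q)) - q * s * (p' * s' - r' * q') \<in> P"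
    by (intro is_ideal_diff[OF ideal is_ideal_uminus[OF ideal is_ideal_mult[OF ideal rs(2)]]]
        is_ideal_mult[OF ideal rs(4)])
  moreover have "- (q' * s' * (p * s - r * q)) - q * s * (p' * s' - r' * q') =
      (r * s' + r' * s) * (q * q') - (p * q' + p' * q) * (s * s')"
    by (simp add: algebra_simps)
  ultimately show ?thesis
    using assms rs by (simp add: frac_def Fr_eq_iff mult_notin flip: r_s_r'_s'_def)
qed

lemma der_frac:
  assumes "q \<notin> P"
  shows "der frac (Fr p q) = Fr (dp_der d p * q - p * dp_der d q) (q * q)"
proof -
  interpret p: comm_derivation "dp_der d" by (rule comm_derivation_dp_der)
  define r s where "r = num (Fr p q)" "s = den (Fr p q)"
  note rs = num_den_Fr[OF assms, of p, folded r_s_def]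
  \<comment> \<open>Minus the numerator of the derivative of
    \<open>(p * s - r * q) / (q * s)\<close>, the difference of the two representatives. It lies in
    \<open>P\<close> because \<open>P\<close> is a differential ideal.\<close>
  have "(p * s - r * q) * dp_der d (q * s) - q * s * dp_der d (p * s - r * q) \<in> P"
    by (intro is_ideal_diff[OF ideal is_ideal_mult_right[OF ideal rs(2)]]
        is_ideal_mult[OF ideal der_closed[OF rs(2)]])
  moreover have "(p * s - r * q) * dp_der d (q * s) - q * s * dp_der d (p * s - r * q) =
      (dp_der d r * s - r * dp_der d s) * (q * q) - (dp_der d p * q - p * dp_der d q) * (s * s)"
    by (simp add: p.mult p.diff algebra_simps)
  ultimately show ?thesis
    using assms rs by (simp add: frac_def Fr_eq_iff mult_notin flip: r_s_def)
qed

lemmas frac_simps = mult_frac add_frac one_frac zero_frac Fr_carrier mult_notin one_notin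

lemma cring_frac: "cring frac"
proof (rule cringI)
  show "abelian_group frac"
  proof (rule abelian_groupI)
    fix x y z
    assume "x \<in> carrier frac" "y \<in> carrier frac" "z \<in> carrier frac"
    then obtain a b c e f g where "x = Fr a b" "y = Fr c e" "z = Fr f g" "b \<notin> P" "e \<notin> P" "g \<notin> P"
      unfolding carrier_frac by blast
    then show "x \<oplus>\<^bsub>frac\<^esub> y \<in> carrier frac"
      "(x \<oplus>\<^bsub>frac\<^esub> y) \<oplus>\<^bsub>frac\<^esub> z = x \<oplus>\<^bsub>frac\<^esub> (y \<oplus>\<^bsub>frac\<^esub> z)"
      "x \<oplus>\<^bsub>frac\<^esub> y = y \<oplus>\<^bsub>frac\<^esub> x" "\<zero>\<^bsub>frac\<^esub> \<oplus>\<^bsub>frac\<^esub> x = x"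
      by (simp_all add: frac_simps algebra_simps)
  next
    fix x assume "x \<in> carrier frac"
    then obtain a b where "x = Fr a b" "b \<notin> P" unfolding carrier_frac by blast
    then have "Fr (- a) b \<oplus>\<^bsub>frac\<^esub> x = \<zero>\<^bsub>frac\<^esub>" "Fr (- a) b \<in> carrier frac"
      by (simp_all add: frac_simps Fr_eq_iff is_ideal_zero[OF ideal])
    then show "\<exists>y\<in>carrier frac. y \<oplus>\<^bsub>frac\<^esub> x = \<zero>\<^bsub>frac\<^esub>" by blast
  qed (simp add: frac_simps)
  show "comm_monoid frac"
  proof (rule comm_monoidI)
    fix x y z
    assume "x \<in> carrier frac" "y \<in> carrier frac" "z \<in> carrier frac"
    then obtain a b c e f g where "x = Fr a b" "y = Fr c e" "z = Fr f g" "b \<notin> P" "e \<notin> P" "g \<notin> P"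
      unfolding carrier_frac by blast
    then show "x \<otimes>\<^bsub>frac\<^esub> y \<in> carrier frac"
      "(x \<otimes>\<^bsub>frac\<^esub> y) \<otimes>\<^bsub>frac\<^esub> z = x \<otimes>\<^bsub>frac\<^esub> (y \<otimes>\<^bsub>frac\<^esub> z)"
      "x \<otimes>\<^bsub>frac\<^esub> y = y \<otimes>\<^bsub>frac\<^esub> x" "\<one>\<^bsub>frac\<^esub> \<otimes>\<^bsub>frac\<^esub> x = x"
      by (simp_all add: frac_simps algebra_simps)
  qed (simp add: frac_simps)
  fix x y z
  assume "x \<in> carrier frac" "y \<in> carrier frac" "z \<in> carrier frac"
  then obtain a b c e f g where "x = Fr a b" "y = Fr c e" "z = Fr f g" "b \<notin> P" "e \<notin> P" "g \<notin> P"
    unfolding carrier_frac by blast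
  then show "(x \<oplus>\<^bsub>frac\<^esub> y) \<otimes>\<^bsub>frac\<^esub> z = x \<otimes>\<^bsub>frac\<^esub> z \<oplus>\<^bsub>frac\<^esub> y \<otimes>\<^bsub>frac\<^esub> z"
    by (simp add: frac_simps) (rule Fr_eqI; simp add: frac_simps algebra_simps)
qed

lemma Fr_zero_iff: "q \<notin> P \<Longrightarrow> Fr p q = \<zero>\<^bsub>frac\<^esub> \<longleftrightarrow> p \<in> P"
  by (simp add: zero_frac Fr_eq_iff one_notin)

lemma Fr_inverse: "p \<notin> P \<Longrightarrow> q \<notin> P \<Longrightarrow> Fr p q \<otimes>\<^bsub>frac\<^esub> Fr q p = \<one>\<^bsub>frac\<^esub>"
  by (simp add: frac_simps Fr_eq_iff is_ideal_zero[OF ideal] mult.commute)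

lemma field_frac: "field frac"
proof -
  interpret cring frac by (rule cring_frac)
  show ?thesis
  proof (rule cring_fieldI)
    have "Fr p q \<in> Units frac" if "p \<notin> P" "q \<notin> P" for p q
      unfolding Units_def using that
      by (intro CollectI conjI bexI[of _ "Fr q p"]) (simp_all add: Fr_carrier Fr_inverse)
    moreover have "\<zero>\<^bsub>frac\<^esub> \<notin> Units frac"
    proof
      assume "\<zero>\<^bsub>frac\<^esub> \<in> Units frac"
      then have "\<zero>\<^bsub>frac\<^esub> = \<one>\<^bsub>frac\<^esub>" by (metis Units_l_inv_ex r_null)
      then show False using Fr_zero_iff[of 1 1] by (simp add: one_frac one_notin)
    qed
    ultimately have "C \<in> Units frac \<longleftrightarrow> C \<noteq> \<zero>\<^bsub>frac\<^esub>" if "C \<in> carrier frac" for C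
      using that Fr_zero_iff by (metis carrier_frac)
    then show "Units frac = carrier frac - {\<zero>\<^bsub>frac\<^esub>}"
      using Units_closed by blast
  qed
qed

lemma is_dalg_frac: "is_dalg d frac"
proof -
  interpret p: comm_derivation "dp_der d" by (rule comm_derivation_dp_der)
  have "derivation frac (der frac)"
    unfolding derivation_def
  proof (intro conjI ballI)
    show "der frac \<in> carrier frac \<rightarrow> carrier frac"
      by (auto simp: carrier_frac der_frac) (metis mult_notin)
    fix x y assume "x \<in> carrier frac" "y \<in> carrier frac"
    then obtain a b c e where xy: "x = Fr a b" "y = Fr c e" "b \<notin> P" "e \<notin> P"
      unfolding carrier_frac by blast
    show "der frac (x \<oplus>\<^bsub>frac\<^esub> y) = der frac x \<oplus>\<^bsub>frac\<^esub> der frac y"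
      unfolding xy by (simp add: xy frac_simps der_frac)
        (rule Fr_eqI; simp add: xy frac_simps p.add p.mult algebra_simps)
    show "der frac (x \<otimes>\<^bsub>frac\<^esub> y) = der frac x \<otimes>\<^bsub>frac\<^esub> y \<oplus>\<^bsub>frac\<^esub> x \<otimes>\<^bsub>frac\<^esub> der frac y"
      unfolding xy by (simp add: xy frac_simps der_frac)
        (rule Fr_eqI; simp add: xy frac_simps p.add p.mult algebra_simps)
  qed
  moreover have "emb frac \<in> ring_hom cring_class_ops frac"
    by (rule ring_hom_memI)
      (simp_all add: emb_frac frac_simps class_simps dp_const_add dp_const_mult)
  moreover have "der frac (emb frac c) = emb frac (d c)" for c
    by (simp add: emb_frac der_frac one_notin p.one)
  ultimately show ?thesis by (simp add: is_dalg_def cring_frac)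
qed

text \<open>Almost all indeterminates vanish in the quotient, so the remaining ones generate the
  field under the field operations and the derivation. This is the condition under which
  semi-universality may be applied.\<close>

lemma diff_fin_gen_frac:
  assumes fin: "\<And>n. n \<ge> N \<Longrightarrow> dp_var (n, 0) \<in> P"
  shows "diff_fin_gen_field frac"
  unfolding diff_fin_gen_field_def
proof (intro exI conjI allI impI)
  let ?S = "(\<lambda>n. Fr (dp_var (n, 0)) 1) ` {..<N}"
  show "finite ?S" by simp
  show "?S \<subseteq> carrier frac" by (auto simp: Fr_carrier one_notin)
  fix K
  assume "subfield K frac \<and> range (emb frac) \<subseteq> K \<and> ?S \<subseteq> K \<and> der frac ` K \<subseteq> K"
  then have K: "subfield K frac" "\<And>c. emb frac c \<in> K" "\<And>n. n < N \<Longrightarrow> Fr (dp_var (n, 0)) 1 \<in> K"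
    "\<And>C. C \<in> K \<Longrightarrow> der frac C \<in> K"
    by auto
  interpret K: subfield K frac by fact
  interpret field frac by (rule field_frac)
  have poly: "Fr F 1 \<in> K" for F
  proof (induction F rule: dpoly_induct)
    case (const c)
    then show ?case using K(2)[of c] by (simp add: emb_frac)
  next
    case (var w)
    have "Fr (dp_var (n, q)) 1 \<in> K" for n q
    proof (induction q)
      case 0
      show ?case
      proof (cases "n < N")
        case False
        then have "Fr (dp_var (n, 0)) 1 = \<zero>\<^bsub>frac\<^esub>" using fin by (simp add: Fr_zero_iff one_notin)
        then show ?thesis using K(2)[of 0] by (simp add: emb_frac zero_frac)
      qed (rule K(3))
    next
      case (Suc q)
      interpret p: comm_derivation "dp_der d" by (rule comm_derivation_dp_der)
      have "der frac (Fr (dp_var (n, q)) 1) = Fr (dp_var (n, Suc q)) 1"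
        by (simp add: der_frac one_notin p.one)
      then show ?case using K(4)[OF Suc] by simp
    qed
    then show ?case by (cases w) simp
  next
    case (add F H)
    then show ?case using subringE(7)[OF K.subring_axioms, of "Fr F 1" "Fr H 1"] by (simp add: frac_simps)
  next
    case (mult F H)
    then show ?case using K.m_closed[of "Fr F 1" "Fr H 1"] by (simp add: frac_simps)
  qed
  have "Fr p q \<in> K" if "q \<notin> P" for p q
  proof -
    have "Fr q 1 \<in> K - {\<zero>\<^bsub>frac\<^esub>}" using that poly by (simp add: Fr_zero_iff one_notin)
    then have "inv\<^bsub>frac\<^esub> (Fr q 1) \<in> K" using subfield_m_inv(1)[OF K(1)] by blast
    moreover have "inv\<^bsub>frac\<^esub> (Fr q 1) = Fr 1 q"
      using that by (intro comm_inv_char) (simp_all add: Fr_carrier one_notin Fr_inverse)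
    ultimately have "Fr p 1 \<otimes>\<^bsub>frac\<^esub> Fr 1 q \<in> K" using poly by simp
    then show ?thesis using that by (simp add: frac_simps)
  qed
  then show "K = carrier frac" using K.subset by (auto simp: carrier_frac)
qed

end

section \<open>Existence of points over a semi-universal field\<close>

locale semi_universal_ext =
  fixes d :: "'k::field_char_0 \<Rightarrow> 'k" and du :: "'u::field \<Rightarrow> 'u" and \<iota> :: "'k \<Rightarrow> 'u"
  assumes derivation_d: "derivation cring_class_ops d"
    and semi_universal: "semi_universal d (type_dalg du \<iota>)"
begin

lemma diff_ext: "diff_ext d du \<iota>"
proof -
  have "is_dalg d (type_dalg du \<iota>)" using semi_universal by (simp add: semi_universal_def)
  then have "derivation (type_dalg du \<iota>) du" "\<iota> \<in> ring_hom cring_class_ops (type_dalg du \<iota>)"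
    "\<forall>c. du (\<iota> c) = \<iota> (d c)"
    by (simp_all add: is_dalg_def)
  moreover have "comm_derivation d" using derivation_d by (simp add: comm_derivation_iff)
  ultimately show ?thesis
    by (auto simp: diff_ext_def diff_ext_axioms_def comm_derivation_def ring_embedding_def
        derivation_def ring_hom_def class_simps)
qed

sublocale diff_ext d du \<iota>
  by (rule diff_ext)

lemma \<iota>_eq_0_iff: "\<iota> c = 0 \<longleftrightarrow> c = 0"
proof
  assume "\<iota> c = 0"
  then have "\<iota> (c * inverse c) = 0" by (simp add: hom_mult)
  then show "c = 0" by (metis right_inverse hom_one zero_neq_one)
qed (simp add: hom_zero)

lemma of_nat_neq_0: "n > 0 \<Longrightarrow> (of_nat n :: 'u) \<noteq> 0"
  by (metis hom_of_nat \<iota>_eq_0_iff neq0_conv of_nat_eq_0_iff)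

text \<open>Semi-universality embeds the field of fractions in the universal field; the images of
  the indeterminates form the point. Elements outside \<open>P\<close> become invertible fractions,
  hence do not vanish there.\<close>

lemma ex_generic_point:
  assumes "prime_diff_ideal d P" and fin: "\<And>n. n \<ge> N \<Longrightarrow> dp_var (n, 0) \<in> P"
  shows "\<exists>y. \<forall>F. ev y F = 0 \<longleftrightarrow> F \<in> P"
proof -
  interpret P: prime_diff_ideal d P by fact
  interpret pd: comm_derivation "dp_der d" by (rule d.comm_derivation_dp_der)
  have "dalg_hom P.frac (type_dalg du \<iota>) \<noteq> {}"
    using semi_universal P.is_dalg_frac P.field_frac P.diff_fin_gen_frac[OF fin]
    by (simp add: semi_universal_def)
  then obtain \<phi> where "\<phi> \<in> dalg_hom P.frac (type_dalg du \<iota>)" by blast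
  then have hom: "\<phi> \<in> ring_hom P.frac (type_dalg du \<iota>)"
    and emb: "\<And>c. \<phi> (emb P.frac c) = \<iota> c"
    and der: "\<And>C. C \<in> carrier P.frac \<Longrightarrow> \<phi> (der P.frac C) = du (\<phi> C)"
    by (auto simp: dalg_hom_def)
  note homs = ring_hom_mult[OF hom, simplified] ring_hom_add[OF hom, simplified] ring_hom_one[OF hom, simplified]
  define y where "y n = \<phi> (P.Fr (dp_var (n, 0)) 1)" for n
  have eval: "ev y F = \<phi> (P.Fr F 1)" for F
  proof (induction F rule: dpoly_induct)
    case (const c)
    then show ?case using emb[of c] by (simp add: P.emb_frac)
  next
    case (var w)
    have "(du ^^ q) (y n) = \<phi> (P.Fr (dp_var (n, q)) 1)" for n q
    proof (induction q)
      case (Suc q)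
      have "der P.frac (P.Fr (dp_var (n, q)) 1) = P.Fr (dp_var (n, Suc q)) 1"
        by (simp add: P.der_frac P.one_notin pd.one)
      then show ?case using Suc der[of "P.Fr (dp_var (n, q)) 1"] by (simp add: P.Fr_carrier P.one_notin)
    qed (simp add: y_def)
    then show ?case by (cases w) simp
  next
    case (add F H)
    then show ?case using homs(2)[of "P.Fr F 1" "P.Fr H 1"] by (simp add: ev_add P.frac_simps)
  next
    case (mult F H)
    then show ?case using homs(1)[of "P.Fr F 1" "P.Fr H 1"] by (simp add: ev_mult P.frac_simps)
  qed
  have zero: "\<phi> (P.Fr 0 1) = 0" using eval[of 0] by (simp add: ev_zero)
  have "ev y F = 0 \<longleftrightarrow> F \<in> P" for F
  proof
    assume "F \<in> P"
    then have "P.Fr F 1 = P.Fr 0 1" using P.Fr_zero_iff[of 1 F] by (simp add: P.one_notin P.zero_frac)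
    then show "ev y F = 0" by (simp add: eval zero)
  next
    assume "ev y F = 0"
    show "F \<in> P"
    proof (rule ccontr)
      assume "F \<notin> P"
      then have "\<phi> (P.Fr F 1) * \<phi> (P.Fr 1 F) = 1"
        using homs(1)[of "P.Fr F 1" "P.Fr 1 F"] homs(3) P.Fr_inverse[of F 1]
        by (simp add: P.Fr_carrier P.one_notin)
      then show False using \<open>ev y F = 0\<close> by (simp add: eval)
    qed
  qed
  then show ?thesis by blast
qed

text \<open>A form of the differential Nullstellensatz: enlarge \<open>I\<close> to a prime
  differential ideal still disjoint from \<open>M\<close> and take a generic point of it.\<close>

lemma ex_point_avoiding:
  fixes N :: nat
  assumes I: "is_ideal I" "\<And>F. F \<in> I \<Longrightarrow> dp_der d F \<in> I" "I \<inter> M = {}"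
    and M: "1 \<in> M" "\<And>a b. a \<in> M \<Longrightarrow> b \<in> M \<Longrightarrow> a * b \<in> M"
    and fin: "\<And>n. n \<ge> N \<Longrightarrow> dp_var (n, 0) \<in> I"
  shows "\<exists>y. (\<forall>F\<in>I. ev y F = 0) \<and> (\<forall>F\<in>M. ev y F \<noteq> 0)"
proof -
  interpret pd: comm_derivation "dp_der d" by (rule d.comm_derivation_dp_der)
  interpret dp: diff_ext d "dp_der d" dp_const by (rule d.diff_ext_dp_const)
  have char: "\<exists>c. of_nat n * c = (1 :: (nat, 'k) dpoly)" if "n > 0" for n
  proof -
    have "of_nat n * dp_const (inverse (of_nat n)) = (1 :: (nat, 'k) dpoly)"
      using that by (simp flip: dp.hom_of_nat dp_const_mult)
    then show ?thesis by blast
  qed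
  have "\<exists>P. is_ideal P \<and> (\<forall>a\<in>P. dp_der d a \<in> P) \<and> I \<subseteq> P \<and> P \<inter> M = {} \<and>
      (\<forall>a b. a * b \<in> P \<longrightarrow> a \<in> P \<or> b \<in> P)"
    by (intro comm_derivation.ex_prime_diff_ideal_avoiding[OF d.comm_derivation_dp_der] I M char)
  then obtain P where P: "is_ideal P" "\<forall>a\<in>P. dp_der d a \<in> P" "I \<subseteq> P" "P \<inter> M = {}"
    "\<forall>a b. a * b \<in> P \<longrightarrow> a \<in> P \<or> b \<in> P" by blast
  then have "prime_diff_ideal d P"
    using M(1) by unfold_locales (auto intro: d.add d.mult)
  then show ?thesis using ex_generic_point[of P N] P fin by blast
qed

end

section \<open>Functionals on a tensor square\<close>

inductive_set gen_ideal :: "'a::comm_ring_1 set \<Rightarrow> 'a set" for S where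
  zero: "0 \<in> gen_ideal S"
| add: "a \<in> gen_ideal S \<Longrightarrow> b \<in> gen_ideal S \<Longrightarrow> a + b \<in> gen_ideal S"
| gen: "s \<in> S \<Longrightarrow> r * s \<in> gen_ideal S"

lemma gen_ideal_incl: "s \<in> S \<Longrightarrow> s \<in> gen_ideal S"
  using gen_ideal.gen[of s S 1] by simp

lemma is_ideal_gen_ideal: "is_ideal (gen_ideal S)"
proof -
  have "r * a \<in> gen_ideal S" if "a \<in> gen_ideal S" for a r
    using that
    by induction (auto simp: distrib_left mult.assoc[symmetric] intro: gen_ideal.intros)
  then show ?thesis by (auto simp: is_ideal_def intro: gen_ideal.intros)
qed

lemma (in comm_derivation) gen_ideal_closed:
  assumes "\<And>s. s \<in> S \<Longrightarrow> D s \<in> S" "a \<in> gen_ideal S"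
  shows "D a \<in> gen_ideal S"
  using assms(2)
  by induction (auto simp: zero add mult intro: gen_ideal.intros assms(1))

abbreviation left_var :: "('k \<Rightarrow> 'k) \<Rightarrow> (nat, 'k::comm_ring_1) dpoly \<Rightarrow> (nat, 'k) dpoly" where
  "left_var d \<equiv> dp_subst d (\<lambda>n. dp_var (2 * n, 0))"

abbreviation right_var :: "('k \<Rightarrow> 'k) \<Rightarrow> (nat, 'k::comm_ring_1) dpoly \<Rightarrow> (nat, 'k) dpoly" where
  "right_var d \<equiv> dp_subst d (\<lambda>n. dp_var (Suc (2 * n), 0))"

definition left_part :: "nat \<times> nat \<Rightarrow> (nat, 'k::comm_ring_1) dpoly" where
  "left_part w = (if even (fst w) then dp_var (fst w div 2, snd w) else 1)"

definition right_part :: "nat \<times> nat \<Rightarrow> (nat, 'k::comm_ring_1) dpoly" where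
  "right_part w = (if even (fst w) then 1 else dp_var (fst w div 2, snd w))"

context semi_universal_ext
begin

text \<open>
  Even and odd indeterminates generate two copies of the ring of differential polynomials, whose
  tensor product is the whole ring; \<open>pairing y \<beta>\<close> is the linear form \<open>F \<otimes> H \<mapsto> F(y) \<beta>(H)\<close> on it.
\<close>

definition pairing :: "(nat \<Rightarrow> 'u) \<Rightarrow> ((nat, 'k) dpoly \<Rightarrow> 'u) \<Rightarrow> (nat, 'k) dpoly \<Rightarrow> 'u" where
  "pairing y \<beta> Q = (\<Sum>m\<in>Poly_Mapping.keys Q. ev y (monom_eval left_part m) *
     \<beta> (dp_const (Poly_Mapping.lookup Q m) * monom_eval right_part m))"

definition k_linear :: "((nat, 'k) dpoly \<Rightarrow> 'u) \<Rightarrow> bool" where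
  "k_linear \<beta> \<longleftrightarrow> (\<forall>F H. \<beta> (F + H) = \<beta> F + \<beta> H) \<and> (\<forall>c F. \<beta> (dp_const c * F) = \<iota> c * \<beta> F)"

lemma k_linear_zero: "k_linear \<beta> \<Longrightarrow> \<beta> 0 = 0"
  unfolding k_linear_def by (metis add_0 add_right_cancel)

lemma k_linear_mult: "k_linear \<beta> \<Longrightarrow> k_linear (\<lambda>H. \<beta> (F * H))"
  by (simp add: k_linear_def distrib_left mult.left_commute[of F])

lemma pairing_zero [simp]: "pairing y \<beta> 0 = 0"
  by (simp add: pairing_def)

lemma pairing_single:
  "k_linear \<beta> \<Longrightarrow> pairing y \<beta> (Poly_Mapping.single m c) =
    ev y (monom_eval left_part m) * \<beta> (dp_const c * monom_eval right_part m)"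
  by (cases "c = 0") (simp_all add: pairing_def k_linear_zero)

lemma pairing_add: "k_linear \<beta> \<Longrightarrow> pairing y \<beta> (Q + R) = pairing y \<beta> Q + pairing y \<beta> R"
  unfolding pairing_def
  by (rule setsum_keys_plus_distrib)
    (simp_all add: k_linear_zero dp_const_add distrib_right distrib_left k_linear_def)

lemma pairing_diff: "k_linear \<beta> \<Longrightarrow> pairing y \<beta> (Q - R) = pairing y \<beta> Q - pairing y \<beta> R"
  using pairing_add[of \<beta> y "Q - R" R] by simp

lemma pairing_one: "k_linear \<beta> \<Longrightarrow> pairing y \<beta> 1 = \<beta> 1"
  using pairing_single[of \<beta> y 0 1] by (simp add: ev.hom_one)

lemma pairing_combine:
  "pairing y (\<lambda>H. a * \<beta> H - \<gamma> H) Q = a * pairing y \<beta> Q - pairing y \<gamma> Q"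
  by (simp add: pairing_def right_diff_distrib sum_subtractf sum_distrib_left mult.left_commute[of a])

lemma pairing_const:
  assumes "k_linear \<beta>"
  shows "pairing y \<beta> (dp_const c * Q) = \<iota> c * pairing y \<beta> Q"
proof (induction Q rule: poly_mapping_add_induct)
  case (single m c')
  have "dp_const c * Poly_Mapping.single m c' = Poly_Mapping.single m (c * c')"
    by (simp add: dp_const_def mult_single)
  then show ?case
    using assms by (simp add: pairing_single dp_const_mult mult.assoc) (simp add: k_linear_def)
qed (simp_all add: distrib_left pairing_add assms)

lemma dp_var_mult_single:
  "dp_var w * Poly_Mapping.single m c = Poly_Mapping.single (Poly_Mapping.single w 1 + m) c"
  by (simp add: dp_var_def mult_single)

lemma pairing_left:
  assumes "k_linear \<beta>"
  shows "pairing y \<beta> (left_var d F * Q) = ev y F * pairing y \<beta> Q"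
proof -
  interpret dp: diff_ext d "dp_der d" "dp_const :: _ \<Rightarrow> (nat, 'k) dpoly" by (rule d.diff_ext_dp_const)
  show ?thesis
  proof (induction F arbitrary: Q rule: dpoly_induct)
    case (const c)
    then show ?case by (simp add: pairing_const assms)
  next
    case (var w)
    obtain n q where w: "w = (n, q)" by (cases w)
    show ?case
    proof (induction Q rule: poly_mapping_add_induct)
      case (single m c)
      show ?case
        by (simp add: w dp_var_mult_single pairing_single assms monom_eval_add left_part_def
            right_part_def ev_mult)
    qed (simp_all add: distrib_left pairing_add assms)
  next
    case (add F H)
    then show ?case by (simp add: dp.ev_add ev_add distrib_right pairing_add assms)
  next
    case (mult F H)
    then show ?case by (simp add: dp.ev_mult ev_mult mult.assoc)
  qed
qed

lemma pairing_right:
  assumes "k_linear \<beta>"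
  shows "pairing y \<beta> (right_var d F * Q) = pairing y (\<lambda>H. \<beta> (F * H)) Q"
proof -
  interpret dp: diff_ext d "dp_der d" "dp_const :: _ \<Rightarrow> (nat, 'k) dpoly" by (rule d.diff_ext_dp_const)
  show ?thesis
    using assms
  proof (induction F arbitrary: Q \<beta> rule: dpoly_induct)
    case (const c)
    show ?case
    proof (induction Q rule: poly_mapping_add_induct)
      case (single m c')
      have "dp_const c * Poly_Mapping.single m c' = Poly_Mapping.single m (c * c')"
        by (simp add: dp_const_def mult_single)
      then show ?case
        using const by (simp add: pairing_single k_linear_mult dp_const_mult mult.assoc)
    qed (simp_all add: distrib_left pairing_add const k_linear_mult)
  next
    case (var w)
    obtain n q where w: "w = (n, q)" by (cases w)
    show ?case
    proof (induction Q rule: poly_mapping_add_induct)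
      case (single m c)
      show ?case
        by (simp add: w dp_var_mult_single pairing_single var k_linear_mult monom_eval_add left_part_def
            right_part_def mult.left_commute[of "dp_const c"])
    qed (simp_all add: distrib_left pairing_add var k_linear_mult)
  next
    case (add F H)
    have "pairing y (\<lambda>K. \<beta> (F * K) + \<beta> (H * K)) Q =
        pairing y (\<lambda>K. \<beta> (F * K)) Q + pairing y (\<lambda>K. \<beta> (H * K)) Q"
      by (simp add: pairing_def distrib_left sum.distrib)
    moreover have "\<beta> (F * K + H * K) = \<beta> (F * K) + \<beta> (H * K)" for K
      using add.prems by (simp add: k_linear_def)
    ultimately show ?case using add by (simp add: dp.ev_add distrib_right pairing_add)
  next
    case (mult F H)
    then show ?case by (simp add: dp.ev_mult mult.assoc k_linear_mult)
  qed
qed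

lemma pairing_gen_ideal:
  assumes "k_linear \<beta>" "\<And>s r. s \<in> S \<Longrightarrow> pairing y \<beta> (r * s) = 0" "Q \<in> gen_ideal S"
  shows "pairing y \<beta> Q = 0"
  using assms(3) by induction (simp_all add: pairing_add assms(1,2))

text \<open>A point with a coordinate \<open>u\<close> outside \<open>k\<close> is not rigid: it has
  two specialisations that differ in this coordinate. They are the even and odd parts of a zero of
  two copies of the ideal of \<open>y0\<close> at which \<open>\<Delta>\<close>, that is
  \<open>u \<otimes> 1 - 1 \<otimes> u\<close>, does not vanish. Such a zero exists unless a power
  of \<open>\<Delta>\<close> lies in the ideal; but the pairings given by linear maps
  \<open>\<phi>\<close> kill the ideal and send the \<open>n\<close>-th power to the
  \<open>n\<close>-th iterate of \<open>ad_scale\<close> on \<open>\<phi>\<close>, evaluated at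
  \<open>1\<close>.\<close>

lemma two_points:
  fixes y0 :: "nat \<Rightarrow> 'u"
  assumes fin: "finite {n. y0 n \<noteq> 0}" and u: "y0 n0 \<notin> range \<iota>"
  shows "\<exists>y1 y2. (\<forall>F. ev y0 F = 0 \<longrightarrow> ev y1 F = 0 \<and> ev y2 F = 0) \<and> y1 n0 \<noteq> y2 n0"
proof -
  interpret dp: diff_ext d "dp_der d" "dp_const :: _ \<Rightarrow> (nat, 'k) dpoly" by (rule d.diff_ext_dp_const)
  interpret pd: comm_derivation "dp_der d :: (nat, 'k) dpoly \<Rightarrow> _" by (rule d.comm_derivation_dp_der)
  let ?u = "y0 n0"
  define I0 where "I0 = {F. ev y0 F = 0}"
  define S where "S = left_var d ` I0 \<union> right_var d ` I0"
  define \<Delta> where "\<Delta> = left_var d (dp_var (n0, 0)) - right_var d (dp_var (n0, 0))"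
  have lin: "k_linear (\<lambda>H. \<phi> (ev y0 H))" if "linear_over \<iota> \<phi>" for \<phi>
    using that by (simp add: k_linear_def linear_over_def ev_add ev_mult)
  have step: "pairing y0 (\<lambda>H. \<phi> (ev y0 H)) (\<Delta> * Q) = pairing y0 (\<lambda>H. ad_scale ?u \<phi> (ev y0 H)) Q"
    if "linear_over \<iota> \<phi>" for \<phi> Q
  proof -
    have "pairing y0 (\<lambda>H. \<phi> (ev y0 H)) (\<Delta> * Q) = ?u * pairing y0 (\<lambda>H. \<phi> (ev y0 H)) Q -
        pairing y0 (\<lambda>H. \<phi> (?u * ev y0 H)) Q"
      unfolding \<Delta>_def left_diff_distrib
      by (simp only: pairing_diff[OF lin[OF that]] pairing_left[OF lin[OF that]]
          pairing_right[OF lin[OF that]]) (simp add: ev_mult)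
    also have "\<dots> = pairing y0 (\<lambda>H. ad_scale ?u \<phi> (ev y0 H)) Q"
      by (simp add: ad_scale_def pairing_combine)
    finally show ?thesis .
  qed
  have power: "pairing y0 (\<lambda>H. \<phi> (ev y0 H)) (\<Delta> ^ n) = (ad_scale ?u ^^ n) \<phi> 1"
    if "linear_over \<iota> \<phi>" for \<phi> n
    using that
  proof (induction n arbitrary: \<phi>)
    case 0
    then show ?case by (simp add: pairing_one lin ev.hom_one)
  next
    case (Suc n)
    then show ?case
      by (simp add: step linear_over_ad_scale funpow_Suc_right del: funpow.simps)
  qed
  have kill: "pairing y0 (\<lambda>H. \<phi> (ev y0 H)) Q = 0" if "linear_over \<iota> \<phi>" "Q \<in> gen_ideal S" for \<phi> Q
  proof (rule pairing_gen_ideal[OF lin[OF that(1)] _ that(2)])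
    fix s r assume "s \<in> S"
    then obtain F where F: "ev y0 F = 0" "s = left_var d F \<or> s = right_var d F"
      by (auto simp: S_def I0_def)
    have "\<phi> 0 = 0" using k_linear_zero[OF lin[OF that(1)]] by (simp add: ev_zero)
    then have "pairing y0 (\<lambda>H. \<phi> (ev y0 (F * H))) r = 0"
      by (simp add: ev_mult F pairing_def)
    then show "pairing y0 (\<lambda>H. \<phi> (ev y0 H)) (r * s) = 0"
      using F(2) F(1) by (auto simp: mult.commute[of r] pairing_left pairing_right lin that)
  qed
  have avoid: "\<Delta> ^ n \<notin> gen_ideal S" for n
  proof
    assume mem: "\<Delta> ^ n \<in> gen_ideal S"
    obtain \<phi> where \<phi>: "linear_over \<iota> \<phi>" "(ad_scale ?u ^^ n) \<phi> \<noteq> (\<lambda>_. 0)"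
      using ad_scale_not_nilpotent[OF ring_embedding_axioms u of_nat_neq_0] by blast
    then obtain w where w: "(ad_scale ?u ^^ n) \<phi> w \<noteq> 0" by (auto simp: fun_eq_iff)
    \<comment> \<open>\<open>power\<close> only sees values at \<open>1\<close>; composing
      \<open>\<phi>\<close> with multiplication by \<open>w\<close> commutes with
      \<open>ad_scale\<close> and moves the nonzero value from \<open>w\<close> to
      \<open>1\<close>.\<close>
    have "(ad_scale ?u ^^ m) (\<lambda>v. \<phi> (w * v)) = (\<lambda>v. (ad_scale ?u ^^ m) \<phi> (w * v))" for m
      by (induction m) (simp_all add: ad_scale_def mult.left_commute)
    moreover have "linear_over \<iota> (\<lambda>v. \<phi> (w * v))"
      using \<phi>(1) by (simp add: linear_over_def distrib_left mult.left_commute[of w])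
    ultimately have "(ad_scale ?u ^^ n) \<phi> w = 0"
      using power[of "\<lambda>v. \<phi> (w * v)" n] kill[OF _ mem, of "\<lambda>v. \<phi> (w * v)"] by simp
    then show False using w by simp
  qed
  obtain N where N: "y0 n = 0" if "n \<ge> N" for n
  proof -
    obtain N where "\<forall>n\<in>{n. y0 n \<noteq> 0}. n < N" using fin finite_nat_set_iff_bounded by blast
    then show thesis by (intro that[of N]) auto
  qed
  have "\<exists>y. (\<forall>F\<in>gen_ideal S. ev y F = 0) \<and> (\<forall>F\<in>range (\<lambda>n. \<Delta> ^ n). ev y F \<noteq> 0)"
  proof (rule ex_point_avoiding[of _ _ "2 * N"])
    show "is_ideal (gen_ideal S)" by (rule is_ideal_gen_ideal)
    have "dp_der d s \<in> S" if "s \<in> S" for s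
    proof -
      have "dp_der d F \<in> I0" if "F \<in> I0" for F
        using that by (simp add: I0_def ev_der du.zero)
      then show ?thesis using that by (auto simp: S_def simp flip: dp.ev_der)
    qed
    then show "dp_der d F \<in> gen_ideal S" if "F \<in> gen_ideal S" for F
      using that by (rule comm_derivation.gen_ideal_closed[OF d.comm_derivation_dp_der])
    show "gen_ideal S \<inter> range (\<lambda>n. \<Delta> ^ n) = {}" using avoid by auto
    show "1 \<in> range (\<lambda>n. \<Delta> ^ n)" by (rule range_eqI[of _ _ 0]) simp
    show "a * b \<in> range (\<lambda>n. \<Delta> ^ n)" if "a \<in> range (\<lambda>n. \<Delta> ^ n)" "b \<in> range (\<lambda>n. \<Delta> ^ n)" for a b
      using that by (auto simp flip: power_add)
    show "dp_var (n, 0) \<in> gen_ideal S" if "n \<ge> 2 * N" for n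
    proof (rule gen_ideal_incl)
      have "dp_var (n div 2, 0) \<in> I0" using N[of "n div 2"] that by (simp add: I0_def)
      then have "left_var d (dp_var (n div 2, 0)) \<in> S" "right_var d (dp_var (n div 2, 0)) \<in> S"
        unfolding S_def by blast+
      then show "dp_var (n, 0) \<in> S" by (cases "even n") simp_all
    qed
  qed
  then obtain y where y: "\<And>F. F \<in> gen_ideal S \<Longrightarrow> ev y F = 0" "\<And>n. ev y (\<Delta> ^ n) \<noteq> 0" by blast
  have "ev (\<lambda>n. y (2 * n)) F = 0 \<and> ev (\<lambda>n. y (Suc (2 * n))) F = 0" if "ev y0 F = 0" for F
  proof -
    have "left_var d F \<in> gen_ideal S" "right_var d F \<in> gen_ideal S"
      using that by (auto simp: S_def I0_def intro!: gen_ideal_incl)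
    then show ?thesis using y(1) by (fastforce simp: ev_subst)
  qed
  moreover have "y (2 * n0) \<noteq> y (Suc (2 * n0))"
    using y(2)[of 1] by (simp add: \<Delta>_def ev.hom_diff)
  ultimately show ?thesis by blast
qed

text \<open>
  A dependence relation over the universal field on the points of a differential variety over \<open>k\<close>,
  minimal and with one coefficient \<open>1\<close>, has its coefficients in \<open>k\<close>: they are rational in the coordinates of some
  points, and \<open>two_points\<close> would yield other points giving another value.
\<close>

lemma linear_dependence_descent:
  fixes I :: "(nat, 'k) dpoly set" and F :: "'e \<Rightarrow> (nat, 'k) dpoly"
  defines "Y \<equiv> {y. \<forall>P\<in>I. ev y P = 0}"
  assumes bounded: "\<And>y n. y \<in> Y \<Longrightarrow> n \<ge> N \<Longrightarrow> y n = 0"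
    and "finite E" and "\<And>y. y \<in> Y \<Longrightarrow> (\<Sum>e\<in>E. u e * ev y (F e)) = 0" and "\<exists>e\<in>E. u e \<noteq> 0"
  shows "\<exists>c. (\<exists>e\<in>E. c e \<noteq> 0) \<and> (\<forall>y\<in>Y. (\<Sum>e\<in>E. \<iota> (c e) * ev y (F e)) = 0)"
  using assms(3-5)
proof (induction E arbitrary: u rule: finite_psubset_induct)
  case (psubset E)
  show ?case
  proof (cases "\<exists>E' u'. E' \<subset> E \<and> (\<forall>y\<in>Y. (\<Sum>e\<in>E'. u' e * ev y (F e)) = 0) \<and> (\<exists>e\<in>E'. u' e \<noteq> 0)")
    case True
    then obtain E' u' where E': "E' \<subset> E" "\<forall>y\<in>Y. (\<Sum>e\<in>E'. u' e * ev y (F e)) = 0" "\<exists>e\<in>E'. u' e \<noteq> 0"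
      by blast
    from psubset.IH[OF E'(1) _ E'(3)] E'(2)
    obtain c where c: "\<exists>e\<in>E'. c e \<noteq> 0" "\<forall>y\<in>Y. (\<Sum>e\<in>E'. \<iota> (c e) * ev y (F e)) = 0" by blast
    have "(\<Sum>e\<in>E. \<iota> (if e \<in> E' then c e else 0) * ev y (F e)) = (\<Sum>e\<in>E'. \<iota> (c e) * ev y (F e))" for y
      by (rule sum.mono_neutral_cong_right) (use E'(1) psubset.hyps in \<open>auto simp: hom_zero\<close>)
    then show ?thesis
      using c E'(1) by (intro exI[of _ "\<lambda>e. if e \<in> E' then c e else 0"]) auto
  next
    case False
    obtain a where a: "a \<in> E" "u a \<noteq> 0" using psubset.prems by blast
    define E' where "E' = E - {a}"
    have E': "E' \<subset> E" "E = insert a E'" "a \<notin> E'" "finite E'"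
      using a psubset.hyps by (auto simp: E'_def)
    \<comment> \<open>Minimality of \<open>E\<close>: the functions other than the one with index
      \<open>a\<close> satisfy no nontrivial relation on \<open>Y\<close>.\<close>
    have indep: "u' e = 0" if "\<And>y. y \<in> Y \<Longrightarrow> (\<Sum>e\<in>E'. u' e * ev y (F e)) = 0" "e \<in> E'" for u' e
      using False that E'(1) by blast
    define v where "v e = - u e / u a" for e
    have rel: "ev y (F a) = (\<Sum>e\<in>E'. v e * ev y (F e))" if "y \<in> Y" for y
    proof -
      have "u a * ev y (F a) + (\<Sum>e\<in>E'. u e * ev y (F e)) = 0"
        using psubset.prems(1)[OF that] E' by simp
      then have "ev y (F a) = - (\<Sum>e\<in>E'. u e * ev y (F e)) / u a"
        using a by (simp add: field_simps add_eq_0_iff)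
      also have "\<dots> = (\<Sum>e\<in>E'. v e * ev y (F e))"
        by (simp add: v_def sum_divide_distrib sum_negf)
      finally show ?thesis .
    qed
    have "v e0 \<in> range \<iota>" if e0: "e0 \<in> E'" for e0
    proof (rule ccontr)
      assume notin: "v e0 \<notin> range \<iota>"
      \<comment> \<open>Extension by zero outside \<open>Y\<close> turns independence on
        \<open>Y\<close> into independence of functions on all points, as
        \<open>dual_eval_combs\<close> requires.\<close>
      define q where "q e y = (if y \<in> Y then ev y (F e) else 0)" for e y
      have q_indep: "c e = 0" if c: "\<And>y. (\<Sum>e\<in>E'. c e * q e y) = 0" "e \<in> E'" for c e
      proof (rule indep[OF _ c(2)])
        fix y assume "y \<in> Y"
        then show "(\<Sum>e\<in>E'. c e * ev y (F e)) = 0" using c(1)[of y] by (simp add: q_def)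
      qed
      have "\<exists>L. \<forall>e\<in>E'. eval_comb (L e) \<and> (\<forall>e'\<in>E'. L e (q e') = (if e = e' then 1 else 0))"
        by (rule dual_eval_combs[OF E'(4)]) (rule q_indep)
      with e0 obtain L where L: "eval_comb L" "\<And>e. e \<in> E' \<Longrightarrow> L (q e) = (if e0 = e then 1 else 0)" by blast
      then obtain H0 w where H0: "finite H0" "\<And>f. L f = (\<Sum>h\<in>H0. w h * f h)"
        by (auto simp: eval_comb_def)
      define H where "H = H0 \<inter> Y"
      have H: "finite H" "H \<subseteq> Y" using H0 by (auto simp: H_def)
      have Lq: "(\<Sum>h\<in>H. w h * ev h (F e)) = L (q e)" for e
        unfolding H0(2) H_def by (rule sum.mono_neutral_cong_left) (use H0(1) in \<open>auto simp: q_def\<close>)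
      obtain h where h: "bij_betw h {..<card H} H"
        using ex_bij_betw_nat_finite[OF H(1)] by (auto simp: atLeast0LessThan)
      define r where "r = card H"
      have hY: "h j \<in> Y" if "j < r" for j using h H that by (auto simp: bij_betw_def r_def)
      define idx where "idx j n = Suc (prod_encode (j, n))" for j n
      \<comment> \<open>One large point collects all data of the argument: coordinate
        \<open>0\<close> is the coefficient \<open>v e0\<close>, and block \<open>j\<close> consists
        of the weight \<open>w (h j)\<close> followed by the coordinates of the point
        \<open>h j\<close>. All other coordinates are zero.\<close>
      define y0 where "y0 k = (case k of 0 \<Rightarrow> v e0 | Suc k' \<Rightarrow> (case prod_decode k' of (j, n) \<Rightarrow>
         if j < r then (case n of 0 \<Rightarrow> w (h j) | Suc n \<Rightarrow> h j n) else 0))" for k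
      have y0: "y0 0 = v e0" "\<And>j. j < r \<Longrightarrow> y0 (idx j 0) = w (h j)"
          "\<And>j n. j < r \<Longrightarrow> y0 (idx j (Suc n)) = h j n"
        by (simp_all add: y0_def idx_def)
      define subst_at where "subst_at j = dp_subst d (\<lambda>n. dp_var (idx j (Suc n), 0))" for j
      \<comment> \<open>The functional \<open>L\<close>, with its weights and points turned into
        indeterminates: the value of \<open>pl e\<close> at \<open>y0\<close> is
        \<open>L (q e)\<close>.\<close>
      define pl where "pl e = (\<Sum>j<r. dp_var (idx j 0, 0) * subst_at j (F e))" for e
      have ev_subst_at: "ev y (subst_at j P) = ev (\<lambda>n. y (idx j (Suc n))) P" for y j P
        by (simp add: subst_at_def ev_subst)
      have ev_pl: "ev y (pl e) = (\<Sum>j<r. y (idx j 0) * ev (\<lambda>n. y (idx j (Suc n))) (F e))" for y e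
        by (simp add: pl_def ev.hom_sum ev_mult ev_subst_at)
      have pl_y0: "ev y0 (pl e) = L (q e)" for e
      proof -
        have "ev y0 (pl e) = (\<Sum>j<r. w (h j) * ev (h j) (F e))"
          unfolding ev_pl by (rule sum.cong) (simp_all add: y0)
        also have "\<dots> = (\<Sum>h\<in>H. w h * ev h (F e))"
          using sum.reindex_bij_betw[OF h, of "\<lambda>h. w h * ev h (F e)"] by (simp add: r_def)
        finally show ?thesis by (simp add: Lq)
      qed
      have L_rel: "(\<Sum>e\<in>E'. v e * (if e0 = e then 1 else 0)) = v e0"
        using e0 E'(4) by (simp add: if_distrib cong: if_cong)
      have "L (q a) = L (\<lambda>y. \<Sum>e\<in>E'. v e * q e y)"
        by (rule arg_cong[of _ _ L]) (auto simp: q_def rel)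
      also have "\<dots> = (\<Sum>e\<in>E'. v e * L (q e))" by (rule eval_comb_linear[OF L(1)])
      finally have La: "L (q a) = v e0" using L(2) L_rel by simp
      have fin: "finite {k. y0 k \<noteq> 0}"
      proof (rule finite_subset)
        show "{k. y0 k \<noteq> 0} \<subseteq> insert 0 ((\<lambda>(j, n). idx j n) ` ({..<r} \<times> {..N}))"
        proof
          fix k assume "k \<in> {k. y0 k \<noteq> 0}"
          then have k: "y0 k \<noteq> 0" by simp
          show "k \<in> insert 0 ((\<lambda>(j, n). idx j n) ` ({..<r} \<times> {..N}))"
          proof (cases k)
            case (Suc k')
            obtain j n where jn: "prod_decode k' = (j, n)" by (cases "prod_decode k'")
            then have k': "k = idx j n" by (metis Suc idx_def prod_decode_inverse)
            have "j < r" using k by (auto simp: y0_def Suc jn split: if_splits)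
            moreover have "n \<le> N"
            proof (rule ccontr)
              assume "\<not> n \<le> N"
              then obtain n' where "n = Suc n'" "n' \<ge> N" by (cases n) auto
              then show False using k y0(3)[OF \<open>j < r\<close>] bounded[OF hY[OF \<open>j < r\<close>]] by (simp add: k')
            qed
            ultimately show ?thesis by (auto simp: k')
          qed simp
        qed
      qed simp
      \<comment> \<open>No specialisation \<open>y\<close> of \<open>y0\<close> can change
        coordinate \<open>0\<close>. The blocks of \<open>y\<close> are again points of
        \<open>Y\<close>, so the dependence relation holds at them. The equations saying that
        \<open>L (q e)\<close> is \<open>0\<close> or \<open>1\<close> for \<open>e\<close> in
        \<open>E'\<close>, and that coordinate \<open>0\<close> equals \<open>L (q a)\<close>, are
        polynomial over \<open>k\<close> and persist. Together they force the value
        \<open>v e0\<close>, contrary to \<open>two_points\<close>.\<close>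
      have y_0: "y 0 = v e0" if y: "\<And>P. ev y0 P = 0 \<Longrightarrow> ev y P = 0" for y
      proof -
        have pt: "(\<lambda>n. y (idx j (Suc n))) \<in> Y" if "j < r" for j
        proof -
          have "ev y (subst_at j P) = 0" if "P \<in> I" for P
          proof (rule y)
            have "(\<lambda>n. y0 (idx j (Suc n))) = h j" using y0(3)[OF \<open>j < r\<close>] by (simp add: fun_eq_iff)
            then show "ev y0 (subst_at j P) = 0" using hY[OF \<open>j < r\<close>] that by (simp add: ev_subst_at Y_def)
          qed
          then show ?thesis by (simp add: ev_subst_at Y_def)
        qed
        have "ev y (pl e) = (if e0 = e then 1 else 0)" if "e \<in> E'" for e
        proof -
          have "ev y (pl e - dp_const (if e0 = e then 1 else 0)) = 0"
            by (rule y) (simp add: ev.hom_diff pl_y0 L(2) that hom_zero hom_one)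
          then show ?thesis by (simp add: ev.hom_diff hom_zero hom_one split: if_splits)
        qed
        then have "(\<Sum>e\<in>E'. v e * ev y (pl e)) = v e0" using L_rel by simp
        moreover have "ev y (pl a) = (\<Sum>e\<in>E'. v e * ev y (pl e))"
          unfolding ev_pl sum_distrib_left
          by (subst sum.swap, rule sum.cong)
            (simp_all add: rel pt sum_distrib_left mult.left_commute)
        moreover have "ev y (dp_var (0, 0) - pl a) = 0"
          by (rule y) (simp add: ev.hom_diff pl_y0 La y0)
        ultimately show ?thesis by (simp add: ev.hom_diff)
      qed
      obtain y1 y2 where "\<And>P. ev y0 P = 0 \<Longrightarrow> ev y1 P = 0" "\<And>P. ev y0 P = 0 \<Longrightarrow> ev y2 P = 0" "y1 0 \<noteq> y2 0"
        using two_points[OF fin, of 0] notin y0(1) by auto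
      then show False using y_0[of y1] y_0[of y2] by simp
    qed
    then have "\<forall>e\<in>E'. \<exists>c. v e = \<iota> c" by blast
    then obtain c where c: "\<And>e. e \<in> E' \<Longrightarrow> v e = \<iota> (c e)" by metis
    have "(\<Sum>e\<in>E. \<iota> (if e = a then -1 else c e) * ev y (F e)) = 0" if "y \<in> Y" for y
    proof -
      have "(\<Sum>e\<in>E'. \<iota> (if e = a then -1 else c e) * ev y (F e)) = (\<Sum>e\<in>E'. v e * ev y (F e))"
        by (rule sum.cong) (use E'(3) c in auto)
      then show ?thesis using E' rel[OF that] by (simp add: hom_uminus hom_one)
    qed
    then show ?thesis
      using a by (intro exI[of _ "\<lambda>e. if e = a then -1 else c e"]) auto
  qed
qed

end

section \<open>Quotients of differential polynomial rings\<close>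

abbreviation cls :: "'a::comm_ring_1 set \<Rightarrow> 'a \<Rightarrow> 'a set" where
  "cls J F \<equiv> J +>\<^bsub>cring_class_ops\<^esub> F"

text \<open>The construction of \<open>coord_ring\<close> for an arbitrary ideal, so that
  \<open>A\<close> and the test algebras are treated alike.\<close>

definition dquot :: "('k \<Rightarrow> 'k) \<Rightarrow> ('v, 'k::field) dpoly set \<Rightarrow> ('k, ('v, 'k) dpoly set) dalg" where
  "dquot d J = ring.extend (cring_class_ops Quot J)
     (dalg.fields (\<lambda>C. \<Union>F\<in>C. cls J (dp_der d F)) (\<lambda>c. cls J (dp_const c)))"

lemma coord_ring_eq_dquot: "coord_ring d du \<iota> G = dquot d (van_ideal du \<iota> G)"
  by (simp add: coord_ring_def dquot_def)

lemma cls_eq: "cls J F = {a + F |a. a \<in> J}"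
  by (auto simp: a_r_coset_def' class_simps)

locale diff_ideal = comm_derivation d for d :: "'k::field \<Rightarrow> 'k" +
  fixes J :: "('v, 'k) dpoly set"
  assumes ideal: "is_ideal J" and der_closed: "F \<in> J \<Longrightarrow> dp_der d F \<in> J"
begin

lemma cls_eq_iff: "cls J F = cls J H \<longleftrightarrow> F - H \<in> J"
proof
  assume "cls J F = cls J H"
  moreover have "F \<in> cls J F" using is_ideal_zero[OF ideal] by (auto simp: cls_eq intro: exI[of _ 0])
  ultimately show "F - H \<in> J" by (auto simp: cls_eq)
next
  assume FH: "F - H \<in> J"
  have "a + F = (a + (F - H)) + H" "a + H = (a - (F - H)) + F" for a by simp_all
  then show "cls J F = cls J H"
    unfolding cls_eq using is_ideal_add[OF ideal _ FH] is_ideal_diff[OF ideal _ FH]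
    by (auto, metis, metis)
qed

lemma ideal_class: "Ideal.ideal J cring_class_ops"
proof (rule idealI)
  show "ring (cring_class_ops :: ('v, 'k) dpoly ring)"
    using cring_class by (rule cring.axioms)
  show "subgroup J (add_monoid cring_class_ops)"
  proof
    show "inv\<^bsub>add_monoid cring_class_ops\<^esub> x \<in> J" if "x \<in> J" for x
      using is_ideal_uminus[OF ideal that] uminus_class[of x] by (simp add: a_inv_def)
  qed (auto simp: class_simps intro: is_ideal_zero[OF ideal] is_ideal_add[OF ideal])
qed (auto simp: class_simps intro: is_ideal_mult[OF ideal] is_ideal_mult_right[OF ideal])

lemma dquot_simps:
  "carrier (dquot d J) = range (cls J)"
  "one (dquot d J) = cls J 1" "zero (dquot d J) = cls J 0"
  "mult (dquot d J) (cls J F) (cls J H) = cls J (F * H)"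
  "add (dquot d J) (cls J F) (cls J H) = cls J (F + H)"
  "der (dquot d J) (cls J F) = cls J (dp_der d F)"
  "emb (dquot d J) c = cls J (dp_const c)"
proof -
  interpret I: Ideal.ideal J "cring_class_ops :: ('v, 'k) dpoly ring" by (rule ideal_class)
  show "carrier (dquot d J) = range (cls J)"
    by (auto simp: dquot_def ring.extend_def FactRing_def A_RCOSETS_def' class_simps)
  show "one (dquot d J) = cls J 1"
    by (simp add: dquot_def ring.extend_def FactRing_def class_simps)
  have "cls J 0 = J" by (auto simp: cls_eq)
  then show "zero (dquot d J) = cls J 0"
    by (simp add: dquot_def ring.extend_def FactRing_def)
  show "mult (dquot d J) (cls J F) (cls J H) = cls J (F * H)"
    using I.rcoset_mult_add[of F H]
    by (simp add: dquot_def ring.extend_def FactRing_def class_simps)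
  show "add (dquot d J) (cls J F) (cls J H) = cls J (F + H)"
    using I.a_rcos_sum[of F H]
    by (simp add: dquot_def ring.extend_def FactRing_def class_simps)
  interpret p: comm_derivation "dp_der d :: ('v, 'k) dpoly \<Rightarrow> _" by (rule comm_derivation_dp_der)
  have "cls J (dp_der d H) = cls J (dp_der d F)" if "H \<in> cls J F" for H
  proof -
    have "H - F \<in> J" using that by (auto simp: cls_eq)
    then show ?thesis using der_closed[of "H - F"] by (simp add: cls_eq_iff p.diff)
  qed
  moreover have "F \<in> cls J F" using is_ideal_zero[OF ideal] by (auto simp: cls_eq intro: exI[of _ 0])
  ultimately have "(\<Union>H\<in>cls J F. cls J (dp_der d H)) = cls J (dp_der d F)" by blast
  then show "der (dquot d J) (cls J F) = cls J (dp_der d F)"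
    by (simp add: dquot_def ring.extend_def dalg.fields_def)
  show "emb (dquot d J) c = cls J (dp_const c)"
    by (simp add: dquot_def ring.extend_def dalg.fields_def)
qed

lemma dquot_carrier [simp, intro]: "cls J F \<in> carrier (dquot d J)"
  by (simp add: dquot_simps)

lemma dquot_carrierE:
  assumes "C \<in> carrier (dquot d J)"
  obtains F where "C = cls J F"
  using assms by (auto simp: dquot_simps)

lemma cring_dquot: "cring (dquot d J)"
proof (rule cringI)
  show "abelian_group (dquot d J)"
  proof (rule abelian_groupI)
    fix x assume "x \<in> carrier (dquot d J)"
    then obtain F where "x = cls J F" by (rule dquot_carrierE)
    then have "cls J (- F) \<oplus>\<^bsub>dquot d J\<^esub> x = \<zero>\<^bsub>dquot d J\<^esub>" by (simp add: dquot_simps)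
    then show "\<exists>y\<in>carrier (dquot d J). y \<oplus>\<^bsub>dquot d J\<^esub> x = \<zero>\<^bsub>dquot d J\<^esub>" by blast
  qed (auto simp: dquot_simps add_ac)
  show "comm_monoid (dquot d J)"
    by (rule comm_monoidI) (auto simp: dquot_simps mult_ac)
qed (auto simp: dquot_simps distrib_right)

lemma is_dalg_dquot: "is_dalg d (dquot d J)"
proof -
  interpret p: comm_derivation "dp_der d :: ('v, 'k) dpoly \<Rightarrow> _" by (rule comm_derivation_dp_der)
  have "derivation (dquot d J) (der (dquot d J))"
    by (auto simp: derivation_def dquot_simps p.add p.mult)
  moreover have "emb (dquot d J) \<in> ring_hom cring_class_ops (dquot d J)"
    by (rule ring_hom_memI) (auto simp: dquot_simps class_simps dp_const_add dp_const_mult)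
  ultimately show ?thesis
    by (simp add: is_dalg_def cring_dquot) (simp add: dquot_simps)
qed

lemma finsum_dquot:
  "finite S \<Longrightarrow> finsum (dquot d J) (\<lambda>s. cls J (f s)) S = cls J (sum f S)"
proof (induction S rule: finite_induct)
  case (insert s S)
  interpret cring "dquot d J" by (rule cring_dquot)
  show ?case using insert by (simp add: dquot_simps)
qed (simp add: dquot_simps cring.cring_simprules abelian_monoid.finsum_empty
    abelian_group.axioms ring.axioms cring.axioms cring_dquot)

definition rep_of :: "('v, 'k) dpoly set \<Rightarrow> ('v, 'k) dpoly" where
  "rep_of C = (SOME F. C = cls J F)"

lemma cls_rep_of: "C \<in> carrier (dquot d J) \<Longrightarrow> cls J (rep_of C) = C"
  unfolding rep_of_def by (rule dquot_carrierE, assumption) (metis (mono_tags, lifting) someI)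

lemma rep_of_cls: "rep_of (cls J F) - F \<in> J"
  using cls_rep_of[OF dquot_carrier, of F] cls_eq_iff by blast

end

text \<open>The points of \<open>G\<close> with values in test algebras that the proof feeds to the
  representations all arise in this way, from a substitution that respects the ideals.\<close>

locale diff_ideal_pair = I: diff_ideal d I + J: diff_ideal d J
  for d :: "'k::field \<Rightarrow> 'k" and I :: "('v, 'k) dpoly set" and J :: "('w, 'k) dpoly set" +
  fixes z :: "'v \<Rightarrow> ('w, 'k) dpoly"
  assumes subst_in: "F \<in> I \<Longrightarrow> dp_subst d z F \<in> J"
begin

definition subst_hom :: "('v, 'k) dpoly set \<Rightarrow> ('w, 'k) dpoly set" where
  "subst_hom = (\<lambda>C\<in>carrier (dquot d I). cls J (dp_subst d z (I.rep_of C)))"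

lemma subst_hom_cls: "subst_hom (cls I F) = cls J (dp_subst d z F)"
proof -
  interpret dp: diff_ext d "dp_der d" "dp_const :: _ \<Rightarrow> ('w, 'k) dpoly" by (rule I.diff_ext_dp_const)
  show ?thesis
    using subst_in[OF I.rep_of_cls[of F]] by (simp add: subst_hom_def J.cls_eq_iff dp.ev.hom_diff)
qed

lemma subst_hom_in: "subst_hom \<in> dalg_hom (dquot d I) (dquot d J)"
proof -
  interpret dp: diff_ext d "dp_der d" "dp_const :: _ \<Rightarrow> ('w, 'k) dpoly" by (rule I.diff_ext_dp_const)
  have "subst_hom \<in> ring_hom (dquot d I) (dquot d J)"
    by (rule ring_hom_memI)
      (auto simp: I.dquot_simps J.dquot_simps subst_hom_cls dp.ev_add dp.ev_mult dp.ev.hom_one)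
  moreover have "subst_hom \<in> extensional (carrier (dquot d I))"
    by (simp add: subst_hom_def)
  ultimately show ?thesis
    by (auto simp: dalg_hom_def I.dquot_simps J.dquot_simps subst_hom_cls dp.ev_der)
qed

end

text \<open>Classes modulo the kernel of \<open>f\<close> are faithfully recorded by their values
  under \<open>f\<close>, so computations in the quotient become computations in the target. The
  target carries no derivation; it is enough that the kernel is differential.\<close>

locale quot_test = comm_derivation d + f: ring_embedding f
  for d :: "'k::field \<Rightarrow> 'k" and f :: "('v, 'k) dpoly \<Rightarrow> 't::comm_ring_1" +
  fixes J :: "('v, 'k) dpoly set"
  assumes J_eq: "J = {F. f F = 0}" and f_der: "f F = 0 \<Longrightarrow> f (dp_der d F) = 0"
begin

sublocale diff_ideal d J
  by unfold_locales (auto simp: J_eq is_ideal_def f.hom_zero f.hom_add f.hom_mult f_der)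

definition test :: "('v, 'k) dpoly set \<Rightarrow> 't" where
  "test C = f (rep_of C)"

lemma mem_J_iff: "F \<in> J \<longleftrightarrow> f F = 0"
  by (simp add: J_eq)

lemma test_cls [simp]: "test (cls J F) = f F"
  using rep_of_cls[of F] by (simp add: test_def mem_J_iff f.hom_diff)

lemma test_inject:
  "C \<in> carrier (dquot d J) \<Longrightarrow> D \<in> carrier (dquot d J) \<Longrightarrow> test C = test D \<longleftrightarrow> C = D"
  by (elim dquot_carrierE) (simp add: cls_eq_iff mem_J_iff f.hom_diff)

lemma test_mult: "C \<in> carrier (dquot d J) \<Longrightarrow> D \<in> carrier (dquot d J) \<Longrightarrow>
    test (C \<otimes>\<^bsub>dquot d J\<^esub> D) = test C * test D"
  by (auto elim!: dquot_carrierE simp: dquot_simps f.hom_mult)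

lemma test_add: "C \<in> carrier (dquot d J) \<Longrightarrow> D \<in> carrier (dquot d J) \<Longrightarrow>
    test (C \<oplus>\<^bsub>dquot d J\<^esub> D) = test C + test D"
  by (auto elim!: dquot_carrierE simp: dquot_simps f.hom_add)

lemma test_one: "test \<one>\<^bsub>dquot d J\<^esub> = 1"
  and test_zero: "test \<zero>\<^bsub>dquot d J\<^esub> = 0"
  by (simp_all add: dquot_simps f.hom_one f.hom_zero)

lemma test_finsum:
  assumes "g \<in> S \<rightarrow> carrier (dquot d J)"
  shows "test (finsum (dquot d J) g S) = (\<Sum>s\<in>S. test (g s))"
proof -
  interpret cring "dquot d J" by (rule cring_dquot)
  show ?thesis
    using assms
    by (induction S rule: infinite_finite_induct) (simp_all add: test_zero test_add Pi_iff)
qed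

lemma test_add_pow:
  assumes "C \<in> carrier (dquot d J)"
  shows "test (add_pow (dquot d J) (n::nat) C) = of_nat n * test C"
proof -
  interpret cring "dquot d J" by (rule cring_dquot)
  show ?thesis
    using assms by (induction n) (simp_all add: test_zero test_add algebra_simps)
qed

end

section \<open>The coordinate ring as a ring of functions\<close>

lemma (in ring_embedding) hom_of_int: "\<iota> (of_int n) = of_int n"
  by (cases n) (simp_all add: hom_of_nat hom_diff hom_uminus hom_one hom_add)

lemma (in ring_embedding) hom_det: "\<iota> (det M) = det (\<chi> i j. \<iota> (M $ i $ j))"
  by (simp add: det_def hom_sum hom_mult hom_of_int hom_prod)

locale diff_group = semi_universal_ext d du \<iota>
  for d :: "'k::field_char_0 \<Rightarrow> 'k" and du :: "'u::field \<Rightarrow> 'u" and \<iota> +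
  fixes G :: "('u^'n^'n) set"
  assumes lin_diff_alg_group: "lin_diff_alg_group du \<iota> G"
begin

abbreviation "I \<equiv> van_ideal du \<iota> G"
abbreviation "A \<equiv> coord_ring d du \<iota> G"
abbreviation "X \<equiv> coord_mat du \<iota> G"

lemma one_in_G: "mat 1 \<in> G"
  and mult_in_G: "g \<in> G \<Longrightarrow> h \<in> G \<Longrightarrow> g ** h \<in> G"
  and inv_in_G: "g \<in> G \<Longrightarrow> matrix_inv g \<in> G"
  and G_invertible: "g \<in> G \<Longrightarrow> invertible g"
  using lin_diff_alg_group by (auto simp: lin_diff_alg_group_def)

lemma matrix_inv_G: "g \<in> G \<Longrightarrow> g ** matrix_inv g = mat 1"
  "g \<in> G \<Longrightarrow> matrix_inv g ** g = mat 1"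
  using G_invertible[of g] someI_ex[of "\<lambda>h. g ** h = mat 1 \<and> h ** g = mat 1"]
  by (auto simp: invertible_def matrix_inv_def)

lemma det_G: "g \<in> G \<Longrightarrow> det g \<noteq> 0"
  using G_invertible by (simp add: invertible_det_nz)

text \<open>
  Functions on \<open>G\<close> are extended to all matrices by their value at the identity, so that ring
  operations and equality are those of functions.
\<close>

definition retract :: "'u^'n^'n \<Rightarrow> 'u^'n^'n" where
  "retract g = (if g \<in> G then g else mat 1)"

lemma retract_in_G: "retract g \<in> G"
  by (simp add: retract_def one_in_G)

lemma retract_G [simp]: "g \<in> G \<Longrightarrow> retract g = g"
  by (simp add: retract_def)

definition fn :: "('n, 'k) gl_dpoly \<Rightarrow> 'u^'n^'n \<Rightarrow> 'u" where
  "fn F = (\<lambda>g. ev (gl_coord (retract g)) F)"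

lemma fn_retract: "fn F (retract g) = fn F g"
  by (simp add: fn_def retract_in_G)

lemma fn_zero_iff: "fn F = 0 \<longleftrightarrow> F \<in> I"
  unfolding fn_def van_ideal_def fun_eq_iff using retract_in_G by (auto) (metis retract_G)

lemma ring_embedding_fn: "ring_embedding fn"
  by unfold_locales (auto simp: fn_def fun_eq_iff ev_add ev_mult ev.hom_one)

sublocale fn: ring_embedding fn
  by (rule ring_embedding_fn)

lemma fn_der: "fn (dp_der d F) = (\<lambda>g. du (fn F g))"
  by (simp add: fn_def ev_der)

sublocale A: quot_test d fn I
proof -
  have "fn (dp_der d F) = 0" if "fn F = 0" for F
    using that by (simp add: fn_der fun_eq_iff du.zero)
  then show "quot_test d fn I"
    by unfold_locales (auto simp: fn_zero_iff)
qed

lemma A_eq: "A = dquot d I"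
  by (rule coord_ring_eq_dquot)

abbreviation "fun_of \<equiv> A.test"

lemma fun_of_retract: "fun_of C (retract g) = fun_of C g"
  by (simp add: A.test_def fn_retract)

lemma fun_of_der: "C \<in> carrier A \<Longrightarrow> fun_of (der A C) = (\<lambda>g. du (fun_of C g))"
  unfolding A_eq by (auto elim!: A.dquot_carrierE simp: A.dquot_simps fn_der)

lemma fun_of_emb: "fun_of (emb A c) = (\<lambda>g. \<iota> c)"
  unfolding A_eq by (simp add: A.dquot_simps) (simp add: fn_def)

text \<open>The coordinates are numbered because test algebras and points over the universal field
  use indeterminates indexed by \<open>nat\<close>. Indeterminates outside the range of
  \<open>enc\<close> are sent to \<open>0\<close>, so \<open>nat_ideal\<close> contains them and its
  quotient is a copy of \<open>A\<close>.\<close>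

definition enc :: "('n \<times> 'n) option \<Rightarrow> nat" where
  "enc = (SOME e. inj e)"

lemma inj_enc: "inj enc"
proof -
  obtain e :: "('n \<times> 'n) option \<Rightarrow> nat" where "inj e"
    using finite_imp_inj_to_nat_seg[of "UNIV :: ('n \<times> 'n) option set"] by auto
  then show ?thesis unfolding enc_def by (rule someI[where P = inj])
qed

lemma enc_eq_iff [simp]: "enc v = enc w \<longleftrightarrow> v = w"
  using inj_enc by (auto dest: injD)

lemma inv_enc [simp]: "inv_into UNIV enc (enc v) = v"
  by (simp add: inj_enc)

lemma enc_bound: "\<exists>N. \<forall>n\<ge>N. n \<notin> range enc"
proof -
  have "finite (range enc)" by simp
  then obtain N where "\<forall>n\<in>range enc. n < N" using finite_nat_set_iff_bounded by blast
  then show ?thesis by (metis not_le)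
qed

definition nat_coord :: "'u^'n^'n \<Rightarrow> nat \<Rightarrow> 'u" where
  "nat_coord g n = (if n \<in> range enc then gl_coord g (inv_into UNIV enc n) else 0)"

lemma nat_coord_enc [simp]: "nat_coord g (enc v) = gl_coord g v"
  by (simp add: nat_coord_def)

abbreviation "to_nat_dp \<equiv> dp_subst d (\<lambda>v. dp_var (enc v, 0))"
abbreviation "of_nat_dp \<equiv> dp_subst d (\<lambda>n. if n \<in> range enc then dp_var (inv_into UNIV enc n, 0) else 0)"

lemma ev_to_nat_dp: "ev (nat_coord g) (to_nat_dp F) = ev (gl_coord g) F"
  by (simp add: ev_subst)

lemma ev_of_nat_dp: "ev (gl_coord g) (of_nat_dp P) = ev (nat_coord g) P"
proof -
  have "(\<lambda>n. ev (gl_coord g) (if n \<in> range enc then dp_var (inv_into UNIV enc n, 0) else 0)) = nat_coord g"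
    by (auto simp: fun_eq_iff nat_coord_def ev_zero)
  then show ?thesis by (simp add: ev_subst)
qed

definition nat_ideal :: "(nat, 'k) dpoly set" where
  "nat_ideal = {P. fn (of_nat_dp P) = 0}"

lemma nat_ideal_iff: "P \<in> nat_ideal \<longleftrightarrow> (\<forall>g\<in>G. ev (nat_coord g) P = 0)"
  unfolding nat_ideal_def mem_Collect_eq fn_zero_iff van_ideal_def by (simp add: ev_of_nat_dp)

sublocale dp_gl: diff_ext d "dp_der d" "dp_const :: _ \<Rightarrow> ('n, 'k) gl_dpoly"
  by (rule d.diff_ext_dp_const)

sublocale nat: quot_test d "\<lambda>P. fn (of_nat_dp P)" nat_ideal
proof -
  have "fn (of_nat_dp (dp_der d P)) = 0" if "fn (of_nat_dp P) = 0" for P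
    using that by (simp add: dp_gl.ev_der fn_der fun_eq_iff du.zero)
  then show "quot_test d (\<lambda>P. fn (of_nat_dp P)) nat_ideal"
    by unfold_locales
      (simp_all add: nat_ideal_def dp_gl.ev_add dp_gl.ev_mult dp_gl.ev.hom_one fn.hom_add fn.hom_mult fn.hom_one)
qed

abbreviation gl_var :: "('n \<times> 'n) option \<Rightarrow> ('n, 'k) gl_dpoly" where
  "gl_var v \<equiv> dp_var (v, 0)"

definition det_dp :: "('n, 'k) gl_dpoly" where
  "det_dp = det (\<chi> i j. gl_var (Some (i, j)))"

lemma ev_det_dp: "ev y det_dp = det (\<chi> i j. y (Some (i, j)))"
  by (simp add: det_dp_def ev.hom_det)

lemma det_relation: "gl_var None * det_dp - 1 \<in> I"
proof -
  have "ev (gl_coord g) (gl_var None * det_dp - 1) = 0" if "g \<in> G" for g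
  proof -
    have "(\<chi> i j. gl_coord g (Some (i, j))) = g" by (simp add: vec_eq_iff gl_coord_def)
    then show ?thesis
      using det_G[OF that] by (simp add: ev.hom_diff ev_mult ev_det_dp ev.hom_one) (simp add: gl_coord_def)
  qed
  then show ?thesis by (simp add: van_ideal_def)
qed

text \<open>A zero comes from \<open>G\<close> because \<open>G\<close> is closed: the relation
  \<open>det_relation\<close> makes the matrix read off from \<open>y\<close> invertible and fixes
  the coordinate of the inverse determinant, and the defining equations of \<open>G\<close> lie in
  \<open>I\<close>.\<close>

lemma nat_ideal_zeros:
  "(\<forall>P\<in>nat_ideal. ev y P = 0) \<longleftrightarrow> y \<in> nat_coord ` G"
proof
  assume y: "\<forall>P\<in>nat_ideal. ev y P = 0"
  define g :: "'u^'n^'n" where "g = (\<chi> i j. y (enc (Some (i, j))))"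
  have gl: "ev (\<lambda>v. y (enc v)) F = 0" if "F \<in> I" for F
  proof -
    have "to_nat_dp F \<in> nat_ideal"
      using that by (simp add: nat_ideal_iff ev_to_nat_dp van_ideal_def)
    with y have "ev y (to_nat_dp F) = 0" by blast
    then show ?thesis by (simp add: ev_subst)
  qed
  have "y (enc None) * det g = 1"
    using gl[OF det_relation] by (simp add: ev.hom_diff ev_mult ev_det_dp ev.hom_one g_def)
  then have det: "det g \<noteq> 0" "y (enc None) = inverse (det g)"
    by (auto simp: inverse_unique mult.commute intro: inverse_unique[symmetric])
  obtain S :: "('n \<times> 'n, 'k) dpoly set" where
    S: "G = {g. invertible g \<and> (\<forall>F\<in>S. ev (\<lambda>(i, j). g $ i $ j) F = 0)}"
    using lin_diff_alg_group by (auto simp: lin_diff_alg_group_def)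
  have "ev (\<lambda>(i, j). g $ i $ j) F = 0" if "F \<in> S" for F
  proof -
    have "ev (gl_coord h) (dp_subst d (\<lambda>p. gl_var (Some p)) F) = ev (\<lambda>(i, j). h $ i $ j) F" for h
    proof -
      have "(\<lambda>p. gl_coord h (Some p)) = (\<lambda>(i, j). h $ i $ j)" by (auto simp: gl_coord_def)
      then show ?thesis by (simp add: ev_subst)
    qed
    then have "dp_subst d (\<lambda>p. gl_var (Some p)) F \<in> I"
      using that S by (auto simp: van_ideal_def)
    from gl[OF this] have "ev (\<lambda>p. y (enc (Some p))) F = 0" by (simp add: ev_subst)
    moreover have "(\<lambda>p. y (enc (Some p))) = (\<lambda>(i, j). g $ i $ j)" by (auto simp: g_def)
    ultimately show ?thesis by simp
  qed
  then have "g \<in> G" using det(1) S by (simp add: invertible_det_nz)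
  moreover have "y = nat_coord g"
  proof
    fix n
    show "y n = nat_coord g n"
    proof (cases "n \<in> range enc")
      case True
      then obtain v where "n = enc v" by auto
      then show ?thesis by (cases v) (auto simp: gl_coord_def det(2) g_def)
    next
      case False
      then have "dp_var (n, 0) \<in> nat_ideal" by (simp add: nat_ideal_iff nat_coord_def)
      then have "ev y (dp_var (n, 0)) = 0" using y by blast
      then show ?thesis using False by (simp add: nat_coord_def)
    qed
  qed
  ultimately show "y \<in> nat_coord ` G" by blast
qed (auto simp: nat_ideal_iff)

text \<open>\<open>linear_dependence_descent\<close> applies since the zeros of
  \<open>nat_ideal\<close> are exactly the points of \<open>G\<close>, whose coordinates vanish
  beyond the range of \<open>enc\<close>.\<close>

lemma fn_descent:
  assumes "finite E" "\<And>e. e \<in> E \<Longrightarrow> f e \<in> range fn" "\<And>g. (\<Sum>e\<in>E. u e * f e g) = 0" "\<exists>e\<in>E. u e \<noteq> 0"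
  shows "\<exists>c. (\<exists>e\<in>E. c e \<noteq> 0) \<and> (\<forall>g. (\<Sum>e\<in>E. \<iota> (c e) * f e g) = 0)"
proof -
  obtain F where F: "\<And>e. e \<in> E \<Longrightarrow> f e = fn (F e)"
  proof -
    have "\<forall>e\<in>E. \<exists>F. f e = fn F" using assms(2) by blast
    then show thesis using that by (auto dest: bchoice)
  qed
  obtain N where N: "\<And>n. n \<ge> N \<Longrightarrow> n \<notin> range enc" using enc_bound by blast
  have "\<exists>c. (\<exists>e\<in>E. c e \<noteq> 0) \<and>
      (\<forall>y\<in>{y. \<forall>P\<in>nat_ideal. ev y P = 0}. (\<Sum>e\<in>E. \<iota> (c e) * ev y (to_nat_dp (F e))) = 0)"
  proof (rule linear_dependence_descent[where u = u and N = N])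
    show "y n = 0" if "y \<in> {y. \<forall>P\<in>nat_ideal. ev y P = 0}" "n \<ge> N" for y n
      using that N by (auto simp: nat_ideal_zeros nat_coord_def)
    fix y assume "y \<in> {y. \<forall>P\<in>nat_ideal. ev y P = 0}"
    then obtain g where g: "g \<in> G" "y = nat_coord g" by (auto simp: nat_ideal_zeros)
    have "(\<Sum>e\<in>E. u e * ev y (to_nat_dp (F e))) = (\<Sum>e\<in>E. u e * f e g)"
      by (rule sum.cong) (simp_all add: F fn_def g ev_to_nat_dp)
    then show "(\<Sum>e\<in>E. u e * ev y (to_nat_dp (F e))) = 0" by (simp add: assms(3))
  qed (use assms in auto)
  then obtain c where c: "\<exists>e\<in>E. c e \<noteq> 0"
      "\<And>y. \<forall>P\<in>nat_ideal. ev y P = 0 \<Longrightarrow> (\<Sum>e\<in>E. \<iota> (c e) * ev y (to_nat_dp (F e))) = 0" by blast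
  have "(\<Sum>e\<in>E. \<iota> (c e) * f e g) = 0" for g
  proof -
    have "(\<Sum>e\<in>E. \<iota> (c e) * f e g) = (\<Sum>e\<in>E. \<iota> (c e) * ev (nat_coord (retract g)) (to_nat_dp (F e)))"
      by (rule sum.cong) (simp_all add: F fn_def ev_to_nat_dp)
    moreover have "\<forall>P\<in>nat_ideal. ev (nat_coord (retract g)) P = 0"
      using nat_ideal_zeros retract_in_G by blast
    ultimately show ?thesis using c(2) by simp
  qed
  then show ?thesis using c(1) by blast
qed

end

section \<open>Representations as matrices of functions\<close>

context diff_group
begin

lemma coord_mat_eq: "X i j = cls I (gl_var (Some (i, j)))"
  by (simp add: coord_mat_def)

text \<open>The value at the inverse determinant is forced as the inverse of the value at
  \<open>det_dp\<close>, and the values at derivatives are forced by compatibility with the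
  derivations. This is what gives the definite descriptions in \<open>points\<close> a
  meaning.\<close>

lemma dalg_hom_unique:
  assumes B: "is_dalg d B" and l: "l1 \<in> dalg_hom A B" "l2 \<in> dalg_hom A B"
    and eq: "\<And>i j. l1 (X i j) = l2 (X i j)"
  shows "l1 = l2"
proof -
  interpret B: cring B using B by (simp add: is_dalg_def)
  define agree where "agree F \<longleftrightarrow> l1 (cls I F) = l2 (cls I F)" for F
  have hom: "l \<in> ring_hom A B" "\<And>c. l (emb A c) = emb B c" "\<And>C. C \<in> carrier A \<Longrightarrow> l (der A C) = der B (l C)"
    if "l \<in> {l1, l2}" for l
    using that l by (auto simp: dalg_hom_def)
  have l_mult: "l (cls I (F * H)) = l (cls I F) \<otimes>\<^bsub>B\<^esub> l (cls I H)" if "l \<in> {l1, l2}" for l F H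
    using ring_hom_mult[OF hom(1)[OF that], of "cls I F" "cls I H"] by (simp add: A_eq A.dquot_simps)
  have l_add: "l (cls I (F + H)) = l (cls I F) \<oplus>\<^bsub>B\<^esub> l (cls I H)" if "l \<in> {l1, l2}" for l F H
    using ring_hom_add[OF hom(1)[OF that], of "cls I F" "cls I H"] by (simp add: A_eq A.dquot_simps)
  have l_const: "l (cls I (dp_const c)) = emb B c" if "l \<in> {l1, l2}" for l c
    using hom(2)[OF that, of c] by (simp add: A_eq A.dquot_simps)
  have l_der: "l (cls I (dp_der d F)) = der B (l (cls I F))" if "l \<in> {l1, l2}" for l F
    using hom(3)[OF that, of "cls I F"] by (simp add: A_eq A.dquot_simps)
  have l_closed: "l (cls I F) \<in> carrier B" if "l \<in> {l1, l2}" for l F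
    using ring_hom_closed[OF hom(1)[OF that], of "cls I F"] by (simp add: A_eq)
  have const: "agree (dp_const c)" for c by (simp add: agree_def l_const)
  have add: "agree (F + H)" if "agree F" "agree H" for F H using that by (simp add: agree_def l_add)
  have mult: "agree (F * H)" if "agree F" "agree H" for F H using that by (simp add: agree_def l_mult)
  have "agree 0" "agree 1" using const[of 0] const[of 1] by simp_all
  then have sum: "agree (sum f S)" if "\<And>s. s \<in> S \<Longrightarrow> agree (f s)" for f :: "('n \<Rightarrow> 'n) \<Rightarrow> _" and S
    using that by (induction S rule: infinite_finite_induct) (auto intro: add)
  have prod: "agree (prod f S)" if "\<And>s. s \<in> S \<Longrightarrow> agree (f s)" for f :: "'n \<Rightarrow> _" and S
    using that \<open>agree 1\<close> by (induction S rule: infinite_finite_induct) (auto intro: mult)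
  have "agree (of_int n)" for n
    using const[of "of_int n"] by (simp add: dp_gl.hom_of_int)
  moreover have "agree (gl_var (Some (i, j)))" for i j
    using eq[of i j] by (simp add: agree_def coord_mat_eq)
  ultimately have det: "agree det_dp"
    unfolding det_dp_def det_def by (intro sum mult prod) simp_all
  have "cls I (gl_var None * det_dp) = cls I 1"
    using det_relation by (simp add: A.cls_eq_iff)
  then have T: "l (cls I (gl_var None)) \<otimes>\<^bsub>B\<^esub> l (cls I det_dp) = \<one>\<^bsub>B\<^esub>" if "l \<in> {l1, l2}" for l
    using ring_hom_one[OF hom(1)[OF that]] that by (simp flip: l_mult add: A_eq A.dquot_simps)
  have None: "agree (gl_var None)"
    unfolding agree_def
  proof (rule B.inv_unique)
    show "l1 (cls I (gl_var None)) \<otimes>\<^bsub>B\<^esub> l1 (cls I det_dp) = \<one>\<^bsub>B\<^esub>" by (rule T) simp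
    have "l2 (cls I (gl_var None)) \<otimes>\<^bsub>B\<^esub> l1 (cls I det_dp) = \<one>\<^bsub>B\<^esub>"
      using T[of l2] det by (simp add: agree_def)
    then show "l1 (cls I det_dp) \<otimes>\<^bsub>B\<^esub> l2 (cls I (gl_var None)) = \<one>\<^bsub>B\<^esub>"
      by (simp add: B.m_comm l_closed)
  qed (simp_all add: l_closed)
  have var0: "agree (gl_var v)" for v
  proof (cases v)
    case (Some p)
    then show ?thesis using eq by (cases p) (simp add: agree_def coord_mat_eq)
  qed (simp add: None)
  have "agree F" for F
  proof (induction F rule: dpoly_induct)
    case (var w)
    have "agree (dp_var (v, q))" for v q
    proof (induction q)
      case (Suc q)
      then show ?case using l_der[of l1 "dp_var (v, q)"] l_der[of l2 "dp_var (v, q)"] by (simp add: agree_def)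
    qed (rule var0)
    then show ?case by (cases w) simp
  qed (auto intro: const add mult)
  then have "l1 C = l2 C" if "C \<in> carrier A" for C
    using that unfolding A_eq agree_def by (auto elim!: A.dquot_carrierE)
  then show ?thesis using l by (auto simp: dalg_hom_def intro: extensionalityI)
qed

lemma quot_test_ev: "quot_test d (ev y) {P. ev y P = 0}"
  by unfold_locales (auto simp: ev_der du.zero)

definition left_vars :: "('n \<times> 'n) option \<Rightarrow> (nat, 'k) dpoly" where
  "left_vars v = dp_var (2 * enc v, 0)"

definition right_vars :: "('n \<times> 'n) option \<Rightarrow> (nat, 'k) dpoly" where
  "right_vars v = dp_var (Suc (2 * enc v), 0)"

text \<open>The comultiplication in coordinates; the inverse determinant is group-like.\<close>

definition product_vars :: "('n \<times> 'n) option \<Rightarrow> (nat, 'k) dpoly" where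
  "product_vars v = (case v of None \<Rightarrow> left_vars None * right_vars None
     | Some (i, j) \<Rightarrow> (\<Sum>k\<in>UNIV. left_vars (Some (i, k)) * right_vars (Some (k, j))))"

lemma rep_carrier: "diff_rep d A X V \<Longrightarrow> i \<in> basis V \<Longrightarrow> j \<in> basis V \<Longrightarrow> coef V (i, j) \<in> carrier A"
  and rep_finite: "diff_rep d A X V \<Longrightarrow> finite (basis V)"
  by (auto simp: diff_rep_def)

text \<open>The universal field need not be a test algebra, so \<open>g\<close> and \<open>h\<close>
  are replaced by points with values in \<open>?B\<close>, the quotient by the differential
  polynomials vanishing at the pair, with \<open>g\<close> in the even and \<open>h\<close> in the
  odd coordinates. Evaluation embeds \<open>?B\<close> in the universal field, which turns
  multiplicativity of the representation over \<open>?B\<close> into the identity at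
  \<open>g\<close> and \<open>h\<close>.\<close>

lemma rep_mult:
  assumes V: "diff_rep d A X V" and gh: "g \<in> G" "h \<in> G" and ij: "i \<in> basis V" "j \<in> basis V"
  shows "fun_of (coef V (i, j)) (g ** h) =
    (\<Sum>k\<in>basis V. fun_of (coef V (i, k)) g * fun_of (coef V (k, j)) h)"
proof -
  define y where "y n = (if even n then nat_coord g (n div 2) else nat_coord h (n div 2))" for n
  define J where "J = {P. ev y P = 0}"
  interpret J: quot_test d "ev y" J unfolding J_def by (rule quot_test_ev)
  interpret dp: diff_ext d "dp_der d" "dp_const :: _ \<Rightarrow> (nat, 'k) dpoly" by (rule d.diff_ext_dp_const)
  let ?B = "dquot d J"
  have coords: "ev y (left_vars v) = gl_coord g v" "ev y (right_vars v) = gl_coord h v" for v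
    by (simp_all add: left_vars_def right_vars_def y_def)
  have coord_mult: "ev y (product_vars v) = gl_coord (g ** h) v" for v
  proof (cases v)
    case None
    then show ?thesis
      by (simp add: product_vars_def ev_mult coords) (simp add: gl_coord_def det_mul)
  next
    case (Some p)
    then show ?thesis
      by (cases p) (simp add: product_vars_def ev_mult ev.hom_sum coords,
          simp add: gl_coord_def matrix_matrix_mult_def)
  qed
  have sub: "diff_ideal_pair d I J z" if "\<And>v. ev y (z v) = gl_coord f v" "f \<in> G" for z f
  proof unfold_locales
    fix F assume "F \<in> I"
    then show "dp_subst d z F \<in> J" using that by (simp add: J_def ev_subst van_ideal_def)
  qed
  interpret L: diff_ideal_pair d I J left_vars by (rule sub[OF coords(1) gh(1)])
  interpret R: diff_ideal_pair d I J right_vars by (rule sub[OF coords(2) gh(2)])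
  interpret M: diff_ideal_pair d I J product_vars by (rule sub[OF coord_mult]) (rule mult_in_G[OF gh])
  let ?L = L.subst_hom and ?R = R.subst_hom and ?M = M.subst_hom
  have homs: "?L \<in> dalg_hom A ?B" "?R \<in> dalg_hom A ?B" "?M \<in> dalg_hom A ?B"
    using L.subst_hom_in R.subst_hom_in M.subst_hom_in by (simp_all add: A_eq)
  have test_hom: "J.test (?L C) = fun_of C g" "J.test (?R C) = fun_of C h" "J.test (?M C) = fun_of C (g ** h)"
    "?L C \<in> carrier ?B" "?R C \<in> carrier ?B" if "C \<in> carrier A" for C
    using that gh unfolding A_eq
    by (auto elim!: A.dquot_carrierE simp: L.subst_hom_cls R.subst_hom_cls M.subst_hom_cls ev_subst
        coords coord_mult fn_def mult_in_G)
  have prod: "?M (X i j) = (\<Oplus>\<^bsub>?B\<^esub>k\<in>UNIV. ?L (X i k) \<otimes>\<^bsub>?B\<^esub> ?R (X k j))" for i j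
    by (simp add: coord_mat_eq L.subst_hom_cls R.subst_hom_cls M.subst_hom_cls J.dquot_simps
        J.finsum_dquot product_vars_def)
  have "?L \<otimes>\<^bsub>points A X ?B\<^esub> ?R = ?M"
    unfolding points_def
  proof (simp, rule the_equality)
    show "?M \<in> dalg_hom A ?B \<and>
        (\<forall>i j. ?M (X i j) = (\<Oplus>\<^bsub>?B\<^esub>k\<in>UNIV. ?L (X i k) \<otimes>\<^bsub>?B\<^esub> ?R (X k j)))"
      using homs prod by blast
    fix l assume "l \<in> dalg_hom A ?B \<and>
        (\<forall>i j. l (X i j) = (\<Oplus>\<^bsub>?B\<^esub>k\<in>UNIV. ?L (X i k) \<otimes>\<^bsub>?B\<^esub> ?R (X k j)))"
    then show "l = ?M" using homs prod by (intro dalg_hom_unique[OF J.is_dalg_dquot]) auto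
  qed
  moreover have "act V \<in> hom (points A X ?B) (GL (basis V) ?B)"
    using V J.is_dalg_dquot by (simp add: diff_rep_def)
  ultimately have "act V ?M = act V ?L \<otimes>\<^bsub>GL (basis V) ?B\<^esub> act V ?R"
    using Group.hom_mult[of "act V" "points A X ?B" "GL (basis V) ?B" ?L ?R] homs by (simp add: points_def)
  then have "act V ?M (i, j) = (act V ?L \<otimes>\<^bsub>GL (basis V) ?B\<^esub> act V ?R) (i, j)" by simp
  then have "?M (coef V (i, j)) =
      (\<Oplus>\<^bsub>?B\<^esub>k\<in>basis V. act V ?L (i, k) \<otimes>\<^bsub>?B\<^esub> act V ?R (k, j))"
    using ij by (simp add: act_def GL_def units_of_mult mat_monoid_def)
  then have "J.test (?M (coef V (i, j))) =
      J.test (\<Oplus>\<^bsub>?B\<^esub>k\<in>basis V. act V ?L (i, k) \<otimes>\<^bsub>?B\<^esub> act V ?R (k, j))" by simp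
  also have "\<dots> = (\<Sum>k\<in>basis V. J.test (act V ?L (i, k) \<otimes>\<^bsub>?B\<^esub> act V ?R (k, j)))"
  proof (rule J.test_finsum)
    interpret cring ?B by (rule J.cring_dquot)
    show "(\<lambda>k. act V ?L (i, k) \<otimes>\<^bsub>?B\<^esub> act V ?R (k, j)) \<in> basis V \<rightarrow> carrier ?B"
      using ij V by (auto simp: act_def test_hom rep_carrier)
  qed
  also have "\<dots> = (\<Sum>k\<in>basis V. fun_of (coef V (i, k)) g * fun_of (coef V (k, j)) h)"
    by (rule sum.cong) (use ij V in \<open>simp_all add: act_def J.test_mult test_hom rep_carrier\<close>)
  finally show ?thesis using V ij by (simp add: test_hom rep_carrier)
qed

lemma fn_of_nat_to_nat: "fn (of_nat_dp (to_nat_dp F)) = fn F"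
  by (simp add: fn_def fun_eq_iff ev_of_nat_dp ev_to_nat_dp)

lemma to_nat_dp_in: "F \<in> I \<Longrightarrow> to_nat_dp F \<in> nat_ideal"
  by (simp add: nat_ideal_def fn_of_nat_to_nat) (simp add: fn_zero_iff)

text \<open>The representation is applied to the universal point, the isomorphism of
  \<open>A\<close> with its copy over \<open>nat\<close>. Its matrix of coefficients is invertible
  there, and the inverse is transported back to \<open>A\<close>.\<close>

lemma rep_inverse:
  assumes V: "diff_rep d A X V"
  shows "\<exists>b. \<forall>i\<in>basis V. \<forall>j\<in>basis V. b (i, j) \<in> carrier A \<and>
    (\<Sum>k\<in>basis V. fun_of (coef V (i, k)) * fun_of (b (k, j))) = (if i = j then 1 else 0) \<and>
    (\<Sum>k\<in>basis V. fun_of (b (i, k)) * fun_of (coef V (k, j))) = (if i = j then 1 else 0)"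
proof -
  interpret P: diff_ideal_pair d I nat_ideal "\<lambda>v. dp_var (enc v, 0)"
    by unfold_locales (rule to_nat_dp_in)
  let ?B = "dquot d nat_ideal" and ?P = P.subst_hom
  interpret B: cring ?B by (rule nat.cring_dquot)
  have P: "?P \<in> dalg_hom A ?B" using P.subst_hom_in by (simp add: A_eq)
  have test_P: "nat.test (?P C) = fun_of C" "?P C \<in> carrier ?B" if "C \<in> carrier A" for C
    using that unfolding A_eq
    by (auto elim!: A.dquot_carrierE simp: P.subst_hom_cls fn_of_nat_to_nat)
  have "act V \<in> hom (points A X ?B) (GL (basis V) ?B)"
    using V nat.is_dalg_dquot by (simp add: diff_rep_def)
  then have "act V ?P \<in> Units (mat_monoid (basis V) ?B)"
    using P by (auto simp: hom_def points_def GL_def units_of_carrier)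
  then obtain N where N: "N \<in> carrier (mat_monoid (basis V) ?B)"
      "N \<otimes>\<^bsub>mat_monoid (basis V) ?B\<^esub> act V ?P = \<one>\<^bsub>mat_monoid (basis V) ?B\<^esub>"
      "act V ?P \<otimes>\<^bsub>mat_monoid (basis V) ?B\<^esub> N = \<one>\<^bsub>mat_monoid (basis V) ?B\<^esub>"
    by (auto simp: Units_def)
  define b where "b p = cls I (of_nat_dp (nat.rep_of (N p)))" for p
  have N_carrier: "N (i, j) \<in> carrier ?B" if "i \<in> basis V" "j \<in> basis V" for i j
    using N(1) that by (auto simp: mat_monoid_def)
  have test_N: "nat.test (N p) = fun_of (b p)" for p
    by (simp add: b_def nat.test_def)
  have left: "(\<Sum>k\<in>basis V. fun_of (b (i, k)) * fun_of (coef V (k, j))) = (if i = j then 1 else 0)"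
    if ij: "i \<in> basis V" "j \<in> basis V" for i j
  proof -
    have "(\<Oplus>\<^bsub>?B\<^esub>k\<in>basis V. N (i, k) \<otimes>\<^bsub>?B\<^esub> act V ?P (k, j)) = (if i = j then \<one>\<^bsub>?B\<^esub> else \<zero>\<^bsub>?B\<^esub>)"
      using fun_cong[OF N(2), of "(i, j)"] ij by (simp add: mat_monoid_def)
    then have "nat.test (\<Oplus>\<^bsub>?B\<^esub>k\<in>basis V. N (i, k) \<otimes>\<^bsub>?B\<^esub> act V ?P (k, j)) = (if i = j then 1 else 0)"
      by (simp add: nat.test_one nat.test_zero)
    also have "nat.test (\<Oplus>\<^bsub>?B\<^esub>k\<in>basis V. N (i, k) \<otimes>\<^bsub>?B\<^esub> act V ?P (k, j)) =
        (\<Sum>k\<in>basis V. nat.test (N (i, k) \<otimes>\<^bsub>?B\<^esub> act V ?P (k, j)))"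
      by (rule nat.test_finsum) (use ij V in \<open>auto simp: act_def test_P rep_carrier N_carrier\<close>)
    also have "\<dots> = (\<Sum>k\<in>basis V. fun_of (b (i, k)) * fun_of (coef V (k, j)))"
      by (rule sum.cong) (use ij V in \<open>simp_all add: act_def nat.test_mult test_P test_N rep_carrier N_carrier\<close>)
    finally show ?thesis .
  qed
  have right: "(\<Sum>k\<in>basis V. fun_of (coef V (i, k)) * fun_of (b (k, j))) = (if i = j then 1 else 0)"
    if ij: "i \<in> basis V" "j \<in> basis V" for i j
  proof -
    have "(\<Oplus>\<^bsub>?B\<^esub>k\<in>basis V. act V ?P (i, k) \<otimes>\<^bsub>?B\<^esub> N (k, j)) = (if i = j then \<one>\<^bsub>?B\<^esub> else \<zero>\<^bsub>?B\<^esub>)"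
      using fun_cong[OF N(3), of "(i, j)"] ij by (simp add: mat_monoid_def)
    then have "nat.test (\<Oplus>\<^bsub>?B\<^esub>k\<in>basis V. act V ?P (i, k) \<otimes>\<^bsub>?B\<^esub> N (k, j)) = (if i = j then 1 else 0)"
      by (simp add: nat.test_one nat.test_zero)
    also have "nat.test (\<Oplus>\<^bsub>?B\<^esub>k\<in>basis V. act V ?P (i, k) \<otimes>\<^bsub>?B\<^esub> N (k, j)) =
        (\<Sum>k\<in>basis V. nat.test (act V ?P (i, k) \<otimes>\<^bsub>?B\<^esub> N (k, j)))"
      by (rule nat.test_finsum) (use ij V in \<open>auto simp: act_def test_P rep_carrier N_carrier\<close>)
    also have "\<dots> = (\<Sum>k\<in>basis V. fun_of (coef V (i, k)) * fun_of (b (k, j)))"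
      by (rule sum.cong) (use ij V in \<open>simp_all add: act_def nat.test_mult test_P test_N rep_carrier N_carrier\<close>)
    finally show ?thesis .
  qed
  have "b p \<in> carrier A" for p by (simp add: b_def A_eq)
  then show ?thesis using left right by blast
qed

section \<open>Faithfulness\<close>

text \<open>
  A point at which no element of a maximal multiplicative set of \<open>R\<close> vanishes: it is generic on a
  component of the variety of \<open>R\<close>, so that the local ring of \<open>R\<close> at it is a field.
\<close>

lemma ex_generic_point_of_subring:
  assumes R: "R \<subseteq> range fn" "1 \<in> R" "\<And>f f'. f \<in> R \<Longrightarrow> f' \<in> R \<Longrightarrow> f * f' \<in> R"
  obtains g0 where "g0 \<in> G" "\<And>f. f \<in> R \<Longrightarrow> f g0 = 0 \<Longrightarrow> \<exists>s\<in>R. s g0 \<noteq> 0 \<and> s * f = 0"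
proof -
  define \<M> where "\<M> = {S. S \<subseteq> R \<and> 1 \<in> S \<and> 0 \<notin> S \<and> (\<forall>f\<in>S. \<forall>f'\<in>S. f * f' \<in> S)}"
  have "\<exists>S\<in>\<M>. \<forall>T\<in>\<M>. S \<subseteq> T \<longrightarrow> T = S"
  proof (rule subset_Zorn_nonempty)
    have "{1} \<in> \<M>" using R by (simp add: \<M>_def)
    then show "\<M> \<noteq> {}" by blast
    fix \<C> assume \<C>: "\<C> \<noteq> {}" "subset.chain \<M> \<C>"
    then have sub: "S \<in> \<M>" if "S \<in> \<C>" for S using that by (auto simp: subset.chain_def)
    have "f * f' \<in> \<Union>\<C>" if "f \<in> S" "S \<in> \<C>" "f' \<in> S'" "S' \<in> \<C>" for f f' S S'
    proof -
      have "S \<subseteq> S' \<or> S' \<subseteq> S" using \<C> that by (auto simp: subset.chain_def)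
      then obtain T where "T \<in> \<C>" "f \<in> T" "f' \<in> T"
        using \<open>f \<in> S\<close> \<open>S \<in> \<C>\<close> \<open>f' \<in> S'\<close> \<open>S' \<in> \<C>\<close> by blast
      then show ?thesis using sub[of T] by (auto simp: \<M>_def)
    qed
    moreover obtain S where "S \<in> \<C>" using \<C>(1) by blast
    then have "1 \<in> \<Union>\<C>" using sub[of S] by (auto simp: \<M>_def)
    moreover have "\<Union>\<C> \<subseteq> R" "0 \<notin> \<Union>\<C>" using sub by (auto simp: \<M>_def)
    ultimately show "\<Union>\<C> \<in> \<M>" unfolding \<M>_def by blast
  qed
  then obtain S where S: "S \<in> \<M>" and max: "\<And>T. T \<in> \<M> \<Longrightarrow> S \<subseteq> T \<Longrightarrow> T = S" by blast
  have S_R: "S \<subseteq> R" and S1: "1 \<in> S" and S0: "0 \<notin> S" and S_mult: "\<And>f f'. f \<in> S \<Longrightarrow> f' \<in> S \<Longrightarrow> f * f' \<in> S"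
    using S by (auto simp: \<M>_def)
  have kill: "\<exists>s\<in>S. s * f = 0" if f: "f \<in> R" "f \<notin> S" for f
  proof -
    let ?T = "{s * f ^ n |s n. s \<in> S}"
    have incl: "S \<subseteq> ?T"
    proof
      fix s assume "s \<in> S"
      moreover have "s = s * f ^ 0" by simp
      ultimately show "s \<in> ?T" by blast
    qed
    have "f = 1 * f ^ 1" by simp
    then have "f \<in> ?T" using S1 by blast
    then have "?T \<notin> \<M>" using max[OF _ incl] f by blast
    moreover have "f ^ n \<in> R" for n
    proof (induction n)
      case 0
      show ?case by (simp only: power_0 R(2))
    next
      case (Suc n)
      show ?case by (simp only: power_Suc R(3)[OF f(1) Suc])
    qed
    then have "?T \<subseteq> R" using S_R R(3) by blast
    moreover have "t * t' \<in> ?T" if "t \<in> ?T" "t' \<in> ?T" for t t'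
    proof -
      obtain s n s' n' where "t = s * f ^ n" "t' = s' * f ^ n'" "s \<in> S" "s' \<in> S" using \<open>t \<in> ?T\<close> \<open>t' \<in> ?T\<close> by blast
      moreover from this have "t * t' = (s * s') * f ^ (n + n')" by (simp add: power_add mult_ac)
      ultimately show ?thesis using S_mult by blast
    qed
    moreover have "1 \<in> ?T" using incl S1 by blast
    ultimately have "0 \<in> ?T" unfolding \<M>_def by blast
    then obtain s n where s: "s \<in> S" "0 = s * f ^ n" by blast
    have pow: "(f ^ n) g = f g ^ n" for g by (induction n) simp_all
    have "(s * f) g = 0" for g
      using fun_cong[OF s(2), of g] by (auto simp: pow)
    then show ?thesis using s(1) by (auto simp: fun_eq_iff)
  qed
  \<comment> \<open>The preimage of \<open>S\<close>: a zero of \<open>nat_ideal\<close> at which no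
    element of \<open>M\<close> vanishes is a point of \<open>G\<close> at which no element of
    \<open>S\<close> vanishes.\<close>
  define M where "M = {P. fn (of_nat_dp P) \<in> S}"
  obtain N where N: "\<And>n. n \<ge> N \<Longrightarrow> n \<notin> range enc" using enc_bound by blast
  have "\<exists>y. (\<forall>P\<in>nat_ideal. ev y P = 0) \<and> (\<forall>P\<in>M. ev y P \<noteq> 0)"
  proof (rule ex_point_avoiding[of _ _ N])
    show "nat_ideal \<inter> M = {}" using S0 by (auto simp: M_def nat_ideal_def)
    show "1 \<in> M" using S1 by (simp add: M_def nat.f.hom_one)
    show "P * Q \<in> M" if "P \<in> M" "Q \<in> M" for P Q
      using that S_mult by (simp add: M_def nat.f.hom_mult)
    show "dp_var (n, 0) \<in> nat_ideal" if "n \<ge> N" for n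
      using N[OF that] by (simp add: nat_ideal_iff nat_coord_def)
  qed (fact nat.ideal, rule nat.der_closed)
  then obtain y where y: "\<forall>P\<in>nat_ideal. ev y P = 0" "\<And>P. P \<in> M \<Longrightarrow> ev y P \<noteq> 0" by blast
  then obtain g0 where g0: "g0 \<in> G" "y = nat_coord g0" using nat_ideal_zeros by blast
  have S_g0: "s g0 \<noteq> 0" if "s \<in> S" for s
  proof -
    obtain F where F: "s = fn F" using S_R R(1) \<open>s \<in> S\<close> by blast
    then have "to_nat_dp F \<in> M" using that by (simp add: M_def fn_of_nat_to_nat)
    from y(2)[OF this] show ?thesis using g0 by (simp add: F fn_def ev_to_nat_dp)
  qed
  show thesis
  proof (rule that[OF g0(1)])
    fix f assume "f \<in> R" "f g0 = 0"
    then have "f \<notin> S" using S_g0 by blast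
    then show "\<exists>s\<in>R. s g0 \<noteq> 0 \<and> s * f = 0" using kill[OF \<open>f \<in> R\<close>] S_g0 S_R by blast
  qed
qed

text \<open>
  Two points of \<open>G\<close> with values in \<open>A \<otimes>\<^bsub>R\<^esub> A\<close> have the same image in \<open>GL(V)\<close>, so that
  \<open>f \<otimes> 1 = 1 \<otimes> f\<close> there. If \<open>f\<close> were not in the fraction field of \<open>R\<close> at the generic point \<open>g0\<close>, a
  semilinear functional \<open>\<mu>\<close> with \<open>\<mu>(1) = 0\<close> and \<open>\<mu>(f) = 1\<close> would separate these elements.
\<close>

lemma faithful_imp_fraction:
  assumes R: "R \<subseteq> range fn" "\<And>f f'. f \<in> R \<Longrightarrow> f' \<in> R \<Longrightarrow> f * f' \<in> R"
      "\<And>f f'. f \<in> R \<Longrightarrow> f' \<in> R \<Longrightarrow> f + f' \<in> R" "\<And>c. (\<lambda>_. \<iota> c) \<in> R" "\<And>f. f \<in> R \<Longrightarrow> (\<lambda>g. du (f g)) \<in> R"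
    and V: "diff_rep d A X V" "faithful_rep d A X V"
      "\<And>i j. i \<in> basis V \<Longrightarrow> j \<in> basis V \<Longrightarrow> fun_of (coef V (i, j)) \<in> R"
    and g0: "g0 \<in> G" "\<And>f. f \<in> R \<Longrightarrow> f g0 = 0 \<Longrightarrow> \<exists>s\<in>R. s g0 \<noteq> 0 \<and> s * f = 0"
    and f: "f \<in> range fn"
  shows "\<exists>s\<in>R. s g0 \<noteq> 0 \<and> s * f \<in> R"
proof (rule ccontr)
  assume not: "\<not> ?thesis"
  have const1: "(\<lambda>_. \<iota> 1) = (1 :: 'u^'n^'n \<Rightarrow> 'u)" by (simp add: fun_eq_iff hom_one)
  have uminus: "- f \<in> R" if "f \<in> R" for f
  proof -
    have "(\<lambda>_. \<iota> (- 1)) * f = - f" by (simp add: fun_eq_iff hom_uminus hom_one)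
    then show ?thesis using R(2)[OF R(4)[of "- 1"] that] by simp
  qed
  obtain \<mu> where \<mu>: "\<And>a b. \<mu> (a + b) = \<mu> a + \<mu> b" "\<And>f a. f \<in> R \<Longrightarrow> \<mu> (f * a) = f g0 * \<mu> a"
    "\<mu> 1 = 0" "\<mu> f = 1"
  proof (rule semilinear_functional[of R "\<lambda>f. f g0" f])
    show "1 \<in> R" using R(4)[of 1] const1 by simp
    show "s * f \<notin> R" if "s \<in> R" "s g0 \<noteq> 0" for s using not that by blast
  qed (use R uminus g0 in auto)
  interpret dp: diff_ext d "dp_der d" "dp_const :: _ \<Rightarrow> (nat, 'k) dpoly" by (rule d.diff_ext_dp_const)
  define \<beta> where "\<beta> P = \<mu> (fn (of_nat_dp P))" for P
  have lin: "k_linear \<beta>"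
    unfolding k_linear_def
  proof (intro conjI allI)
    show "\<beta> (P + Q) = \<beta> P + \<beta> Q" for P Q by (simp add: \<beta>_def nat.f.hom_add \<mu>)
    fix c P
    have "fn (of_nat_dp (dp_const c)) = (\<lambda>_. \<iota> c)" by (simp add: fn_def)
    then show "\<beta> (dp_const c * P) = \<iota> c * \<beta> P"
      using \<mu>(2)[OF R(4)[of c]] by (simp add: \<beta>_def nat.f.hom_mult)
  qed
  have \<beta>_R: "\<beta> (P * Q) = ev (nat_coord g0) P * \<beta> Q" if "fn (of_nat_dp P) \<in> R" for P Q
    using \<mu>(2)[OF that] g0(1) by (simp add: \<beta>_def nat.f.hom_mult) (simp add: fn_def ev_of_nat_dp)
  let ?p = "pairing (nat_coord g0) \<beta>"
  \<comment> \<open>Relations of the tensor square of \<open>A\<close> over \<open>R\<close>: those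
    of \<open>A\<close> in each copy, and the identification of both copies of \<open>R\<close>. The
    generated ideal is not made radical, so that linear functionals can test membership in
    it.\<close>
  define S where "S = left_var d ` nat_ideal \<union> right_var d ` nat_ideal \<union>
    (\<lambda>P. left_var d P - right_var d P) ` {P. fn (of_nat_dp P) \<in> R}"
  define J where "J = gen_ideal S"
  have S_der: "dp_der d s \<in> S" if "s \<in> S" for s
  proof -
    have "fn (of_nat_dp (dp_der d P)) \<in> R" if "fn (of_nat_dp P) \<in> R" for P
      using R(5)[OF that] by (simp add: dp_gl.ev_der fn_der)
    then show ?thesis
      using that nat.der_closed by (auto simp: S_def dp.du.diff simp flip: dp.ev_der)
  qed
  interpret J: diff_ideal d J
    unfolding J_def
    by unfold_locales (rule is_ideal_gen_ideal comm_derivation.gen_ideal_closed[OF d.comm_derivation_dp_der S_der], assumption?)+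
  have kill: "?p Q = 0" if "Q \<in> J" for Q
  proof (rule pairing_gen_ideal[OF lin _ that[unfolded J_def]])
    fix s r assume "s \<in> S"
    then consider P where "P \<in> nat_ideal" "s = left_var d P" | P where "P \<in> nat_ideal" "s = right_var d P"
      | P where "fn (of_nat_dp P) \<in> R" "s = left_var d P - right_var d P"
      by (auto simp: S_def)
    then show "?p (r * s) = 0"
    proof cases
      case (1 P)
      then show ?thesis
        using g0(1) by (simp add: mult.commute[of r] pairing_left[OF lin] nat_ideal_iff)
    next
      case (2 P)
      have "(0 :: 'u^'n^'n \<Rightarrow> 'u) = (\<lambda>_. \<iota> 0)" by (simp add: fun_eq_iff hom_zero)
      then have "fn (of_nat_dp P) \<in> R" using 2(1) R(4)[of 0] by (simp add: nat_ideal_def)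
      moreover have "ev (nat_coord g0) P = 0" using 2(1) g0(1) nat_ideal_iff by blast
      ultimately have "\<beta> (P * H) = 0" for H by (simp add: \<beta>_R)
      then show ?thesis
        by (simp add: 2 mult.commute[of r] pairing_right[OF lin]) (simp add: pairing_def)
    next
      case (3 P)
      have "?p (r * s) = ev (nat_coord g0) P * ?p r - pairing (nat_coord g0) (\<lambda>H. \<beta> (P * H)) r"
        by (simp add: 3 mult.commute[of r] left_diff_distrib pairing_diff[OF lin] pairing_left[OF lin] pairing_right[OF lin])
      also have "pairing (nat_coord g0) (\<lambda>H. \<beta> (P * H)) r = ev (nat_coord g0) P * ?p r"
        unfolding \<beta>_R[OF 3(1)] by (simp add: pairing_def sum_distrib_left mult_ac)
      finally show ?thesis by simp
    qed
  qed
  have left: "dp_subst d left_vars F = left_var d (to_nat_dp F)"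
    and right: "dp_subst d right_vars F = right_var d (to_nat_dp F)" for F
    by (simp_all add: dp.ev_subst left_vars_def[abs_def] right_vars_def[abs_def])
  have "left_var d P \<in> J" "right_var d P \<in> J" if "P \<in> nat_ideal" for P
    using that by (auto simp: J_def S_def intro!: gen_ideal_incl)
  then interpret L: diff_ideal_pair d I J left_vars + R: diff_ideal_pair d I J right_vars
    by unfold_locales (simp_all add: left right to_nat_dp_in)
  let ?L = L.subst_hom and ?R = R.subst_hom and ?B = "dquot d J"
  have "act V ?L = act V ?R"
  proof
    fix p
    show "act V ?L p = act V ?R p"
    proof (cases "p \<in> basis V \<times> basis V")
      case True
      then obtain i j where p: "p = (i, j)" "i \<in> basis V" "j \<in> basis V" by auto
      obtain F where F: "coef V (i, j) = cls I F"
        using rep_carrier[OF V(1) p(2,3)] unfolding A_eq by (rule A.dquot_carrierE)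
      have "fn (of_nat_dp (to_nat_dp F)) \<in> R"
        using V(3)[OF p(2,3)] by (simp add: F fn_of_nat_to_nat)
      then have "left_var d (to_nat_dp F) - right_var d (to_nat_dp F) \<in> J"
        by (auto simp: J_def S_def intro!: gen_ideal_incl)
      then show ?thesis
        using p by (simp add: act_def F L.subst_hom_cls R.subst_hom_cls J.cls_eq_iff left right)
    qed (simp add: act_def)
  qed
  moreover have "inj_on (act V) (carrier (points A X ?B))"
    using V(2) J.is_dalg_dquot by (simp add: faithful_rep_def)
  moreover have "?L \<in> carrier (points A X ?B)" "?R \<in> carrier (points A X ?B)"
    using L.subst_hom_in R.subst_hom_in by (simp_all add: points_def A_eq)
  ultimately have "?L = ?R" by (blast dest: inj_onD)
  obtain F where F: "f = fn F" using f by blast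
  let ?P = "to_nat_dp F"
  have "left_var d ?P - right_var d ?P \<in> J"
    using fun_cong[OF \<open>?L = ?R\<close>, of "cls I F"]
    by (simp add: L.subst_hom_cls R.subst_hom_cls J.cls_eq_iff left right)
  then have "?p (left_var d ?P * 1 - right_var d ?P * 1) = 0" by (simp add: kill)
  moreover have "?p (left_var d ?P * 1 - right_var d ?P * 1) = ev (nat_coord g0) ?P * \<beta> 1 - \<beta> (?P * 1)"
    by (simp only: pairing_diff[OF lin] pairing_left[OF lin] pairing_right[OF lin]
        pairing_one[OF lin] pairing_one[OF k_linear_mult[OF lin]])
  moreover have "\<beta> 1 = 0" by (simp add: \<beta>_def nat.f.hom_one \<mu>)
  moreover have "\<beta> (?P * 1) = 1" by (simp add: \<beta>_def fn_of_nat_to_nat \<mu> flip: F)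
  ultimately show False by simp
qed

end

section \<open>Spans of functions\<close>

text \<open>A member occurring in a relation is expressed by the others and discarded. Inverses of
  nonzero scalars are a hypothesis because the locale only provides a commutative ring; the lemma
  serves both for scalars from \<open>k\<close> and, with the identity embedding, for scalars from
  the universal field.\<close>

lemma (in ring_embedding) independent_subfamily:
  fixes q :: "'e \<Rightarrow> 'x \<Rightarrow> 'a"
  assumes inv: "\<forall>c :: 'k. c \<noteq> 0 \<longrightarrow> (\<exists>c'. c * c' = 1)" and "finite E"
  shows "\<exists>E0 \<tau>. E0 \<subseteq> E \<and> (\<forall>e\<in>E. \<forall>h. q e h = (\<Sum>a\<in>E0. \<iota> (\<tau> e a) * q a h)) \<and>
    (\<forall>c. (\<forall>h. (\<Sum>a\<in>E0. \<iota> (c a) * q a h) = 0) \<longrightarrow> (\<forall>a\<in>E0. c a = 0))"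
  using assms(2)
proof (induction E rule: finite_psubset_induct)
  case (psubset E)
  show ?case
  proof (cases "\<forall>c. (\<forall>h. (\<Sum>a\<in>E. \<iota> (c a) * q a h) = 0) \<longrightarrow> (\<forall>a\<in>E. c a = 0)")
    case True
    have "q e h = (\<Sum>a\<in>E. \<iota> (if e = a then 1 else 0) * q a h)" if "e \<in> E" for e h
      using that psubset.hyps
      by (simp add: if_distrib[of \<iota>] if_distrib[of "\<lambda>x. x * _"] hom_zero hom_one cong: if_cong)
    then show ?thesis
      using True by (intro exI[of _ E] exI[of _ "\<lambda>e a. if e = a then 1 else 0"]) blast
  next
    case False
    then obtain c e1 where c: "\<And>h. (\<Sum>a\<in>E. \<iota> (c a) * q a h) = 0" "e1 \<in> E" "c e1 \<noteq> 0" by blast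
    have "E - {e1} \<subset> E" using c(2) by blast
    from psubset.IH[OF this]
    obtain E0 \<tau> where E0: "E0 \<subseteq> E - {e1}" "\<forall>e\<in>E - {e1}. \<forall>h. q e h = (\<Sum>a\<in>E0. \<iota> (\<tau> e a) * q a h)"
        "\<forall>c. (\<forall>h. (\<Sum>a\<in>E0. \<iota> (c a) * q a h) = 0) \<longrightarrow> (\<forall>a\<in>E0. c a = 0)"
      by (elim exE conjE) (rule that)
    obtain c' where c': "c e1 * c' = 1" using inv[rule_format, OF c(3)] by blast
    have e1: "q e1 h = (\<Sum>a\<in>E0. \<iota> (\<Sum>e\<in>E - {e1}. - c' * c e * \<tau> e a) * q a h)" for h
    proof -
      have "\<iota> (c e1) * q e1 h + (\<Sum>e\<in>E - {e1}. \<iota> (c e) * q e h) = 0"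
        using c(1)[of h] sum.remove[OF psubset.hyps c(2), of "\<lambda>a. \<iota> (c a) * q a h"] by simp
      then have rel: "\<iota> (c e1) * q e1 h = - (\<Sum>e\<in>E - {e1}. \<iota> (c e) * q e h)"
        by (simp add: add_eq_0_iff2)
      have "q e1 h = \<iota> (c e1 * c') * q e1 h" by (simp only: c' hom_one mult_1)
      also have "\<dots> = \<iota> c' * (\<iota> (c e1) * q e1 h)" by (simp only: hom_mult mult_ac)
      also have "\<dots> = (\<Sum>e\<in>E - {e1}. \<iota> (- c' * c e) * q e h)"
        unfolding rel by (simp add: sum_distrib_left sum_negf hom_uminus hom_mult mult.assoc)
      also have "\<dots> = (\<Sum>e\<in>E - {e1}. \<Sum>a\<in>E0. \<iota> (- c' * c e * \<tau> e a) * q a h)"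
        by (rule sum.cong) (simp_all add: bspec[OF E0(2)] sum_distrib_left hom_mult hom_uminus mult.assoc)
      also have "\<dots> = (\<Sum>a\<in>E0. \<iota> (\<Sum>e\<in>E - {e1}. - c' * c e * \<tau> e a) * q a h)"
        unfolding hom_sum sum_distrib_right by (rule sum.swap)
      finally show ?thesis .
    qed
    define \<tau>' where "\<tau>' e a = (if e = e1 then (\<Sum>e\<in>E - {e1}. - c' * c e * \<tau> e a) else \<tau> e a)" for e a
    have "q e h = (\<Sum>a\<in>E0. \<iota> (\<tau>' e a) * q a h)" if "e \<in> E" for e h
    proof (cases "e = e1")
      case True
      then show ?thesis using e1[of h] by (simp only: \<tau>'_def if_True refl)
    next
      case False
      then have "q e h = (\<Sum>a\<in>E0. \<iota> (\<tau> e a) * q a h)" using E0(2) that by blast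
      then show ?thesis using False by (simp add: \<tau>'_def)
    qed
    moreover have "E0 \<subseteq> E" using E0(1) by blast
    ultimately show ?thesis
      using E0(3) by (intro exI[of _ E0] exI[of _ \<tau>'] conjI ballI allI) auto
  qed
qed

context diff_group
begin

text \<open>The rule \<open>agree\<close> is essential: a translate such as
  \<open>\<lambda>g. c (g ** h)\<close> does not follow the convention that functions outside
  \<open>G\<close> take their value at the identity, so only values on \<open>G\<close> may
  count.\<close>

inductive_set uspan :: "('u^'n^'n \<Rightarrow> 'u) set \<Rightarrow> ('u^'n^'n \<Rightarrow> 'u) set" for R where
  incl: "p \<in> R \<Longrightarrow> p \<in> uspan R"
| zero: "(\<lambda>_. 0) \<in> uspan R"
| add: "p \<in> uspan R \<Longrightarrow> q \<in> uspan R \<Longrightarrow> (\<lambda>g. p g + q g) \<in> uspan R"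
| scale: "p \<in> uspan R \<Longrightarrow> (\<lambda>g. c * p g) \<in> uspan R"
| agree: "p \<in> uspan R \<Longrightarrow> (\<And>g. g \<in> G \<Longrightarrow> q g = p g) \<Longrightarrow> q \<in> uspan R"

lemma uspan_sum: "(\<And>s. s \<in> S \<Longrightarrow> p s \<in> uspan R) \<Longrightarrow> (\<lambda>g. \<Sum>s\<in>S. p s g) \<in> uspan R"
  by (induction S rule: infinite_finite_induct) (auto intro: uspan.intros)

lemma uspan_mult:
  assumes R: "\<And>f f'. f \<in> R \<Longrightarrow> f' \<in> R \<Longrightarrow> f * f' \<in> R"
    and p: "p \<in> uspan R" and q: "q \<in> uspan R"
  shows "(\<lambda>g. p g * q g) \<in> uspan R"
  using p
proof induction
  case (incl p)
  show ?case
    using q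
  proof induction
    case (incl q)
    have "p * q \<in> uspan R" using R incl \<open>p \<in> R\<close> by (intro uspan.incl)
    then show ?case by (rule uspan.agree) simp
  next
    case zero
    then show ?case by (simp add: uspan.zero)
  next
    case (add q q')
    then show ?case by (simp add: distrib_left uspan.add)
  next
    case (scale q c)
    from uspan.scale[OF this(2), of c] show ?case by (simp add: mult.left_commute)
  next
    case (agree q q')
    from this(3) show ?case by (rule uspan.agree) (simp add: agree)
  qed
next
  case zero
  then show ?case by (simp add: uspan.zero)
next
  case (add p p')
  then show ?case by (simp add: distrib_right uspan.add)
next
  case (scale p c)
  from uspan.scale[OF this(2), of c] show ?case by (simp add: mult.assoc)
next
  case (agree p p')
  from this(3) show ?case by (rule uspan.agree) (simp add: agree)
qed

lemma uspan_list:
  "f \<in> uspan R \<Longrightarrow> \<exists>ps. snd ` set ps \<subseteq> R \<and> (\<forall>g\<in>G. f g = (\<Sum>(c, p)\<leftarrow>ps. c * p g))"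
proof (induction rule: uspan.induct)
  case (incl p)
  then show ?case by (intro exI[of _ "[(1, p)]"]) simp
next
  case zero
  then show ?case by (intro exI[of _ "[]"]) simp
next
  case (add p q)
  then obtain ps qs where "snd ` set ps \<subseteq> R" "\<forall>g\<in>G. p g = (\<Sum>(c, p)\<leftarrow>ps. c * p g)"
    "snd ` set qs \<subseteq> R" "\<forall>g\<in>G. q g = (\<Sum>(c, p)\<leftarrow>qs. c * p g)" by blast
  then show ?case by (intro exI[of _ "ps @ qs"]) (simp add: image_Un)
next
  case (scale p a)
  then obtain ps where ps: "snd ` set ps \<subseteq> R" "\<forall>g\<in>G. p g = (\<Sum>(c, p)\<leftarrow>ps. c * p g)" by blast
  have eq: "(\<Sum>(c, p)\<leftarrow>map (\<lambda>(c, p). (a * c, p)) ps. c * p g) = a * (\<Sum>(c, p)\<leftarrow>ps. c * p g)" for g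
    by (induction ps) (auto simp: algebra_simps)
  have "snd ` set (map (\<lambda>(c, p). (a * c, p)) ps) \<subseteq> R" using ps(1) by auto
  moreover have "\<forall>g\<in>G. a * p g = (\<Sum>(c, p)\<leftarrow>map (\<lambda>(c, p). (a * c, p)) ps. c * p g)"
    unfolding eq using ps(2) by simp
  ultimately show ?case by blast
qed force

text \<open>The tensor square of \<open>R\<close>, seen as functions on pairs of points and compared
  only on \<open>G\<close>.\<close>

inductive_set tens :: "('u^'n^'n \<Rightarrow> 'u) set \<Rightarrow> ('u^'n^'n \<Rightarrow> 'u^'n^'n \<Rightarrow> 'u) set" for R where
  pure: "p \<in> R \<Longrightarrow> q \<in> R \<Longrightarrow> (\<lambda>g h. p g * q h) \<in> tens R"
| zero: "(\<lambda>_ _. 0) \<in> tens R"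
| add: "t \<in> tens R \<Longrightarrow> t' \<in> tens R \<Longrightarrow> (\<lambda>g h. t g h + t' g h) \<in> tens R"
| agree: "t \<in> tens R \<Longrightarrow> (\<And>g h. g \<in> G \<Longrightarrow> h \<in> G \<Longrightarrow> t' g h = t g h) \<Longrightarrow> t' \<in> tens R"

lemma tens_sum: "(\<And>s. s \<in> S \<Longrightarrow> t s \<in> tens R) \<Longrightarrow> (\<lambda>g h. \<Sum>s\<in>S. t s g h) \<in> tens R"
  by (induction S rule: infinite_finite_induct) (auto intro: tens.intros)

lemma tens_mult:
  assumes R: "\<And>f f'. f \<in> R \<Longrightarrow> f' \<in> R \<Longrightarrow> f * f' \<in> R"
    and t: "t \<in> tens R" and t': "t' \<in> tens R"
  shows "(\<lambda>g h. t g h * t' g h) \<in> tens R"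
  using t
proof induction
  case (pure p q)
  show ?case
    using t'
  proof induction
    case (pure p' q')
    have "(\<lambda>g h. (p * p') g * (q * q') h) \<in> tens R"
      using R pure \<open>p \<in> R\<close> \<open>q \<in> R\<close> by (intro tens.pure)
    then show ?case by (rule tens.agree) (simp add: mult_ac)
  next
    case zero
    then show ?case by (simp add: tens.zero)
  next
    case (add t t')
    then show ?case by (simp add: distrib_left tens.add)
  next
    case (agree t t')
    from this(3) show ?case by (rule tens.agree) (simp add: agree)
  qed
next
  case zero
  then show ?case by (simp add: tens.zero)
next
  case (add t t')
  then show ?case by (simp add: distrib_right tens.add)
next
  case (agree t t')
  from this(3) show ?case by (rule tens.agree) (simp add: agree)
qed

lemma tens_list:
  "t \<in> tens R \<Longrightarrow> \<exists>ps. set ps \<subseteq> R \<times> R \<and> (\<forall>g\<in>G. \<forall>h\<in>G. t g h = (\<Sum>(p, q)\<leftarrow>ps. p g * q h))"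
proof (induction rule: tens.induct)
  case (pure p q)
  then show ?case by (intro exI[of _ "[(p, q)]"]) simp
next
  case zero
  then show ?case by (intro exI[of _ "[]"]) simp
next
  case (add t t')
  then obtain ps qs where "set ps \<subseteq> R \<times> R" "\<forall>g\<in>G. \<forall>h\<in>G. t g h = (\<Sum>(p, q)\<leftarrow>ps. p g * q h)"
    "set qs \<subseteq> R \<times> R" "\<forall>g\<in>G. \<forall>h\<in>G. t' g h = (\<Sum>(p, q)\<leftarrow>qs. p g * q h)" by blast
  then show ?case by (intro exI[of _ "ps @ qs"]) simp
qed force

lemma tens_right: "t \<in> tens R \<Longrightarrow> h \<in> G \<Longrightarrow> (\<lambda>g. t g h) \<in> uspan R"
proof (induction rule: tens.induct)
  case (pure p q)
  from uspan.scale[OF uspan.incl[OF this(1)], of "q h"] show ?case by (simp add: mult.commute)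
qed (auto intro: uspan.intros)

text \<open>Write \<open>f\<close> as a combination of finitely many elements of \<open>R\<close>.
  By \<open>fn_descent\<close> these elements and \<open>f\<close> satisfy a nontrivial relation
  over \<open>k\<close>. If \<open>f\<close> occurs in it, solving for \<open>f\<close> ends the
  proof; otherwise one of the elements can be eliminated from the combination, and induction
  applies.\<close>

lemma uspan_descent:
  assumes R: "R \<subseteq> range fn" "(\<lambda>_. 0) \<in> R" "\<And>f f'. f \<in> R \<Longrightarrow> f' \<in> R \<Longrightarrow> f + f' \<in> R"
      "\<And>c f. f \<in> R \<Longrightarrow> (\<lambda>g. \<iota> c * f g) \<in> R"
    and f: "f \<in> uspan R" "f \<in> range fn"
  shows "f \<in> R"
proof -
  have sum: "(\<lambda>g. \<Sum>e\<in>E. \<iota> (c e) * p e g) \<in> R" if "\<And>e. e \<in> E \<Longrightarrow> p e \<in> R" for E :: "nat set" and c p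
    using that
  proof (induction E rule: infinite_finite_induct)
    case (insert e E)
    have "(\<lambda>g. \<iota> (c e) * p e g) + (\<lambda>g. \<Sum>e\<in>E. \<iota> (c e) * p e g) \<in> R"
      using insert by (intro R(3,4)) auto
    then show ?case using insert.hyps by (simp add: plus_fun_def)
  qed (simp_all add: R(2))
  have *: "f \<in> R" if "finite E" "\<And>e. e \<in> E \<Longrightarrow> p e \<in> R" "\<And>g. f g = (\<Sum>e\<in>E. \<kappa> e * p e g)"
    for E :: "nat set" and p \<kappa>
    using that
  proof (induction E arbitrary: \<kappa> rule: finite_psubset_induct)
    case (psubset E)
    let ?E = "insert None (Some ` E)" and ?f = "\<lambda>e. case e of None \<Rightarrow> f | Some e \<Rightarrow> p e"
    have sum_opt: "(\<Sum>e\<in>?E. v e * ?f e g) = v None * f g + (\<Sum>e\<in>E. v (Some e) * p e g)" for v g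
      using psubset.hyps by (simp add: sum.reindex)
    have "\<exists>c. (\<exists>e\<in>?E. c e \<noteq> 0) \<and> (\<forall>g. (\<Sum>e\<in>?E. \<iota> (c e) * ?f e g) = 0)"
    proof (rule fn_descent[where u = "case_option 1 (\<lambda>e. - \<kappa> e)"])
      show "finite ?E" using psubset.hyps by simp
      show "?f e \<in> range fn" if "e \<in> ?E" for e
        using that f(2) psubset.prems(1) R(1) by auto
      show "(\<Sum>e\<in>?E. case_option 1 (\<lambda>e. - \<kappa> e) e * ?f e g) = 0" for g
        unfolding sum_opt using psubset.prems(2)[of g] by (simp add: sum_negf)
    qed auto
    then obtain c where c: "\<exists>e\<in>?E. c e \<noteq> 0"
        and rel: "\<And>g. \<iota> (c None) * f g + (\<Sum>e\<in>E. \<iota> (c (Some e)) * p e g) = 0"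
      unfolding sum_opt by blast
    show ?case
    proof (cases "c None = 0")
      case False
      have "f g = (\<Sum>e\<in>E. \<iota> (- c (Some e) / c None) * p e g)" for g
      proof -
        have inv: "\<iota> (inverse (c None)) * \<iota> (c None) = 1"
          using False by (simp add: hom_one flip: hom_mult)
        have "f g = \<iota> (inverse (c None)) * (\<iota> (c None) * f g)"
          by (simp only: mult.assoc[symmetric] inv mult_1)
        also have "\<iota> (c None) * f g = - (\<Sum>e\<in>E. \<iota> (c (Some e)) * p e g)"
          using rel[of g] by (simp add: add_eq_0_iff2)
        also have "\<iota> (inverse (c None)) * - (\<Sum>e\<in>E. \<iota> (c (Some e)) * p e g) =
            (\<Sum>e\<in>E. \<iota> (- c (Some e) / c None) * p e g)"
          by (simp add: sum_distrib_left sum_negf hom_uminus hom_mult divide_inverse mult_ac)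
        finally show ?thesis .
      qed
      then have "f = (\<lambda>g. \<Sum>e\<in>E. \<iota> (- c (Some e) / c None) * p e g)" by blast
      then show ?thesis using sum[OF psubset.prems(1)] by simp
    next
      case True
      then obtain e1 where e1: "e1 \<in> E" "c (Some e1) \<noteq> 0" using c by auto
      then have nz: "\<iota> (c (Some e1)) \<noteq> 0" by (simp add: \<iota>_eq_0_iff)
      have f_eq: "f g = (\<Sum>e\<in>E - {e1}. (\<kappa> e - \<kappa> e1 * \<iota> (c (Some e)) / \<iota> (c (Some e1))) * p e g)" for g
      proof -
        have "\<iota> (c (Some e1)) * p e1 g + (\<Sum>e\<in>E - {e1}. \<iota> (c (Some e)) * p e g) = 0"
          using rel[of g] True sum.remove[OF psubset.hyps e1(1), of "\<lambda>e. \<iota> (c (Some e)) * p e g"]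
          by (simp add: hom_zero)
        then have p1: "p e1 g = - (\<Sum>e\<in>E - {e1}. \<iota> (c (Some e)) * p e g) / \<iota> (c (Some e1))"
          using nz by (simp add: field_simps add_eq_0_iff)
        have "f g = \<kappa> e1 * p e1 g + (\<Sum>e\<in>E - {e1}. \<kappa> e * p e g)"
          using psubset.prems(2)[of g] sum.remove[OF psubset.hyps e1(1), of "\<lambda>e. \<kappa> e * p e g"] by simp
        also have "\<dots> = (\<Sum>e\<in>E - {e1}. (\<kappa> e - \<kappa> e1 * \<iota> (c (Some e)) / \<iota> (c (Some e1))) * p e g)"
          unfolding p1
          by (simp add: left_diff_distrib sum_subtractf sum_divide_distrib sum_distrib_left mult.assoc)
        finally show ?thesis .
      qed
      show ?thesis
        by (rule psubset.IH[OF _ _ f_eq]) (use e1(1) psubset.prems(1) in auto)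
    qed
  qed
  obtain ps where ps: "snd ` set ps \<subseteq> R" "\<And>g. g \<in> G \<Longrightarrow> f g = (\<Sum>(c, p)\<leftarrow>ps. c * p g)"
    using uspan_list[OF f(1)] by blast
  show ?thesis
  proof (rule *[of "{..<length ps}" "\<lambda>i. snd (ps ! i)" "\<lambda>i. fst (ps ! i)"])
    show mem: "snd (ps ! i) \<in> R" if "i \<in> {..<length ps}" for i using ps(1) that by auto
    fix g
    have "f g = f (retract g)" using f(2) by (auto simp: fn_retract)
    also have "\<dots> = (\<Sum>(c, p)\<leftarrow>ps. c * p (retract g))" using ps(2) retract_in_G by blast
    also have "\<dots> = (\<Sum>i<length ps. fst (ps ! i) * snd (ps ! i) (retract g))"
      by (simp add: sum_list_sum_nth atLeast0LessThan case_prod_beta)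
    also have "\<dots> = (\<Sum>i<length ps. fst (ps ! i) * snd (ps ! i) g)"
    proof (rule sum.cong)
      fix i assume "i \<in> {..<length ps}"
      then have "snd (ps ! i) \<in> range fn" using mem R(1) by blast
      then show "fst (ps ! i) * snd (ps ! i) (retract g) = fst (ps ! i) * snd (ps ! i) g"
        by (auto simp: fn_retract)
    qed simp
    finally show "f g = (\<Sum>i<length ps. fst (ps ! i) * snd (ps ! i) g)" .
  qed simp
qed

section \<open>The ring generated by the coefficients of a representation\<close>

definition mat_fun :: "'i set \<Rightarrow> ('i \<times> 'i \<Rightarrow> 'u^'n^'n \<Rightarrow> 'u) \<Rightarrow> bool" where
  "mat_fun S a \<longleftrightarrow> finite S \<and> (\<forall>i\<in>S. \<forall>j\<in>S. a (i, j) \<in> range fn \<and> a (i, j) (mat 1) = (if i = j then 1 else 0) \<and>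
     (\<forall>g\<in>G. \<forall>h\<in>G. a (i, j) (g ** h) = (\<Sum>k\<in>S. a (i, k) g * a (k, j) h)))"

lemma mat_funD:
  assumes "mat_fun S a"
  shows "finite S" "i \<in> S \<Longrightarrow> j \<in> S \<Longrightarrow> a (i, j) \<in> range fn"
    "i \<in> S \<Longrightarrow> j \<in> S \<Longrightarrow> a (i, j) (mat 1) = (if i = j then 1 else 0)"
    "i \<in> S \<Longrightarrow> j \<in> S \<Longrightarrow> g \<in> G \<Longrightarrow> h \<in> G \<Longrightarrow> a (i, j) (g ** h) = (\<Sum>k\<in>S. a (i, k) g * a (k, j) h)"
  using assms by (auto simp: mat_fun_def)

lemma fun_of_range: "C \<in> carrier A \<Longrightarrow> fun_of C \<in> range fn"
  unfolding A_eq by (auto elim!: A.dquot_carrierE)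

lemma fun_sum_apply: "(\<Sum>s\<in>S. f s) g = (\<Sum>s\<in>S. f s g)" for f :: "'s \<Rightarrow> 'x \<Rightarrow> 'u"
  by (induction S rule: infinite_finite_induct) simp_all

text \<open>Multiplicativity makes the matrix at \<open>mat 1\<close> idempotent, and
  \<open>rep_inverse\<close> makes it invertible; hence it is the identity.\<close>

lemma mat_fun_rep:
  assumes V: "diff_rep d A X V"
  shows "mat_fun (basis V) (\<lambda>p. fun_of (coef V p))"
  unfolding mat_fun_def
proof (intro conjI ballI)
  show fin: "finite (basis V)" using V by (rule rep_finite)
  fix i j assume ij: "i \<in> basis V" "j \<in> basis V"
  show "fun_of (coef V (i, j)) \<in> range fn" using rep_carrier[OF V ij] by (rule fun_of_range)
  show "fun_of (coef V (i, j)) (g ** h) =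
      (\<Sum>k\<in>basis V. fun_of (coef V (i, k)) g * fun_of (coef V (k, j)) h)" if "g \<in> G" "h \<in> G" for g h
    using rep_mult[OF V that ij] .
  let ?a = "\<lambda>i j. fun_of (coef V (i, j)) (mat 1)"
  obtain b where b: "\<And>i j. i \<in> basis V \<Longrightarrow> j \<in> basis V \<Longrightarrow>
      (\<Sum>k\<in>basis V. fun_of (coef V (i, k)) * fun_of (b (k, j))) = (if i = j then 1 else 0)"
    using rep_inverse[OF V] by blast
  let ?b = "\<lambda>i j. fun_of (b (i, j)) (mat 1)"
  have ab: "(\<Sum>k\<in>basis V. ?a i k * ?b k j) = (if i = j then 1 else 0)"
    if "i \<in> basis V" "j \<in> basis V" for i j
    using fun_cong[OF b[OF that], of "mat 1"] by (simp add: fun_sum_apply split: if_splits)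
  have aa: "?a i k = (\<Sum>l\<in>basis V. ?a i l * ?a l k)" if "k \<in> basis V" for k
    using rep_mult[OF V one_in_G one_in_G ij(1) that] by simp
  have "(if i = j then 1 else 0) = (\<Sum>k\<in>basis V. (\<Sum>l\<in>basis V. ?a i l * ?a l k) * ?b k j)"
    using ab[OF ij] aa by simp
  also have "\<dots> = (\<Sum>l\<in>basis V. ?a i l * (\<Sum>k\<in>basis V. ?a l k * ?b k j))"
    by (simp add: sum_distrib_left sum_distrib_right mult.assoc) (rule sum.swap)
  also have "\<dots> = (\<Sum>l\<in>basis V. ?a i l * (if l = j then 1 else 0))"
    by (rule sum.cong) (simp_all add: ab ij)
  also have "\<dots> = ?a i j" using ij fin by (simp add: if_distrib[of "\<lambda>x. _ * x"] cong: if_cong)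
  finally show "?a i j = (if i = j then 1 else 0)" by simp
qed

lemma matrix_inv_mult:
  assumes "g \<in> G" "h \<in> G"
  shows "matrix_inv (g ** h) = matrix_inv h ** matrix_inv g"
proof -
  have "matrix_inv (g ** h) = matrix_inv (g ** h) ** (g ** (h ** matrix_inv h) ** matrix_inv g)"
    using assms by (simp add: matrix_inv_G)
  also have "\<dots> = (matrix_inv (g ** h) ** (g ** h)) ** (matrix_inv h ** matrix_inv g)"
    by (simp add: matrix_mul_assoc)
  also have "\<dots> = matrix_inv h ** matrix_inv g"
    using assms by (simp add: matrix_inv_G mult_in_G)
  finally show ?thesis .
qed

lemma matrix_inv_inv:
  assumes "g \<in> G"
  shows "matrix_inv (matrix_inv g) = g"
proof -
  have "matrix_inv (matrix_inv g) = (g ** matrix_inv g) ** matrix_inv (matrix_inv g)"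
    using assms by (simp add: matrix_inv_G)
  also have "\<dots> = g ** (matrix_inv g ** matrix_inv (matrix_inv g))"
    by (simp only: matrix_mul_assoc)
  also have "\<dots> = g"
    by (simp add: matrix_inv_G(1)[OF inv_in_G[OF assms]])
  finally show ?thesis .
qed

text \<open>The entries of \<open>b\<close>, in the application those of the inverse matrix, enter
  without derivatives, in accordance with the modules of the theorem, where \<open>V\<close> is
  prolonged but its dual is not. Derivatives of \<open>b\<close> are recovered by
  \<open>du_b\<close>.\<close>

inductive_set gen_ring :: "'i set \<Rightarrow> ('i \<times> 'i \<Rightarrow> 'u^'n^'n \<Rightarrow> 'u) \<Rightarrow> ('i \<times> 'i \<Rightarrow> 'u^'n^'n \<Rightarrow> 'u) \<Rightarrow>
    ('u^'n^'n \<Rightarrow> 'u) set" for S a b where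
  const: "(\<lambda>_. \<iota> c) \<in> gen_ring S a b"
| der: "i \<in> S \<Longrightarrow> j \<in> S \<Longrightarrow> (\<lambda>g. (du ^^ q) (a (i, j) g)) \<in> gen_ring S a b"
| inv: "i \<in> S \<Longrightarrow> j \<in> S \<Longrightarrow> b (i, j) \<in> gen_ring S a b"
| add: "f \<in> gen_ring S a b \<Longrightarrow> f' \<in> gen_ring S a b \<Longrightarrow> f + f' \<in> gen_ring S a b"
| mult: "f \<in> gen_ring S a b \<Longrightarrow> f' \<in> gen_ring S a b \<Longrightarrow> f * f' \<in> gen_ring S a b"

lemma gen_ring_zero: "0 \<in> gen_ring S a b"
  using gen_ring.const[of 0 S a b] by (simp add: hom_zero zero_fun_def)

lemma gen_ring_one: "1 \<in> gen_ring S a b"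
  using gen_ring.const[of 1 S a b] by (simp add: hom_one one_fun_def)

lemma gen_ring_coef: "i \<in> S \<Longrightarrow> j \<in> S \<Longrightarrow> a (i, j) \<in> gen_ring S a b"
  using gen_ring.der[of i S j 0 a b] by simp

lemma gen_ring_sum: "(\<And>s. s \<in> T \<Longrightarrow> f s \<in> gen_ring S a b) \<Longrightarrow> sum f T \<in> gen_ring S a b"
  by (induction T rule: infinite_finite_induct) (auto intro: gen_ring.add gen_ring_zero)

lemma gen_ring_prod: "(\<And>s. s \<in> T \<Longrightarrow> f s \<in> gen_ring S a b) \<Longrightarrow> prod f T \<in> gen_ring S a b"
  by (induction T rule: infinite_finite_induct) (auto intro: gen_ring.mult gen_ring_one)

lemma gen_ring_scale: "f \<in> gen_ring S a b \<Longrightarrow> (\<lambda>g. \<iota> c * f g) \<in> gen_ring S a b"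
  using gen_ring.mult[OF gen_ring.const[of c S a b], of f] by (simp add: times_fun_def)

lemma gen_ring_uminus: "f \<in> gen_ring S a b \<Longrightarrow> - f \<in> gen_ring S a b"
  using gen_ring_scale[of f S a b "-1"] by (simp add: hom_uminus hom_one fun_Compl_def)

lemma range_fn_der: "f \<in> range fn \<Longrightarrow> (\<lambda>g. (du ^^ q) (f g)) \<in> range fn"
proof (induction q)
  case (Suc q)
  then obtain F where "(\<lambda>g. (du ^^ q) (f g)) = fn F" by blast
  then have "(\<lambda>g. (du ^^ Suc q) (f g)) = fn (dp_der d F)" by (simp add: fn_der fun_eq_iff)
  then show ?case by blast
qed simp

lemma gen_ring_range:
  assumes "\<And>i j. i \<in> S \<Longrightarrow> j \<in> S \<Longrightarrow> a (i, j) \<in> range fn \<and> b (i, j) \<in> range fn"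
  shows "gen_ring S a b \<subseteq> range fn"
proof
  fix f assume "f \<in> gen_ring S a b"
  then show "f \<in> range fn"
  proof induction
    case (const c)
    have "(\<lambda>_. \<iota> c) = fn (dp_const c)" by (simp add: fn_def)
    then show ?case by simp
  next
    case (add f f')
    then obtain F F' where "f = fn F" "f' = fn F'" by blast
    then have "f + f' = fn (F + F')" by (simp only: fn.hom_add)
    then show ?case by blast
  next
    case (mult f f')
    then obtain F F' where "f = fn F" "f' = fn F'" by blast
    then have "f * f' = fn (F * F')" by (simp only: fn.hom_mult)
    then show ?case by blast
  qed (use assms range_fn_der in blast)+
qed

end

locale invertible_mat_fun = diff_group d du \<iota> G
  for d :: "'k::field_char_0 \<Rightarrow> 'k" and du :: "'u::field \<Rightarrow> 'u" and \<iota> and G :: "('u^'n^'n) set" +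
  fixes S :: "'i set" and a b :: "'i \<times> 'i \<Rightarrow> 'u^'n^'n \<Rightarrow> 'u"
  assumes mat_fun: "mat_fun S a"
    and b_range: "i \<in> S \<Longrightarrow> j \<in> S \<Longrightarrow> b (i, j) \<in> range fn"
    and ab: "i \<in> S \<Longrightarrow> j \<in> S \<Longrightarrow> (\<Sum>k\<in>S. a (i, k) g * b (k, j) g) = (if i = j then 1 else 0)"
    and ba: "i \<in> S \<Longrightarrow> j \<in> S \<Longrightarrow> (\<Sum>k\<in>S. b (i, k) g * a (k, j) g) = (if i = j then 1 else 0)"
begin

abbreviation "R \<equiv> gen_ring S a b"

lemma R_range: "R \<subseteq> range fn"
  by (rule gen_ring_range) (simp add: mat_funD[OF mat_fun] b_range)

text \<open>The matrices \<open>a\<close> at \<open>matrix_inv g\<close> and \<open>b\<close> at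
  \<open>g\<close> are both inverse to \<open>a\<close> at \<open>g\<close>.\<close>

lemma b_eq:
  assumes g: "g \<in> G" and ij: "i \<in> S" "j \<in> S"
  shows "b (i, j) g = a (i, j) (matrix_inv g)"
proof -
  note fin = mat_funD(1)[OF mat_fun]
  have "a (i, j) (matrix_inv g) = (\<Sum>l\<in>S. a (i, l) (matrix_inv g) * (if l = j then 1 else 0))"
    using ij fin by (simp add: if_distrib[of "\<lambda>x. _ * x"] cong: if_cong)
  also have "\<dots> = (\<Sum>l\<in>S. a (i, l) (matrix_inv g) * (\<Sum>k\<in>S. a (l, k) g * b (k, j) g))"
    by (rule sum.cong) (simp_all add: ab ij)
  also have "\<dots> = (\<Sum>k\<in>S. (\<Sum>l\<in>S. a (i, l) (matrix_inv g) * a (l, k) g) * b (k, j) g)"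
    by (simp add: sum_distrib_left sum_distrib_right mult.assoc) (rule sum.swap)
  also have "\<dots> = (\<Sum>k\<in>S. (if i = k then 1 else 0) * b (k, j) g)"
    by (rule sum.cong)
      (simp_all add: mat_funD(4)[OF mat_fun, symmetric] mat_funD(3)[OF mat_fun] ij g inv_in_G matrix_inv_G)
  also have "\<dots> = b (i, j) g"
    using ij fin by (simp add: if_distrib[of "\<lambda>x. x * _"] cong: if_cong)
  finally show ?thesis by simp
qed

lemma b_one:
  assumes ij: "i \<in> S" "j \<in> S"
  shows "b (i, j) (mat 1) = (if i = j then 1 else 0)"
proof -
  have "matrix_inv (mat 1 :: 'u^'n^'n) = mat 1"
    using matrix_inv_G(1)[OF one_in_G] by simp
  then show ?thesis using b_eq[OF one_in_G ij] mat_funD(3)[OF mat_fun ij] by simp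
qed

lemma b_mult:
  assumes ij: "i \<in> S" "j \<in> S" and gh: "g \<in> G" "h \<in> G"
  shows "b (i, j) (g ** h) = (\<Sum>k\<in>S. b (k, j) g * b (i, k) h)"
proof -
  have "b (i, j) (g ** h) = (\<Sum>k\<in>S. a (i, k) (matrix_inv h) * a (k, j) (matrix_inv g))"
    using gh by (simp add: b_eq ij mult_in_G matrix_inv_mult mat_funD(4)[OF mat_fun] inv_in_G)
  also have "\<dots> = (\<Sum>k\<in>S. b (k, j) g * b (i, k) h)"
    by (rule sum.cong) (simp_all add: b_eq gh ij)
  finally show ?thesis .
qed

text \<open>The formula for the derivative of an inverse matrix, from differentiating
  \<open>b a = 1\<close> and multiplying by \<open>b\<close> on the right.\<close>

lemma du_b:
  assumes ij: "i \<in> S" "j \<in> S"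
  shows "du (b (i, j) g) = - (\<Sum>l\<in>S. \<Sum>k\<in>S. b (i, k) g * du (a (k, l) g) * b (l, j) g)"
proof -
  note fin = mat_funD(1)[OF mat_fun]
  have D: "(\<Sum>k\<in>S. du (b (i, k) g) * a (k, l) g) = - (\<Sum>k\<in>S. b (i, k) g * du (a (k, l) g))" if "l \<in> S" for l
  proof -
    have "du (\<Sum>k\<in>S. b (i, k) g * a (k, l) g) = 0"
      unfolding ba[OF ij(1) that] by (simp add: du.zero du.one)
    then show ?thesis by (simp add: du.sum du.mult sum.distrib add_eq_0_iff2)
  qed
  have "du (b (i, j) g) = (\<Sum>k\<in>S. du (b (i, k) g) * (if k = j then 1 else 0))"
    using ij fin by (simp add: if_distrib[of "\<lambda>x. _ * x"] cong: if_cong)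
  also have "\<dots> = (\<Sum>k\<in>S. du (b (i, k) g) * (\<Sum>l\<in>S. a (k, l) g * b (l, j) g))"
    by (rule sum.cong) (simp_all add: ab ij)
  also have "\<dots> = (\<Sum>l\<in>S. (\<Sum>k\<in>S. du (b (i, k) g) * a (k, l) g) * b (l, j) g)"
    by (simp add: sum_distrib_left sum_distrib_right mult.assoc) (rule sum.swap)
  also have "\<dots> = (\<Sum>l\<in>S. - (\<Sum>k\<in>S. b (i, k) g * du (a (k, l) g)) * b (l, j) g)"
    by (rule sum.cong) (simp_all add: D)
  finally show ?thesis by (simp add: sum_negf sum_distrib_right)
qed

lemma R_der: "f \<in> R \<Longrightarrow> (\<lambda>g. du (f g)) \<in> R"
proof (induction rule: gen_ring.induct)
  case (const c)
  then show ?case by (simp add: compat gen_ring.const)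
next
  case (der i j q)
  then show ?case using gen_ring.der[of i S j "Suc q" a b] by simp
next
  case (inv i j)
  have "(\<lambda>g. du (b (i, j) g)) =
      - (\<Sum>l\<in>S. \<Sum>k\<in>S. b (i, k) * (\<lambda>g. (du ^^ 1) (a (k, l) g)) * b (l, j))"
    by (simp add: fun_eq_iff du_b inv fun_sum_apply)
  also have "\<dots> \<in> R"
    by (intro gen_ring_uminus gen_ring_sum gen_ring.mult gen_ring.inv gen_ring.der inv)
  finally show ?case .
next
  case (add f f')
  then show ?case using gen_ring.add by (fastforce simp: du.add plus_fun_def)
next
  case (mult f f')
  have "(\<lambda>g. du (f g)) * f' + f * (\<lambda>g. du (f' g)) \<in> R"
    using mult by (intro gen_ring.add gen_ring.mult)
  then show ?case by (simp add: du.mult plus_fun_def times_fun_def)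
qed

lemma R_der_funpow: "f \<in> R \<Longrightarrow> (\<lambda>g. (du ^^ q) (f g)) \<in> R"
  by (induction q) (auto dest: R_der)

text \<open>Stability of \<open>R\<close> under the comultiplication. On derivatives of
  \<open>a\<close> it is the Leibniz rule, and on \<open>b\<close> it is matrix multiplication in
  reversed order.\<close>

lemma R_comult: "f \<in> R \<Longrightarrow> (\<lambda>g h. f (g ** h)) \<in> tens R"
proof (induction rule: gen_ring.induct)
  case (const c)
  from tens.pure[OF gen_ring.const[of c] gen_ring_one] show ?case by simp
next
  case (der i j q)
  have "(\<lambda>g h. \<Sum>k\<in>S. \<Sum>r\<le>q. (\<iota> (of_nat (q choose r)) * (du ^^ r) (a (i, k) g)) * (du ^^ (q - r)) (a (k, j) h)) \<in> tens R"
    by (intro tens_sum tens.pure gen_ring_scale gen_ring.der der)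
  then show ?case
    by (rule tens.agree)
      (simp add: mat_funD(4)[OF mat_fun] der du.funpow_sum du.funpow_mult hom_of_nat mult.assoc)
next
  case (inv i j)
  have "(\<lambda>g h. \<Sum>k\<in>S. b (k, j) g * b (i, k) h) \<in> tens R"
    by (intro tens_sum tens.pure gen_ring.inv inv)
  then show ?case by (rule tens.agree) (rule b_mult[OF inv])
next
  case (add f f')
  from tens.add[OF add.IH] show ?case by simp
next
  case (mult f f')
  have "(\<lambda>g h. f (g ** h) * f' (g ** h)) \<in> tens R"
    by (rule tens_mult[OF _ mult.IH]) (rule gen_ring.mult)
  then show ?case by simp
qed

text \<open>On generators the coinverse exchanges \<open>a\<close> and \<open>b\<close>; the
  derivatives of \<open>b\<close> that arise lie in \<open>R\<close> by
  \<open>R_der_funpow\<close>.\<close>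

lemma R_antipode: "f \<in> R \<Longrightarrow> \<exists>f'\<in>R. \<forall>g\<in>G. f (matrix_inv g) = f' g"
proof (induction rule: gen_ring.induct)
  case (const c)
  show ?case by (rule bexI[OF _ gen_ring.const[of c]]) simp
next
  case (der i j q)
  have "(\<lambda>g. (du ^^ q) (b (i, j) g)) \<in> R" by (intro R_der_funpow gen_ring.inv der)
  then show ?case by (rule bexI[rotated]) (simp add: b_eq der)
next
  case (inv i j)
  have "a (i, j) \<in> R" by (intro gen_ring_coef inv)
  then show ?case by (rule bexI[rotated]) (simp add: b_eq inv inv_in_G matrix_inv_inv)
next
  case (add f f')
  then obtain k k' where "k \<in> R" "k' \<in> R" "\<forall>g\<in>G. f (matrix_inv g) = k g" "\<forall>g\<in>G. f' (matrix_inv g) = k' g" by blast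
  then show ?case by (intro bexI[of _ "k + k'"] gen_ring.add) simp_all
next
  case (mult f f')
  then obtain k k' where "k \<in> R" "k' \<in> R" "\<forall>g\<in>G. f (matrix_inv g) = k g" "\<forall>g\<in>G. f' (matrix_inv g) = k' g" by blast
  then show ?case by (intro bexI[of _ "k * k'"] gen_ring.mult) simp_all
qed

lemma R_uspan_descent: "f \<in> uspan R \<Longrightarrow> f \<in> range fn \<Longrightarrow> f \<in> R"
  by (rule uspan_descent[OF R_range])
    (use gen_ring_zero[of S a b] in \<open>auto simp: zero_fun_def intro: gen_ring.add gen_ring_scale\<close>)

text \<open>
  The ideal of all \<open>c \<in> R\<close> with \<open>c u\<^sub>i\<^sub>j \<in> R\<close> is stable under translations. By the comultiplication
  formula the constant \<open>c(g0) = c(g \<cdot> g\<inverse> g0)\<close> is a combination of translates of \<open>c\<close>, with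
  coefficients in \<open>R\<close>.
\<close>

lemma translation_descent:
  assumes u: "mat_fun J u" and c: "c \<in> R" "g0 \<in> G" "c g0 \<noteq> 0"
    and cu: "\<And>i j. i \<in> J \<Longrightarrow> j \<in> J \<Longrightarrow> c * u (i, j) \<in> R" and il: "i \<in> J" "l \<in> J"
  shows "u (i, l) \<in> R"
proof (rule R_uspan_descent)
  note R_mult = gen_ring.mult[of _ S a b]
  \<comment> \<open>Writing \<open>g\<close> as \<open>(g ** h) ** matrix_inv h\<close> expands
    \<open>u (i, l) g\<close> by row \<open>i\<close> of \<open>u\<close> at \<open>g ** h\<close>,
    with scalar coefficients depending on \<open>h\<close>. So a translate of \<open>c\<close>
    clears the denominators as well as \<open>c\<close> does; here all entries of the row are
    used.\<close>
  have translate: "(\<lambda>g. c (g ** h) * u (i, l) g) \<in> uspan R" if h: "h \<in> G" for h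
  proof -
    have "(\<lambda>g. \<Sum>j\<in>J. u (j, l) (matrix_inv h) * (c * u (i, j)) (g ** h)) \<in> uspan R"
      by (intro uspan_sum uspan.scale tens_right[OF R_comult h] cu il)
    then show ?thesis
    proof (rule uspan.agree)
      fix g assume g: "g \<in> G"
      have "u (i, l) g = u (i, l) ((g ** h) ** matrix_inv h)"
        using h by (simp add: matrix_inv_G flip: matrix_mul_assoc)
      also have "\<dots> = (\<Sum>j\<in>J. u (i, j) (g ** h) * u (j, l) (matrix_inv h))"
        by (rule mat_funD(4)[OF u il mult_in_G[OF g h] inv_in_G[OF h]])
      finally show "c (g ** h) * u (i, l) g =
          (\<Sum>j\<in>J. u (j, l) (matrix_inv h) * (c * u (i, j)) (g ** h))"
        by (simp add: sum_distrib_left mult_ac)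
    qed
  qed
  obtain ps where ps: "set ps \<subseteq> R \<times> R"
      "\<And>g h. g \<in> G \<Longrightarrow> h \<in> G \<Longrightarrow> c (g ** h) = (\<Sum>(p, q)\<leftarrow>ps. p g * q h)"
    using tens_list[OF R_comult[OF c(1)]] by blast
  define p q where "p e = fst (ps ! e)" and "q e = snd (ps ! e)" for e
  let ?E = "{..<length ps}"
  have pq: "p e \<in> R" "q e \<in> R" if "e \<in> ?E" for e
    using ps(1) that by (auto simp: p_def q_def dest!: nth_mem)
  have c_pq: "c (g ** h) = (\<Sum>e\<in>?E. p e g * q e h)" if "g \<in> G" "h \<in> G" for g h
    using ps(2)[OF that] by (simp add: sum_list_sum_nth atLeast0LessThan case_prod_beta p_def q_def)
  \<comment> \<open>Independent right factors make the left factors \<open>p'\<close> recoverable: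
    each is a combination of translates of \<open>c\<close>, by dual functionals in the second
    variable.\<close>
  obtain E0 \<tau> where E0: "E0 \<subseteq> ?E" "\<And>e h. e \<in> ?E \<Longrightarrow> q e h = (\<Sum>a\<in>E0. \<tau> e a * q a h)"
      "\<And>c a. (\<And>h. (\<Sum>a\<in>E0. c a * q a h) = 0) \<Longrightarrow> a \<in> E0 \<Longrightarrow> c a = 0"
  proof -
    interpret idm: ring_embedding "\<lambda>c :: 'u. c" by unfold_locales simp_all
    have "\<forall>c :: 'u. c \<noteq> 0 \<longrightarrow> (\<exists>c'. c * c' = 1)" using right_inverse by blast
    from idm.independent_subfamily[OF this, of ?E q] show thesis using that by blast
  qed
  have finE0: "finite E0" using E0(1) finite_subset by blast
  define p' where "p' a g = (\<Sum>e\<in>?E. \<tau> e a * p e g)" for a g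
  have c_p'q: "c (g ** h) = (\<Sum>a\<in>E0. p' a g * q a h)" if "g \<in> G" "h \<in> G" for g h
  proof -
    have "c (g ** h) = (\<Sum>e\<in>?E. \<Sum>a\<in>E0. \<tau> e a * p e g * q a h)"
      unfolding c_pq[OF that]
      by (rule sum.cong) (simp_all add: E0(2) sum_distrib_left mult_ac)
    also have "\<dots> = (\<Sum>a\<in>E0. p' a g * q a h)"
      by (subst sum.swap) (simp add: p'_def sum_distrib_right)
    finally show ?thesis .
  qed
  have "\<exists>L. \<forall>e\<in>E0. eval_comb (L e) \<and> (\<forall>e'\<in>E0. L e (q e') = (if e = e' then 1 else 0))"
    by (rule dual_eval_combs[OF finE0]) (rule E0(3))
  then obtain L where L: "\<And>e. e \<in> E0 \<Longrightarrow> eval_comb (L e)"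
      "\<And>e e'. e \<in> E0 \<Longrightarrow> e' \<in> E0 \<Longrightarrow> L e (q e') = (if e = e' then 1 else 0)" by blast
  \<comment> \<open>Since \<open>p' e\<close> combines translates of \<open>c\<close>, its product
    with \<open>u (i, l)\<close> is in the span by \<open>translate\<close>.\<close>
  have p'u: "(\<lambda>g. p' e g * u (i, l) g) \<in> uspan R" if e: "e \<in> E0" for e
  proof -
    obtain H w where Hw: "\<And>f. L e f = (\<Sum>h\<in>H. w h * f h)"
      using L(1)[OF e] by (auto simp: eval_comb_def)
    have "(\<lambda>g. \<Sum>h\<in>H. w h * (c (g ** retract h) * u (i, l) g)) \<in> uspan R"
      by (intro uspan_sum uspan.scale translate retract_in_G)
    then show ?thesis
    proof (rule uspan.agree)
      fix g assume g: "g \<in> G"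
      have q_retract: "q a (retract h) = q a h" if "a \<in> E0" for a h
      proof -
        have "q a \<in> range fn" using pq(2)[of a] E0(1) R_range that by blast
        then obtain F where "q a = fn F" by blast
        then show ?thesis by (simp add: fn_retract)
      qed
      have "p' e g = (\<Sum>a\<in>E0. p' a g * L e (q a))"
        using finE0 e by (simp add: L(2) if_distrib[of "\<lambda>x. _ * x"] cong: if_cong)
      also have "\<dots> = L e (\<lambda>h. \<Sum>a\<in>E0. p' a g * q a h)"
        by (rule eval_comb_linear[OF L(1)[OF e], symmetric])
      also have "\<dots> = (\<Sum>h\<in>H. w h * c (g ** retract h))"
        unfolding Hw by (simp add: c_p'q[OF g retract_in_G] q_retract)
      finally show "p' e g * u (i, l) g = (\<Sum>h\<in>H. w h * (c (g ** retract h) * u (i, l) g))"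
        by (simp add: sum_distrib_right mult.assoc)
    qed
  qed
  \<comment> \<open>The comultiplication separates \<open>matrix_inv g\<close> from the fixed
    \<open>g0\<close>, and \<open>R_antipode\<close> removes the inverse.\<close>
  have q_inv: "(\<lambda>g. q e (matrix_inv g ** g0)) \<in> uspan R" if "e \<in> E0" for e
  proof -
    obtain qs where qs: "set qs \<subseteq> R \<times> R"
      "\<And>g h. g \<in> G \<Longrightarrow> h \<in> G \<Longrightarrow> q e (g ** h) = (\<Sum>(p, q)\<leftarrow>qs. p g * q h)"
      using tens_list[OF R_comult[OF pq(2)[of e]]] E0(1) \<open>e \<in> E0\<close> by blast
    have "(\<lambda>g. \<Sum>(p, q)\<leftarrow>qs. p (matrix_inv g) * q g0) \<in> uspan R"
      using qs(1)
    proof (induction qs)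
      case (Cons pq qs)
      obtain p' q' where pq': "pq = (p', q')" by (cases pq)
      then obtain k where k: "k \<in> R" "\<And>g. g \<in> G \<Longrightarrow> p' (matrix_inv g) = k g"
        using R_antipode[of p'] Cons.prems by auto
      have "(\<lambda>g. q' g0 * k g) \<in> uspan R" using k(1) by (intro uspan.scale uspan.incl)
      then have "(\<lambda>g. p' (matrix_inv g) * q' g0) \<in> uspan R"
        by (rule uspan.agree) (simp add: k(2))
      from uspan.add[OF this Cons.IH] Cons.prems show ?case by (simp add: pq')
    qed (simp add: uspan.zero)
    then show ?thesis by (rule uspan.agree) (simp add: qs(2) inv_in_G c(2))
  qed
  have "(\<lambda>g. inverse (c g0) * (\<Sum>e\<in>E0. q e (matrix_inv g ** g0) * (p' e g * u (i, l) g))) \<in> uspan R"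
    by (intro uspan.scale uspan_sum uspan_mult[OF R_mult] q_inv p'u)
  then show "u (i, l) \<in> uspan R"
  proof (rule uspan.agree)
    fix g assume g: "g \<in> G"
    have "c g0 = c (g ** (matrix_inv g ** g0))"
      using g by (simp add: matrix_mul_assoc matrix_inv_G)
    also have "\<dots> = (\<Sum>e\<in>E0. p' e g * q e (matrix_inv g ** g0))"
      using g c(2) by (intro c_p'q mult_in_G inv_in_G)
    finally have "(\<Sum>e\<in>E0. q e (matrix_inv g ** g0) * (p' e g * u (i, l) g)) = c g0 * u (i, l) g"
      by (simp add: sum_distrib_left sum_distrib_right mult_ac)
    then show "u (i, l) g = inverse (c g0) * (\<Sum>e\<in>E0. q e (matrix_inv g ** g0) * (p' e g * u (i, l) g))"
      using c(3) by simp
  qed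
  show "u (i, l) \<in> range fn" by (rule mat_funD(2)[OF u il])
qed

end

text \<open>\<open>translation_descent\<close> needs one denominator for the whole matrix of
  \<open>U\<close>. The product of the denominators of the single entries serves, being nonzero at
  \<open>g0\<close> because all of them are nonzero at this same point.\<close>

lemma (in diff_group) coef_in_gen_ring:
  assumes V: "diff_rep d A X V" "faithful_rep d A X V" and U: "diff_rep d A X U"
    and "invertible_mat_fun d du \<iota> G (basis V) (\<lambda>p. fun_of (coef V p)) b"
    and ij: "i \<in> basis U" "j \<in> basis U"
  shows "fun_of (coef U (i, j)) \<in> gen_ring (basis V) (\<lambda>p. fun_of (coef V p)) b"
proof -
  interpret invertible_mat_fun d du \<iota> G "basis V" "\<lambda>p. fun_of (coef V p)" b by fact
  note finU = rep_finite[OF U]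
  obtain g0 where g0: "g0 \<in> G" "\<And>f. f \<in> R \<Longrightarrow> f g0 = 0 \<Longrightarrow> \<exists>s\<in>R. s g0 \<noteq> 0 \<and> s * f = 0"
    using ex_generic_point_of_subring[OF R_range gen_ring_one gen_ring.mult] by blast
  let ?u = "\<lambda>p. fun_of (coef U p)" and ?J = "basis U \<times> basis U"
  have "\<exists>s\<in>R. s g0 \<noteq> 0 \<and> s * ?u p \<in> R" if "p \<in> ?J" for p
  proof (rule faithful_imp_fraction[OF R_range gen_ring.mult gen_ring.add gen_ring.const R_der V _ g0])
    show "?u p \<in> range fn" using that rep_carrier[OF U] by (auto intro: fun_of_range)
    show "fun_of (coef V (i, j)) \<in> R" if "i \<in> basis V" "j \<in> basis V" for i j
      using gen_ring_coef[OF that, of "\<lambda>p. fun_of (coef V p)"] .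
  qed
  then have "\<forall>p\<in>?J. \<exists>s. s \<in> R \<and> s g0 \<noteq> 0 \<and> s * ?u p \<in> R" by blast
  then obtain s where "\<forall>p\<in>?J. s p \<in> R \<and> s p g0 \<noteq> 0 \<and> s p * ?u p \<in> R"
    by (rule bchoice[THEN exE])
  then have s: "\<And>p. p \<in> ?J \<Longrightarrow> s p \<in> R" "\<And>p. p \<in> ?J \<Longrightarrow> s p g0 \<noteq> 0"
      "\<And>p. p \<in> ?J \<Longrightarrow> s p * ?u p \<in> R"
    by blast+
  define c where "c = (\<Prod>p\<in>?J. s p)"
  have prod_apply: "(\<Prod>p\<in>T. s p) g = (\<Prod>p\<in>T. s p g)" for T g
    by (induction T rule: infinite_finite_induct) simp_all
  have "c * ?u p \<in> R" if p: "p \<in> ?J" for p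
  proof -
    have "c = s p * (\<Prod>p\<in>?J - {p}. s p)"
      unfolding c_def using finU p by (intro prod.remove) auto
    then have "c * ?u p = (\<Prod>p\<in>?J - {p}. s p) * (s p * ?u p)" by (simp only: mult_ac)
    also have "\<dots> \<in> R" by (intro gen_ring.mult gen_ring_prod s p) auto
    finally show ?thesis .
  qed
  moreover have "c \<in> R" unfolding c_def by (intro gen_ring_prod s)
  moreover have "c g0 \<noteq> 0" using finU s(2) by (simp add: c_def prod_apply)
  ultimately show ?thesis
    using translation_descent[OF mat_fun_rep[OF U] _ g0(1) _ _ ij, of c] by blast
qed

section \<open>Mixed tensor representations\<close>

lemma finite_listset: "(\<And>A. A \<in> set As \<Longrightarrow> finite A) \<Longrightarrow> finite (listset As)"
proof (induction As)
  case (Cons A As)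
  have "set_Cons A (listset As) = (\<lambda>(x, xs). x # xs) ` (A \<times> listset As)"
    by (auto simp: set_Cons_def)
  then show ?case using Cons by simp
qed simp

lemma sum_set_Cons:
  "(\<Sum>zs\<in>set_Cons A B. f zs) = (\<Sum>x\<in>A. \<Sum>xs\<in>B. f (x # xs))"
proof -
  have "set_Cons A B = (\<lambda>(x, xs). x # xs) ` (A \<times> B)"
    by (auto simp: set_Cons_def)
  moreover have "inj_on (\<lambda>(x, xs). x # xs) (A \<times> B)" by (auto simp: inj_on_def)
  ultimately have "(\<Sum>zs\<in>set_Cons A B. f zs) = (\<Sum>(x, xs)\<in>A \<times> B. f (x # xs))"
    by (simp only: sum.reindex) (simp add: case_prod_beta comp_def)
  then show ?thesis by (simp add: sum.cartesian_product)
qed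

lemma listset_append: "xs \<in> listset As \<Longrightarrow> ys \<in> listset Bs \<Longrightarrow> xs @ ys \<in> listset (As @ Bs)"
  by (induction As arbitrary: xs) (auto simp: set_Cons_def)

context diff_group
begin

text \<open>A pointwise substitute for \<open>diff_rep\<close>, which can be checked for
  prolongations, tensor products, duals and direct sums by computing with values on \<open>G\<close>
  instead of test algebras.\<close>

definition fun_rep :: "('i, ('n, 'k) gl_dpoly set) rep \<Rightarrow> bool" where
  "fun_rep W \<longleftrightarrow> (\<forall>i\<in>basis W. \<forall>j\<in>basis W. coef W (i, j) \<in> carrier A) \<and>
     mat_fun (basis W) (\<lambda>p. fun_of (coef W p))"

lemma fun_rep_carrier: "fun_rep W \<Longrightarrow> i \<in> basis W \<Longrightarrow> j \<in> basis W \<Longrightarrow> coef W (i, j) \<in> carrier A"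
  and fun_rep_mat_fun: "fun_rep W \<Longrightarrow> mat_fun (basis W) (\<lambda>p. fun_of (coef W p))"
  by (auto simp: fun_rep_def)

lemma fun_rep_finite: "fun_rep W \<Longrightarrow> finite (basis W)"
  using mat_funD(1)[OF fun_rep_mat_fun] .

lemma fun_rep_one: "fun_rep W \<Longrightarrow> i \<in> basis W \<Longrightarrow> j \<in> basis W \<Longrightarrow>
    fun_of (coef W (i, j)) (mat 1) = (if i = j then 1 else 0)"
  using mat_funD(3)[OF fun_rep_mat_fun, of W i j] by simp

lemma fun_rep_mult: "fun_rep W \<Longrightarrow> i \<in> basis W \<Longrightarrow> j \<in> basis W \<Longrightarrow> g \<in> G \<Longrightarrow> h \<in> G \<Longrightarrow>
    fun_of (coef W (i, j)) (g ** h) = (\<Sum>k\<in>basis W. fun_of (coef W (i, k)) g * fun_of (coef W (k, j)) h)"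
  using mat_funD(4)[OF fun_rep_mat_fun, of W i j g h] by simp

lemma fun_repI:
  assumes "finite (basis W)" "\<And>i j. i \<in> basis W \<Longrightarrow> j \<in> basis W \<Longrightarrow> coef W (i, j) \<in> carrier A"
    "\<And>i j. i \<in> basis W \<Longrightarrow> j \<in> basis W \<Longrightarrow> fun_of (coef W (i, j)) (mat 1) = (if i = j then 1 else 0)"
    "\<And>i j g h. i \<in> basis W \<Longrightarrow> j \<in> basis W \<Longrightarrow> g \<in> G \<Longrightarrow> h \<in> G \<Longrightarrow>
      fun_of (coef W (i, j)) (g ** h) = (\<Sum>k\<in>basis W. fun_of (coef W (i, k)) g * fun_of (coef W (k, j)) h)"
  shows "fun_rep W"
  unfolding fun_rep_def mat_fun_def by (intro conjI ballI) (simp_all add: assms fun_of_range)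

lemma diff_rep_fun_rep: "diff_rep d A X V \<Longrightarrow> fun_rep V"
  by (simp add: fun_rep_def mat_fun_rep rep_carrier)

lemma A_cring: "cring A"
  unfolding A_eq by (rule A.cring_dquot)

lemma A_closed [simp]:
  "C \<in> carrier A \<Longrightarrow> D \<in> carrier A \<Longrightarrow> C \<otimes>\<^bsub>A\<^esub> D \<in> carrier A"
  "\<one>\<^bsub>A\<^esub> \<in> carrier A" "\<zero>\<^bsub>A\<^esub> \<in> carrier A" "C \<in> carrier A \<Longrightarrow> add_pow A (m::nat) C \<in> carrier A"
  "emb A c \<in> carrier A"
proof -
  interpret cring A by (rule A_cring)
  show "C \<in> carrier A \<Longrightarrow> D \<in> carrier A \<Longrightarrow> C \<otimes>\<^bsub>A\<^esub> D \<in> carrier A"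
    "\<one>\<^bsub>A\<^esub> \<in> carrier A" "\<zero>\<^bsub>A\<^esub> \<in> carrier A" "C \<in> carrier A \<Longrightarrow> add_pow A (m::nat) C \<in> carrier A"
    by simp_all
  show "emb A c \<in> carrier A" unfolding A_eq by (simp add: A.dquot_simps)
qed

lemma A_der_closed: "C \<in> carrier A \<Longrightarrow> (der A ^^ q) C \<in> carrier A"
proof (induction q)
  case (Suc q)
  then show ?case unfolding A_eq by (auto elim!: A.dquot_carrierE simp: A.dquot_simps)
qed simp

lemma fun_of_simps [simp]:
  "C \<in> carrier A \<Longrightarrow> D \<in> carrier A \<Longrightarrow> fun_of (C \<otimes>\<^bsub>A\<^esub> D) = fun_of C * fun_of D"
  "fun_of \<one>\<^bsub>A\<^esub> = 1" "fun_of \<zero>\<^bsub>A\<^esub> = 0"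
  "C \<in> carrier A \<Longrightarrow> fun_of (add_pow A (m::nat) C) = of_nat m * fun_of C"
  unfolding A_eq by (simp_all add: A.test_mult A.test_one A.test_zero A.test_add_pow)

lemma fun_of_finsum: "f \<in> S \<rightarrow> carrier A \<Longrightarrow> fun_of (finsum A f S) = (\<Sum>s\<in>S. fun_of (f s))"
  unfolding A_eq by (rule A.test_finsum)

lemma fun_of_inject: "C \<in> carrier A \<Longrightarrow> D \<in> carrier A \<Longrightarrow> fun_of C = fun_of D \<longleftrightarrow> C = D"
  unfolding A_eq by (rule A.test_inject)

lemma fun_of_der_funpow:
  assumes "C \<in> carrier A"
  shows "fun_of ((der A ^^ q) C) = (\<lambda>g. (du ^^ q) (fun_of C g))"
proof (induction q)
  case (Suc q)
  then show ?case using fun_of_der[OF A_der_closed[OF assms, of q]] by simp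
qed simp

lemma of_nat_fun_apply: "(of_nat m :: 'x \<Rightarrow> 'u) g = of_nat m"
  by (induction m) simp_all

lemma prolong_coef:
  assumes "fun_rep V" "i \<in> basis V" "j \<in> basis V"
  shows "coef (prolong A p V) ((q, i), (m, j)) \<in> carrier A"
    "fun_of (coef (prolong A p V) ((q, i), (m, j))) g =
      (if q \<le> m then of_nat (m choose q) * (du ^^ (m - q)) (fun_of (coef V (i, j)) g) else 0)"
  using fun_rep_carrier[OF assms]
  by (simp_all add: prolong_def A_der_closed fun_of_der_funpow of_nat_fun_apply)

lemma du_funpow_const: "(du ^^ q) (if P then 1 else 0) = (if q = 0 \<and> P then 1 else 0)"
proof -
  have "(du ^^ q) 1 = (if q = 0 then 1 else 0)"
  proof (cases q)
    case (Suc q')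
    then show ?thesis by (simp only: funpow_Suc_right o_apply du.one du.funpow_zero) simp
  qed simp
  then show ?thesis by (simp add: du.funpow_zero)
qed

text \<open>The matrix is block triangular, so only middle indices \<open>r = q + s\<close> between
  \<open>q\<close> and \<open>m\<close> contribute. The Leibniz rule for the derivative of order
  \<open>m - q\<close> of a matrix product matches the sum over \<open>s\<close>, since \<open>(m
  choose (q + s)) * (q + s choose q) = (m choose q) * (m - q choose s)\<close>.\<close>

lemma fun_rep_prolong:
  assumes V: "fun_rep V"
  shows "fun_rep (prolong A p V)"
proof (rule fun_repI)
  have B: "basis (prolong A p V) = {..p} \<times> basis V" by (simp add: prolong_def)
  then show "finite (basis (prolong A p V))" using fun_rep_finite[OF V] by simp
  fix x y assume "x \<in> basis (prolong A p V)" "y \<in> basis (prolong A p V)"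
  then obtain q i m j where x: "x = (q, i)" "q \<le> p" "i \<in> basis V" and y: "y = (m, j)" "m \<le> p" "j \<in> basis V"
    unfolding B by auto
  let ?a = "\<lambda>i j. fun_of (coef V (i, j))"
  show "coef (prolong A p V) (x, y) \<in> carrier A"
    using prolong_coef(1)[OF V] x y by simp
  show "fun_of (coef (prolong A p V) (x, y)) (mat 1) = (if x = y then 1 else 0)"
    using x y by (auto simp: prolong_coef(2)[OF V] fun_rep_one[OF V] du_funpow_const)
  fix g h assume gh: "g \<in> G" "h \<in> G"
  let ?t = "\<lambda>k s. of_nat (m choose q) * of_nat (m - q choose s) * ((du ^^ s) (?a i k g) * (du ^^ (m - q - s)) (?a k j h))"
  let ?c = "\<lambda>x y g. fun_of (coef (prolong A p V) (x, y)) g"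
  have zero: "?c (q, i) (r, k) g * ?c (r, k) (m, j) h = 0" if "k \<in> basis V" "\<not> (q \<le> r \<and> r \<le> m)" for r k
    using that x y by (auto simp: prolong_coef(2)[OF V])
  have summand: "?c (q, i) (q + s, k) g * ?c (q + s, k) (m, j) h = ?t k s"
    if "k \<in> basis V" "s \<le> m - q" "q \<le> m" for s k
  proof -
    have "(m choose (q + s)) * (q + s choose q) = (m choose q) * (m - q choose s)"
      using choose_mult[of q "q + s" m] that by simp
    then have bin: "of_nat (q + s choose q) * of_nat (m choose (q + s)) = (of_nat (m choose q) * of_nat (m - q choose s) :: 'u)"
      by (metis mult.commute of_nat_mult)
    have left: "?c (q, i) (q + s, k) g = of_nat (q + s choose q) * (du ^^ s) (?a i k g)"
      using that x y by (simp add: prolong_coef(2)[OF V])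
    have "q + s \<le> m" using that by simp
    then have right: "?c (q + s, k) (m, j) h = of_nat (m choose (q + s)) * (du ^^ (m - q - s)) (?a k j h)"
      using that x y by (simp add: prolong_coef(2)[OF V])
    have "?c (q, i) (q + s, k) g * ?c (q + s, k) (m, j) h =
        (of_nat (q + s choose q) * of_nat (m choose (q + s))) * ((du ^^ s) (?a i k g) * (du ^^ (m - q - s)) (?a k j h))"
      unfolding left right by (simp only: mult_ac)
    then show ?thesis unfolding bin .
  qed
  have "(\<Sum>z\<in>basis (prolong A p V). ?c x z g * ?c z y h) =
      (\<Sum>k\<in>basis V. \<Sum>r\<le>p. ?c (q, i) (r, k) g * ?c (r, k) (m, j) h)"
    unfolding B x(1) y(1) by (subst sum.swap) (simp add: sum.cartesian_product case_prod_beta)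
  also have "\<dots> = (\<Sum>k\<in>basis V. if q \<le> m then \<Sum>s\<le>m - q. ?t k s else 0)"
  proof (rule sum.cong)
    fix k assume k: "k \<in> basis V"
    show "(\<Sum>r\<le>p. ?c (q, i) (r, k) g * ?c (r, k) (m, j) h) = (if q \<le> m then \<Sum>s\<le>m - q. ?t k s else 0)"
    proof (cases "q \<le> m")
      case True
      have "(\<Sum>r\<le>p. ?c (q, i) (r, k) g * ?c (r, k) (m, j) h) =
          (\<Sum>r\<in>(\<lambda>s. q + s) ` {..m - q}. ?c (q, i) (r, k) g * ?c (r, k) (m, j) h)"
      proof (rule sum.mono_neutral_right)
        show "(\<lambda>s. q + s) ` {..m - q} \<subseteq> {..p}" using y(2) True by auto
        show "\<forall>r\<in>{..p} - (\<lambda>s. q + s) ` {..m - q}. ?c (q, i) (r, k) g * ?c (r, k) (m, j) h = 0"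
        proof
          fix r assume "r \<in> {..p} - (\<lambda>s. q + s) ` {..m - q}"
          then have "r \<noteq> q + s" if "s \<le> m - q" for s using that by auto
          have "\<not> (q \<le> r \<and> r \<le> m)"
          proof
            assume "q \<le> r \<and> r \<le> m"
            then have "r - q \<le> m - q" "r = q + (r - q)" by (auto intro: diff_le_mono)
            then show False using \<open>\<And>s. s \<le> m - q \<Longrightarrow> r \<noteq> q + s\<close> by blast
          qed
          then show "?c (q, i) (r, k) g * ?c (r, k) (m, j) h = 0" by (rule zero[OF k])
        qed
      qed simp
      also have "\<dots> = (\<Sum>s\<le>m - q. ?c (q, i) (q + s, k) g * ?c (q + s, k) (m, j) h)"
        by (simp add: sum.reindex)
      also have "\<dots> = (\<Sum>s\<le>m - q. ?t k s)"
        by (rule sum.cong) (simp_all add: summand k True)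
      finally show ?thesis using True by simp
    next
      case False
      then show ?thesis using zero[OF k] by (auto intro!: sum.neutral)
    qed
  qed simp
  also have "\<dots> = fun_of (coef (prolong A p V) (x, y)) (g ** h)"
    using x y
    by (simp add: prolong_coef(2)[OF V] fun_rep_mult[OF V _ _ gh] du.funpow_sum du.funpow_mult sum_distrib_left mult.assoc)
  finally show "fun_of (coef (prolong A p V) (x, y)) (g ** h) = (\<Sum>z\<in>basis (prolong A p V). ?c x z g * ?c z y h)" ..
qed

lemma fun_rep_tensor:
  assumes V: "fun_rep V" and W: "fun_rep W"
  shows "fun_rep (tensor A V W)"
proof (rule fun_repI)
  have B: "basis (tensor A V W) = basis V \<times> basis W" by (simp add: tensor_def)
  then show "finite (basis (tensor A V W))" using fun_rep_finite[OF V] fun_rep_finite[OF W] by simp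
  fix x y assume "x \<in> basis (tensor A V W)" "y \<in> basis (tensor A V W)"
  then obtain i i' j j' where x: "x = (i, i')" "i \<in> basis V" "i' \<in> basis W"
      and y: "y = (j, j')" "j \<in> basis V" "j' \<in> basis W" unfolding B by auto
  have coef: "coef (tensor A V W) ((i, i'), (j, j')) = coef V (i, j) \<otimes>\<^bsub>A\<^esub> coef W (i', j')" for i i' j j'
    by (simp add: tensor_def)
  note carr = fun_rep_carrier[OF V] fun_rep_carrier[OF W]
  show "coef (tensor A V W) (x, y) \<in> carrier A" using x y by (simp add: coef carr)
  show "fun_of (coef (tensor A V W) (x, y)) (mat 1) = (if x = y then 1 else 0)"
    using x y by (simp add: coef carr fun_rep_one V W)
  fix g h assume gh: "g \<in> G" "h \<in> G"
  show "fun_of (coef (tensor A V W) (x, y)) (g ** h) =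
      (\<Sum>z\<in>basis (tensor A V W). fun_of (coef (tensor A V W) (x, z)) g * fun_of (coef (tensor A V W) (z, y)) h)"
    unfolding B using x y
    by (simp add: coef carr fun_rep_mult[OF V _ _ gh] fun_rep_mult[OF W _ _ gh] sum_product
        sum.cartesian_product case_prod_beta)
      (rule sum.cong, auto simp: coef carr mult_ac)
qed

lemma fun_rep_tensor_list:
  assumes "\<And>V. V \<in> set Vs \<Longrightarrow> fun_rep V"
  shows "fun_rep (tensor_list A Vs)"
  using assms
proof (induction Vs)
  case Nil
  show ?case by (rule fun_repI; simp add: tensor_list_def)
next
  case (Cons V Vs)
  let ?W = "tensor_list A Vs" and ?T = "tensor_list A (V # Vs)"
  have V: "fun_rep V" using Cons.prems by simp
  have W: "fun_rep ?W" by (rule Cons.IH) (simp add: Cons.prems)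
  note carr = fun_rep_carrier[OF V] fun_rep_carrier[OF W]
  have B: "basis ?T = set_Cons (basis V) (basis ?W)" by (simp add: tensor_list_def)
  have coef: "coef ?T (i # is, j # js) = coef V (i, j) \<otimes>\<^bsub>A\<^esub> coef ?W (is, js)" for i "is" j js
    by (simp add: tensor_list_def)
  show ?case
  proof (rule fun_repI)
    show "finite (basis ?T)"
      using fun_rep_finite[OF Cons.prems]
      by (auto simp: tensor_list_def simp del: listset.simps list.map intro!: finite_listset)
    fix x y assume "x \<in> basis ?T" "y \<in> basis ?T"
    then obtain i i' j j' where x: "x = i # i'" "i \<in> basis V" "i' \<in> basis ?W"
      and y: "y = j # j'" "j \<in> basis V" "j' \<in> basis ?W" unfolding B set_Cons_def by auto
    show "coef ?T (x, y) \<in> carrier A" using x y by (simp add: coef carr)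
    show "fun_of (coef ?T (x, y)) (mat 1) = (if x = y then 1 else 0)"
      using x y by (simp add: coef carr fun_rep_one V W)
    fix g h assume gh: "g \<in> G" "h \<in> G"
    show "fun_of (coef ?T (x, y)) (g ** h) =
        (\<Sum>z\<in>basis ?T. fun_of (coef ?T (x, z)) g * fun_of (coef ?T (z, y)) h)"
      unfolding B sum_set_Cons using x y
      by (simp add: coef carr fun_rep_mult[OF V _ _ gh] fun_rep_mult[OF W _ _ gh] sum_product)
        (intro sum.cong refl, simp add: coef carr mult_ac)
  qed
qed

lemma fun_rep_direct_sum:
  assumes "\<And>V. V \<in> set Vs \<Longrightarrow> fun_rep V"
  shows "fun_rep (direct_sum A Vs)"
proof (rule fun_repI)
  let ?D = "direct_sum A Vs"
  have V: "fun_rep (Vs ! s)" if "s < length Vs" for s using assms that by simp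
  have B: "basis ?D = (SIGMA s:{..<length Vs}. basis (Vs ! s))" by (simp add: direct_sum_def)
  show "finite (basis ?D)" unfolding B by (intro finite_SigmaI) (auto intro: fun_rep_finite V)
  fix x y assume "x \<in> basis ?D" "y \<in> basis ?D"
  then obtain s i t j where x: "x = (s, i)" "s < length Vs" "i \<in> basis (Vs ! s)"
      and y: "y = (t, j)" "t < length Vs" "j \<in> basis (Vs ! t)" unfolding B by auto
  have coef: "coef ?D ((s, i), (t, j)) = (if s = t then coef (Vs ! s) (i, j) else \<zero>\<^bsub>A\<^esub>)" for s i t j
    by (simp add: direct_sum_def)
  show "coef ?D (x, y) \<in> carrier A" using x y fun_rep_carrier[OF V] by (auto simp: coef)
  show "fun_of (coef ?D (x, y)) (mat 1) = (if x = y then 1 else 0)"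
    using x y fun_rep_one[OF V] by (auto simp: coef)
  fix g h assume gh: "g \<in> G" "h \<in> G"
  have "(\<Sum>z\<in>basis ?D. fun_of (coef ?D (x, z)) g * fun_of (coef ?D (z, y)) h) =
      (\<Sum>r<length Vs. \<Sum>k\<in>basis (Vs ! r). fun_of (coef ?D (x, (r, k))) g * fun_of (coef ?D ((r, k), y)) h)"
    unfolding B using fun_rep_finite[OF V] by (subst sum.Sigma) (auto simp: case_prod_beta)
  also have "\<dots> = (\<Sum>r<length Vs. if r = s then
      (if s = t then \<Sum>k\<in>basis (Vs ! s). fun_of (coef (Vs ! s) (i, k)) g * fun_of (coef (Vs ! s) (k, j)) h else 0) else 0)"
    unfolding x(1) y(1) by (rule sum.cong) (auto simp: coef)
  also have "\<dots> = fun_of (coef ?D (x, y)) (g ** h)"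
    using x y fun_rep_mult[OF V _ _ gh, of s i j] by (auto simp: coef)
  finally show "fun_of (coef ?D (x, y)) (g ** h) =
      (\<Sum>z\<in>basis ?D. fun_of (coef ?D (x, z)) g * fun_of (coef ?D (z, y)) h)" ..
qed

text \<open>The inverse in \<open>dual_rep\<close> is a definite description in
  \<open>mat_monoid\<close>, so uniqueness of the inverse has to be shown too. It follows from
  associativity, computed on functions.\<close>

lemma dual_coef:
  assumes V: "diff_rep d A X V"
    and b: "\<And>i j. i \<in> basis V \<Longrightarrow> j \<in> basis V \<Longrightarrow> b (i, j) \<in> carrier A"
      "\<And>i j. i \<in> basis V \<Longrightarrow> j \<in> basis V \<Longrightarrow>
        (\<Sum>k\<in>basis V. fun_of (coef V (i, k)) * fun_of (b (k, j))) = (if i = j then 1 else 0)"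
      "\<And>i j. i \<in> basis V \<Longrightarrow> j \<in> basis V \<Longrightarrow>
        (\<Sum>k\<in>basis V. fun_of (b (i, k)) * fun_of (coef V (k, j))) = (if i = j then 1 else 0)"
    and ij: "i \<in> basis V" "j \<in> basis V"
  shows "coef (dual_rep A V) (i, j) = b (j, i)"
proof -
  let ?S = "basis V" and ?M = "mat_monoid (basis V) A"
  let ?a = "restrict (coef V) (?S \<times> ?S)" and ?b = "restrict b (?S \<times> ?S)"
  note fin = rep_finite[OF V]
  note carr = rep_carrier[OF V] b(1)
  have test: "(\<Oplus>\<^bsub>A\<^esub>k\<in>?S. c (i, k) \<otimes>\<^bsub>A\<^esub> e (k, j)) \<in> carrier A \<and>
      fun_of (\<Oplus>\<^bsub>A\<^esub>k\<in>?S. c (i, k) \<otimes>\<^bsub>A\<^esub> e (k, j)) = (\<Sum>k\<in>?S. fun_of (c (i, k)) * fun_of (e (k, j)))"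
    if "\<And>i j. i \<in> ?S \<Longrightarrow> j \<in> ?S \<Longrightarrow> c (i, j) \<in> carrier A" "\<And>i j. i \<in> ?S \<Longrightarrow> j \<in> ?S \<Longrightarrow> e (i, j) \<in> carrier A"
      "i \<in> ?S" "j \<in> ?S" for c e i j
  proof -
    interpret cring A by (rule A_cring)
    show ?thesis using that by (auto simp: fun_of_finsum intro!: finsum_closed)
  qed
  have eq: "(\<Oplus>\<^bsub>A\<^esub>k\<in>?S. c (i, k) \<otimes>\<^bsub>A\<^esub> e (k, j)) = (if i = j then \<one>\<^bsub>A\<^esub> else \<zero>\<^bsub>A\<^esub>) \<longleftrightarrow>
      (\<Sum>k\<in>?S. fun_of (c (i, k)) * fun_of (e (k, j))) = (if i = j then 1 else 0)"
    if "\<And>i j. i \<in> ?S \<Longrightarrow> j \<in> ?S \<Longrightarrow> c (i, j) \<in> carrier A" "\<And>i j. i \<in> ?S \<Longrightarrow> j \<in> ?S \<Longrightarrow> e (i, j) \<in> carrier A"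
      "i \<in> ?S" "j \<in> ?S" for c e i j
    using fun_of_inject[of "\<Oplus>\<^bsub>A\<^esub>k\<in>?S. c (i, k) \<otimes>\<^bsub>A\<^esub> e (k, j)" "if i = j then \<one>\<^bsub>A\<^esub> else \<zero>\<^bsub>A\<^esub>"]
      test[of c e, OF that] by (auto split: if_splits)
  have mult_one: "c \<otimes>\<^bsub>?M\<^esub> e = \<one>\<^bsub>?M\<^esub> \<longleftrightarrow>
      (\<forall>i\<in>?S. \<forall>j\<in>?S. (\<Sum>k\<in>?S. fun_of (c (i, k)) * fun_of (e (k, j))) = (if i = j then 1 else 0))"
    if c: "\<And>i j. i \<in> ?S \<Longrightarrow> j \<in> ?S \<Longrightarrow> c (i, j) \<in> carrier A" and e: "\<And>i j. i \<in> ?S \<Longrightarrow> j \<in> ?S \<Longrightarrow> e (i, j) \<in> carrier A"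
    for c e
  proof -
    have "c \<otimes>\<^bsub>?M\<^esub> e = \<one>\<^bsub>?M\<^esub> \<longleftrightarrow> (\<forall>i\<in>?S. \<forall>j\<in>?S.
        (\<Oplus>\<^bsub>A\<^esub>k\<in>?S. c (i, k) \<otimes>\<^bsub>A\<^esub> e (k, j)) = (if i = j then \<one>\<^bsub>A\<^esub> else \<zero>\<^bsub>A\<^esub>))"
      by (simp add: mat_monoid_def fun_eq_iff restrict_def) blast
    then show ?thesis using eq[of c e] c e by simp
  qed
  have "inv\<^bsub>?M\<^esub> ?a = ?b"
    unfolding m_inv_def
  proof (rule the_equality)
    have "?b \<in> carrier ?M" using b(1) by (auto simp: mat_monoid_def)
    then show "?b \<in> carrier ?M \<and> ?a \<otimes>\<^bsub>?M\<^esub> ?b = \<one>\<^bsub>?M\<^esub> \<and> ?b \<otimes>\<^bsub>?M\<^esub> ?a = \<one>\<^bsub>?M\<^esub>"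
      using carr b(2,3) by (simp add: mult_one cong: sum.cong)
    fix y assume y: "y \<in> carrier ?M \<and> ?a \<otimes>\<^bsub>?M\<^esub> y = \<one>\<^bsub>?M\<^esub> \<and> y \<otimes>\<^bsub>?M\<^esub> ?a = \<one>\<^bsub>?M\<^esub>"
    then have y_carr: "y (i, j) \<in> carrier A" if "i \<in> ?S" "j \<in> ?S" for i j
      using that by (auto simp: mat_monoid_def)
    have "?a \<otimes>\<^bsub>?M\<^esub> y = \<one>\<^bsub>?M\<^esub>" using y by blast
    then have ay: "(\<Sum>k\<in>?S. fun_of (coef V (i, k)) * fun_of (y (k, j))) = (if i = j then 1 else 0)"
      if "i \<in> ?S" "j \<in> ?S" for i j
      using that carr y_carr by (simp add: mult_one cong: sum.cong)
    have "y (i, j) = b (i, j)" if ij: "i \<in> ?S" "j \<in> ?S" for i j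
    proof -
      have "fun_of (y (i, j)) = (\<Sum>k\<in>?S. (if i = k then 1 else 0) * fun_of (y (k, j)))"
        using ij fin by (simp add: if_distrib[of "\<lambda>x. x * _"] cong: if_cong)
      also have "\<dots> = (\<Sum>k\<in>?S. (\<Sum>l\<in>?S. fun_of (b (i, l)) * fun_of (coef V (l, k))) * fun_of (y (k, j)))"
        by (rule sum.cong) (simp_all add: b(3) ij)
      also have "\<dots> = (\<Sum>l\<in>?S. fun_of (b (i, l)) * (\<Sum>k\<in>?S. fun_of (coef V (l, k)) * fun_of (y (k, j))))"
        by (simp add: sum_distrib_left sum_distrib_right mult.assoc) (rule sum.swap)
      also have "\<dots> = (\<Sum>l\<in>?S. fun_of (b (i, l)) * (if l = j then 1 else 0))"
        by (rule sum.cong) (simp_all add: ay ij)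
      also have "\<dots> = fun_of (b (i, j))"
        using ij fin by (simp add: if_distrib[of "\<lambda>x. _ * x"] cong: if_cong)
      finally show ?thesis using fun_of_inject y_carr b(1) ij by blast
    qed
    moreover have "y \<in> extensional (?S \<times> ?S)" using y by (auto simp: mat_monoid_def PiE_def)
    ultimately show "y = ?b"
      by (intro extensionalityI[of y "?S \<times> ?S"]) auto
  qed
  then show ?thesis using ij by (simp add: dual_rep_def)
qed

end

section \<open>A criterion for subquotients\<close>

context diff_group
begin

lemma fun_of_emb_mult: "C \<in> carrier A \<Longrightarrow> fun_of (emb A c \<otimes>\<^bsub>A\<^esub> C) g = \<iota> c * fun_of C g"
  by (simp add: fun_of_emb)

lemma coact_fun:
  assumes W: "fun_rep W" and i: "i \<in> basis W"
  shows "coact A W v i \<in> carrier A"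
    "fun_of (coact A W v i) g = (\<Sum>j\<in>basis W. \<iota> (v j) * fun_of (coef W (i, j)) g)"
proof -
  interpret cring A by (rule A_cring)
  note carr = fun_rep_carrier[OF W i]
  have closed: "(\<lambda>j. emb A (v j) \<otimes>\<^bsub>A\<^esub> coef W (i, j)) \<in> basis W \<rightarrow> carrier A" by (simp add: carr)
  then show "coact A W v i \<in> carrier A" using i by (simp add: coact_def finsum_closed)
  show "fun_of (coact A W v i) g = (\<Sum>j\<in>basis W. \<iota> (v j) * fun_of (coef W (i, j)) g)"
    using i by (simp add: coact_def fun_of_finsum[OF closed] fun_sum_apply del: fun_of_simps)
      (rule sum.cong, simp_all add: fun_of_emb_mult carr del: fun_of_simps)
qed

lemma tensor_sum_fun:
  assumes \<alpha>: "\<alpha> \<in> T \<rightarrow> carrier A" and i: "i \<in> basis W"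
  shows "tensor_sum A W T n \<alpha> i \<in> carrier A"
    "fun_of (tensor_sum A W T n \<alpha> i) g = (\<Sum>s\<in>T. \<iota> (n s i) * fun_of (\<alpha> s) g)"
proof -
  interpret cring A by (rule A_cring)
  have closed: "(\<lambda>s. emb A (n s i) \<otimes>\<^bsub>A\<^esub> \<alpha> s) \<in> T \<rightarrow> carrier A" using \<alpha> by auto
  then show "tensor_sum A W T n \<alpha> i \<in> carrier A" using i by (simp add: tensor_sum_def finsum_closed)
  show "fun_of (tensor_sum A W T n \<alpha> i) g = (\<Sum>s\<in>T. \<iota> (n s i) * fun_of (\<alpha> s) g)"
    using i by (simp add: tensor_sum_def fun_of_finsum[OF closed] fun_sum_apply del: fun_of_simps)
      (intro sum.cong refl fun_of_emb_mult, use \<alpha> in auto)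
qed

lemma coact_eq_tensor_sum_iff:
  assumes W: "fun_rep W" and \<alpha>: "\<alpha> \<in> T \<rightarrow> carrier A"
  shows "coact A W v = tensor_sum A W T n \<alpha> \<longleftrightarrow>
    (\<forall>i\<in>basis W. \<forall>g. (\<Sum>j\<in>basis W. \<iota> (v j) * fun_of (coef W (i, j)) g) =
      (\<Sum>s\<in>T. \<iota> (n s i) * fun_of (\<alpha> s) g))"
proof -
  have "coact A W v \<in> extensional (basis W)" "tensor_sum A W T n \<alpha> \<in> extensional (basis W)"
    by (simp_all add: coact_def tensor_sum_def)
  then have "coact A W v = tensor_sum A W T n \<alpha> \<longleftrightarrow>
      (\<forall>i\<in>basis W. coact A W v i = tensor_sum A W T n \<alpha> i)"
    by (auto intro: extensionalityI)
  also have "\<dots> \<longleftrightarrow> (\<forall>i\<in>basis W. fun_of (coact A W v i) = fun_of (tensor_sum A W T n \<alpha> i))"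
    by (intro ball_cong refl) (simp add: fun_of_inject coact_fun(1)[OF W] tensor_sum_fun(1)[OF \<alpha>])
  finally show ?thesis
    by (simp add: fun_eq_iff coact_fun(2)[OF W] tensor_sum_fun(2)[OF \<alpha>])
qed

text \<open>
  The rows of the matrix of \<open>W\<close> indexed by \<open>r\<close> with \<open>ir r = i\<close> give comodule maps from \<open>W\<close> to \<open>A\<close>;
  their sums define \<open>\<phi>\<close> from \<open>W\<close> to a power of \<open>A\<close>, into which \<open>U\<close> embeds by the rows of its own
  matrix. The subcomodule \<open>N\<close> is the inverse image of \<open>U\<close>, and the map \<open>f\<close> onto \<open>U\<close> is recovered by
  applying the counit to \<open>\<phi>\<close>.
\<close>

lemma subquotientI:
  assumes W: "fun_rep W" and U: "fun_rep U"
    and sel: "sel \<subseteq> basis W" "\<And>r. r \<in> sel \<Longrightarrow> ir r \<in> basis U"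
    and \<kappa>: "\<And>j. j \<in> basis U \<Longrightarrow> \<kappa> j \<in> vecs W"
    and coef: "\<And>i j g. i \<in> basis U \<Longrightarrow> j \<in> basis U \<Longrightarrow> fun_of (coef U (i, j)) g =
      (\<Sum>r\<in>{r \<in> sel. ir r = i}. \<Sum>b\<in>basis W. \<iota> (\<kappa> j b) * fun_of (coef W (r, b)) g)"
  shows "subquotient A U W"
proof -
  let ?J = "basis U" and ?B = "basis W"
  let ?u = "\<lambda>i j g. fun_of (coef U (i, j)) g" and ?c = "\<lambda>i j g. fun_of (coef W (i, j)) g"
  define R where "R i = {r \<in> sel. ir r = i}" for i
  \<comment> \<open>The counit evaluates at \<open>mat 1\<close>, where the matrix of
    \<open>W\<close> is the identity; so it sends the row sum in \<open>\<phi>\<close> to the sum of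
    the coordinates \<open>n r\<close>.\<close>
  define f where "f n i = (\<Sum>r\<in>R i. n r)" for n :: "_ \<Rightarrow> 'k" and i
  define \<phi> where "\<phi> n i g = (\<Sum>r\<in>R i. \<Sum>b\<in>?B. \<iota> (n b) * ?c r b g)" for n i g
  define N where "N = {n \<in> vecs W. \<forall>i\<in>?J. \<forall>g. \<phi> n i g = (\<Sum>j\<in>?J. \<iota> (f n j) * ?u i j g)}"
  note finB = fun_rep_finite[OF W] and finJ = fun_rep_finite[OF U]
  have R_B: "r \<in> ?B" if "r \<in> R i" for r i using that sel by (auto simp: R_def)
  have R_empty: "R i = {}" if "i \<notin> ?J" for i using that sel(2) by (auto simp: R_def)
  have f_add: "f (\<lambda>i. v i + w i) = (\<lambda>j. f v j + f w j)" for v w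
    by (simp add: f_def sum.distrib fun_eq_iff)
  have f_scale: "f (\<lambda>i. c * v i) = (\<lambda>j. c * f v j)" for c v
    by (simp add: f_def sum_distrib_left fun_eq_iff)
  have f_vecs: "f v \<in> vecs U" for v by (simp add: vecs_def f_def R_empty)
  have \<phi>_add: "\<phi> (\<lambda>i. v i + w i) i g = \<phi> v i g + \<phi> w i g" for v w i g
    by (simp add: \<phi>_def hom_add distrib_right sum.distrib)
  have \<phi>_scale: "\<phi> (\<lambda>i. c * v i) i g = \<iota> c * \<phi> v i g" for c v i g
    by (simp add: \<phi>_def hom_mult sum_distrib_left mult.assoc)
  have \<phi>_coact: "\<phi> v i g = (\<Sum>r\<in>R i. fun_of (coact A W v r) g)" for v i g
    unfolding \<phi>_def by (rule sum.cong) (simp_all add: coact_fun(2)[OF W] R_B)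
  have N_vecs: "N \<subseteq> vecs W" by (auto simp: N_def)
  have N_eq: "\<phi> n i g = (\<Sum>j\<in>?J. \<iota> (f n j) * ?u i j g)" if "n \<in> N" "i \<in> ?J" for n i g
    using that by (simp add: N_def)
  have coaction: "\<exists>S \<alpha>. finite S \<and> S \<subseteq> N \<and> \<alpha> \<in> S \<rightarrow> carrier A \<and>
      coact A W v = tensor_sum A W S (\<lambda>s. s) \<alpha>" if v: "v \<in> N" for v
  proof -
    define \<gamma> where "\<gamma> b = fun_of (coact A W v b)" for b
    have \<gamma>: "\<gamma> b g = (\<Sum>j\<in>?B. \<iota> (v j) * ?c b j g)" if "b \<in> ?B" for b g
      using coact_fun(2)[OF W that] by (simp add: \<gamma>_def)
    have "\<forall>c :: 'k. c \<noteq> 0 \<longrightarrow> (\<exists>c'. c * c' = 1)" using right_inverse by blast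
    \<comment> \<open>A maximal independent set \<open>E\<close> of components of the coaction
      writes \<open>\<rho>(v)\<close> as the sum of \<open>S a \<otimes> \<gamma> a\<close>,
      \<open>a \<in> E\<close>, with \<open>S\<close> as defined below. It remains to see that the
      vectors \<open>S a\<close> lie in \<open>N\<close>.\<close>
    from independent_subfamily[OF this finB, of \<gamma>]
    obtain E \<tau> where E: "E \<subseteq> ?B" "\<forall>b\<in>?B. \<forall>h. \<gamma> b h = (\<Sum>a\<in>E. \<iota> (\<tau> b a) * \<gamma> a h)"
        "\<forall>c. (\<forall>h. (\<Sum>a\<in>E. \<iota> (c a) * \<gamma> a h) = 0) \<longrightarrow> (\<forall>a\<in>E. c a = 0)"
      by (elim exE conjE) (rule that)
    have finE: "finite E" using E(1) finB finite_subset by blast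
    \<comment> \<open>The coefficients to be compared depend on a point \<open>g\<close> and lie in
      the universal field, so independence over \<open>k\<close> is first extended to that
      field.\<close>
    have indep: "w a = 0" if w: "\<And>h. (\<Sum>a\<in>E. w a * \<gamma> a h) = 0" and a: "a \<in> E" for w a
    proof (rule ccontr)
      assume "w a \<noteq> 0"
      then have "\<exists>c. (\<exists>e\<in>E. c e \<noteq> 0) \<and> (\<forall>g. (\<Sum>e\<in>E. \<iota> (c e) * \<gamma> e g) = 0)"
        using finE a w E(1)
        by (intro fn_descent[of E \<gamma> w]) (auto simp: \<gamma>_def intro!: fun_of_range coact_fun(1)[OF W])
      then show False using E(3) by blast
    qed
    define S where "S a b = (if b \<in> ?B then \<tau> b a else 0)" for a b
    have S_N: "S a \<in> N" if a: "a \<in> E" for a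
    proof -
      have "\<phi> (S a) i g = (\<Sum>j\<in>?J. \<iota> (f (S a) j) * ?u i j g)" if i: "i \<in> ?J" for i g
      proof -
        let ?g = "retract g"
        \<comment> \<open>Expand \<open>\<phi> v\<close> at \<open>?g ** ?h\<close> twice, by the
          matrix of \<open>W\<close> and, using \<open>v \<in> N\<close>, by the matrix of
          \<open>U\<close>. Comparing the coefficients of the independent \<open>\<gamma> a\<close>
          at \<open>?h\<close> gives the condition for each \<open>S a\<close>.\<close>
        have "\<phi> (S a) i ?g - (\<Sum>j\<in>?J. \<iota> (f (S a) j) * ?u i j ?g) = 0"
        proof (rule indep[OF _ a])
          fix h
          let ?h = "retract h"
          have gh: "?g \<in> G" "?h \<in> G" by (rule retract_in_G)+
          have "\<phi> v i (?g ** ?h) = (\<Sum>r\<in>R i. \<Sum>b\<in>?B. \<iota> (v b) * (\<Sum>e\<in>?B. ?c r e ?g * ?c e b ?h))"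
            unfolding \<phi>_def by (intro sum.cong refl) (simp add: fun_rep_mult[OF W _ _ gh] R_B)
          also have "\<dots> = (\<Sum>r\<in>R i. \<Sum>e\<in>?B. ?c r e ?g * \<gamma> e ?h)"
          proof (rule sum.cong[OF refl])
            fix r
            show "(\<Sum>b\<in>?B. \<iota> (v b) * (\<Sum>e\<in>?B. ?c r e ?g * ?c e b ?h)) = (\<Sum>e\<in>?B. ?c r e ?g * \<gamma> e ?h)"
              unfolding sum_distrib_left
              by (subst sum.swap, rule sum.cong) (simp_all add: \<gamma> sum_distrib_left mult_ac)
          qed
          also have "\<dots> = (\<Sum>r\<in>R i. \<Sum>e\<in>?B. \<Sum>a\<in>E. \<gamma> a ?h * (\<iota> (S a e) * ?c r e ?g))"
            by (intro sum.cong refl) (simp add: bspec[OF E(2)] S_def sum_distrib_left sum_distrib_right mult_ac)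
          also have "\<dots> = (\<Sum>r\<in>R i. \<Sum>a\<in>E. \<Sum>e\<in>?B. \<gamma> a ?h * (\<iota> (S a e) * ?c r e ?g))"
            by (rule sum.cong[OF refl]) (rule sum.swap)
          also have "\<dots> = (\<Sum>a\<in>E. \<gamma> a ?h * \<phi> (S a) i ?g)"
            by (subst sum.swap) (simp add: \<phi>_def sum_distrib_left)
          finally have 1: "\<phi> v i (?g ** ?h) = (\<Sum>a\<in>E. \<gamma> a ?h * \<phi> (S a) i ?g)" .
          have \<phi>v: "\<phi> v e ?h = (\<Sum>a\<in>E. \<gamma> a ?h * \<iota> (f (S a) e))" for e
          proof -
            have "\<phi> v e ?h = (\<Sum>r\<in>R e. \<Sum>a\<in>E. \<gamma> a ?h * \<iota> (S a r))"
              unfolding \<phi>_coact \<gamma>_def[symmetric]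
              by (intro sum.cong refl) (simp add: bspec[OF E(2)] S_def R_B mult.commute)
            also have "\<dots> = (\<Sum>a\<in>E. \<gamma> a ?h * \<iota> (f (S a) e))"
              by (subst sum.swap) (simp add: f_def hom_sum sum_distrib_left)
            finally show ?thesis .
          qed
          have "\<phi> v i (?g ** ?h) = (\<Sum>j\<in>?J. \<iota> (f v j) * (\<Sum>e\<in>?J. ?u i e ?g * ?u e j ?h))"
            unfolding N_eq[OF v i] by (intro sum.cong refl) (simp add: fun_rep_mult[OF U _ _ gh] i)
          also have "\<dots> = (\<Sum>e\<in>?J. ?u i e ?g * (\<Sum>j\<in>?J. \<iota> (f v j) * ?u e j ?h))"
            unfolding sum_distrib_left
            by (subst sum.swap, intro sum.cong refl) (simp add: mult_ac)
          also have "\<dots> = (\<Sum>e\<in>?J. ?u i e ?g * (\<Sum>a\<in>E. \<gamma> a ?h * \<iota> (f (S a) e)))"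
            by (rule sum.cong) (simp_all add: N_eq[OF v, symmetric] \<phi>v)
          also have "\<dots> = (\<Sum>a\<in>E. \<gamma> a ?h * (\<Sum>e\<in>?J. \<iota> (f (S a) e) * ?u i e ?g))"
            unfolding sum_distrib_left
            by (subst sum.swap, intro sum.cong refl) (simp add: mult_ac)
          finally have 2: "\<phi> v i (?g ** ?h) = (\<Sum>a\<in>E. \<gamma> a ?h * (\<Sum>e\<in>?J. \<iota> (f (S a) e) * ?u i e ?g))" .
          have "\<gamma> a ?h = \<gamma> a h" for a by (simp add: \<gamma>_def fun_of_retract)
          then have "(\<Sum>a\<in>E. (\<phi> (S a) i ?g - (\<Sum>e\<in>?J. \<iota> (f (S a) e) * ?u i e ?g)) * \<gamma> a h) =
              (\<Sum>a\<in>E. \<gamma> a ?h * \<phi> (S a) i ?g) - (\<Sum>a\<in>E. \<gamma> a ?h * (\<Sum>e\<in>?J. \<iota> (f (S a) e) * ?u i e ?g))"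
            by (simp add: right_diff_distrib sum_subtractf mult.commute)
          then show "(\<Sum>a\<in>E. (\<phi> (S a) i ?g - (\<Sum>e\<in>?J. \<iota> (f (S a) e) * ?u i e ?g)) * \<gamma> a h) = 0"
            using 1 2 by simp
        qed
        then show ?thesis by (simp add: \<phi>_def fun_of_retract)
      qed
      moreover have "S a \<in> vecs W" by (simp add: vecs_def S_def)
      ultimately show ?thesis by (simp add: N_def)
    qed
    interpret cring A by (rule A_cring)
    \<comment> \<open>\<open>tensor_sum\<close> runs over a set of vectors, and \<open>S\<close>
      need not be injective on \<open>E\<close>; the coefficients belonging to equal vectors are
      added up.\<close>
    define \<alpha> where "\<alpha> s = finsum A (coact A W v) {a \<in> E. S a = s}" for s
    have closed: "coact A W v \<in> {a \<in> E. S a = s} \<rightarrow> carrier A" for s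
      using E(1) coact_fun(1)[OF W] by auto
    have \<alpha>_closed: "\<alpha> \<in> S ` E \<rightarrow> carrier A" unfolding \<alpha>_def using closed by (auto intro: finsum_closed)
    have "coact A W v = tensor_sum A W (S ` E) (\<lambda>s. s) \<alpha>"
      unfolding coact_eq_tensor_sum_iff[OF W \<alpha>_closed]
    proof (intro ballI allI)
      fix b g assume b: "b \<in> ?B"
      have "(\<Sum>j\<in>?B. \<iota> (v j) * ?c b j g) = (\<Sum>a\<in>E. \<iota> (S a b) * \<gamma> a g)"
        using E(2) b by (simp add: S_def flip: \<gamma>)
      also have "\<dots> = (\<Sum>s\<in>S ` E. \<Sum>a\<in>{a \<in> E. S a = s}. \<iota> (S a b) * \<gamma> a g)"
        by (rule sum.image_gen[OF finE])
      also have "\<dots> = (\<Sum>s\<in>S ` E. \<iota> (s b) * fun_of (\<alpha> s) g)"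
      proof (rule sum.cong[OF refl])
        fix s
        have "fun_of (\<alpha> s) g = (\<Sum>a\<in>{a \<in> E. S a = s}. \<gamma> a g)"
          by (simp add: \<alpha>_def fun_of_finsum[OF closed] fun_sum_apply \<gamma>_def)
        then show "(\<Sum>a\<in>{a \<in> E. S a = s}. \<iota> (S a b) * \<gamma> a g) = \<iota> (s b) * fun_of (\<alpha> s) g"
          by (simp add: sum_distrib_left)
      qed
      finally show "(\<Sum>j\<in>?B. \<iota> (v j) * ?c b j g) = (\<Sum>s\<in>S ` E. \<iota> (s b) * fun_of (\<alpha> s) g)" .
    qed
    then show ?thesis using finE S_N \<alpha>_closed by (intro exI[of _ "S ` E"] exI[of _ \<alpha>]) auto
  qed
  have "subrep A W N"
    unfolding subrep_def
  proof (intro conjI ballI allI)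
    show "N \<subseteq> vecs W" by (rule N_vecs)
    show "(\<lambda>_. 0) \<in> N" by (simp add: N_def vecs_def \<phi>_def f_def hom_zero)
    show "(\<lambda>i. v i + w i) \<in> N" if vw: "v \<in> N" "w \<in> N" for v w
    proof -
      have "(\<lambda>i. v i + w i) \<in> vecs W" using vw by (auto simp: N_def vecs_def)
      then show ?thesis
        using N_eq[OF vw(1)] N_eq[OF vw(2)]
        by (simp add: N_def \<phi>_add f_add hom_add distrib_right sum.distrib)
    qed
    show "(\<lambda>i. c * v i) \<in> N" if v: "v \<in> N" for c v
    proof -
      have "(\<lambda>i. c * v i) \<in> vecs W" using v by (auto simp: N_def vecs_def)
      then show ?thesis
        using N_eq[OF v]
        by (simp add: N_def \<phi>_scale f_scale hom_mult sum_distrib_left mult.assoc)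
    qed
  qed (rule coaction)
  moreover have "subrep_hom A W N U f"
    unfolding subrep_hom_def
  proof (intro conjI ballI allI impI)
    show "f \<in> N \<rightarrow> vecs U" using f_vecs by blast
    show "f (\<lambda>i. v i + w i) = (\<lambda>j. f v j + f w j)" for v w by (rule f_add)
    show "f (\<lambda>i. c * v i) = (\<lambda>j. c * f v j)" for c v by (rule f_scale)
    fix v S \<alpha>
    assume v: "v \<in> N" and S: "finite S \<and> S \<subseteq> N \<and> \<alpha> \<in> S \<rightarrow> carrier A \<and>
        coact A W v = tensor_sum A W S (\<lambda>s. s) \<alpha>"
    then have \<alpha>: "\<alpha> \<in> S \<rightarrow> carrier A"
      and eq: "\<And>b g. b \<in> ?B \<Longrightarrow> (\<Sum>j\<in>?B. \<iota> (v j) * ?c b j g) = (\<Sum>s\<in>S. \<iota> (s b) * fun_of (\<alpha> s) g)"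
      using coact_eq_tensor_sum_iff[OF W, of \<alpha> S v "\<lambda>s. s"] by blast+
    show "coact A U (f v) = tensor_sum A U S f \<alpha>"
      unfolding coact_eq_tensor_sum_iff[OF U \<alpha>]
    proof (intro ballI allI)
      fix i g assume i: "i \<in> ?J"
      have "(\<Sum>j\<in>?J. \<iota> (f v j) * ?u i j g) = (\<Sum>r\<in>R i. \<Sum>s\<in>S. \<iota> (s r) * fun_of (\<alpha> s) g)"
        unfolding N_eq[OF v i, symmetric] \<phi>_def by (rule sum.cong) (simp_all add: eq R_B)
      also have "\<dots> = (\<Sum>s\<in>S. \<iota> (f s i) * fun_of (\<alpha> s) g)"
        by (subst sum.swap) (simp add: f_def hom_sum sum_distrib_right)
      finally show "(\<Sum>j\<in>?J. \<iota> (f v j) * ?u i j g) = (\<Sum>s\<in>S. \<iota> (f s i) * fun_of (\<alpha> s) g)" .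
    qed
  qed
  moreover have "w \<in> f ` N" if w: "w \<in> vecs U" for w
  proof -
    \<comment> \<open>By the hypothesis \<open>coef\<close>, \<open>\<phi>\<close> sends the vector
      \<open>\<kappa> j\<close> to column \<open>j\<close> of the matrix of \<open>U\<close>, so
      this combination is a preimage of \<open>w\<close>.\<close>
    define n where "n b = (\<Sum>j\<in>?J. w j * \<kappa> j b)" for b
    have n_vecs: "n \<in> vecs W" using \<kappa> by (auto simp: vecs_def n_def intro!: sum.neutral)
    have \<phi>n: "\<phi> n i g = (\<Sum>j\<in>?J. \<iota> (w j) * ?u i j g)" if i: "i \<in> ?J" for i g
    proof -
      have "\<phi> n i g = (\<Sum>r\<in>R i. \<Sum>b\<in>?B. \<Sum>j\<in>?J. \<iota> (w j) * (\<iota> (\<kappa> j b) * ?c r b g))"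
        by (simp add: \<phi>_def n_def hom_sum hom_mult sum_distrib_right mult.assoc)
      also have "\<dots> = (\<Sum>r\<in>R i. \<Sum>j\<in>?J. \<Sum>b\<in>?B. \<iota> (w j) * (\<iota> (\<kappa> j b) * ?c r b g))"
        by (rule sum.cong[OF refl]) (rule sum.swap)
      also have "\<dots> = (\<Sum>j\<in>?J. \<Sum>r\<in>R i. \<Sum>b\<in>?B. \<iota> (w j) * (\<iota> (\<kappa> j b) * ?c r b g))"
        by (rule sum.swap)
      also have "\<dots> = (\<Sum>j\<in>?J. \<iota> (w j) * ?u i j g)"
        by (rule sum.cong) (simp_all add: coef[OF i] R_def sum_distrib_left)
      finally show ?thesis .
    qed
    have fn: "f n i = w i" for i
    proof (cases "i \<in> ?J")
      case True
      have "\<iota> (f n i) = \<phi> n i (mat 1)"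
        unfolding \<phi>_def f_def hom_sum
        by (rule sum.cong[OF refl])
          (simp add: fun_rep_one[OF W] R_B finB if_distrib[of "\<lambda>x. _ * x"] cong: if_cong)
      also have "\<dots> = (\<Sum>j\<in>?J. \<iota> (w j) * (if i = j then 1 else 0))"
        unfolding \<phi>n[OF True] by (rule sum.cong) (simp_all add: fun_rep_one[OF U True])
      also have "\<dots> = \<iota> (w i)"
        using True finJ by (simp add: if_distrib[of "\<lambda>x. _ * x"] cong: if_cong)
      finally have "\<iota> (f n i - w i) = 0" by (simp add: hom_diff)
      then show ?thesis by (simp add: \<iota>_eq_0_iff)
    next
      case False
      then show ?thesis using w f_vecs[of n] by (simp add: vecs_def)
    qed
    have "n \<in> N" using n_vecs by (simp add: N_def \<phi>n fn)
    moreover have "f n = w" using fn by blast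
    ultimately show ?thesis by blast
  qed
  then have "f ` N = vecs U" using f_vecs by blast
  ultimately show ?thesis unfolding subquotient_def by blast
qed

section \<open>Coefficients of mixed tensor representations\<close>

lemma tensor_coef_carrier:
  assumes "\<And>V. V \<in> set Vs \<Longrightarrow> fun_rep V" "is \<in> listset (map basis Vs)" "js \<in> listset (map basis Vs)"
  shows "tensor_coef A Vs is js \<in> carrier A"
  using assms
proof (induction Vs arbitrary: "is" js)
  case (Cons V Vs)
  then show ?case using fun_rep_carrier[OF Cons.prems(1)[of V]] by (auto simp: set_Cons_def)
qed simp

lemma tensor_coef_append:
  assumes "\<And>V. V \<in> set (Vs @ Ws) \<Longrightarrow> fun_rep V"
    "is \<in> listset (map basis Vs)" "js \<in> listset (map basis Vs)"
    "is' \<in> listset (map basis Ws)" "js' \<in> listset (map basis Ws)"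
  shows "fun_of (tensor_coef A (Vs @ Ws) (is @ is') (js @ js')) =
    fun_of (tensor_coef A Vs is js) * fun_of (tensor_coef A Ws is' js')"
  using assms(1-3)
proof (induction Vs arbitrary: "is" js)
  case (Cons V Vs)
  obtain i is1 j js1 where ij: "is = i # is1" "js = j # js1" "i \<in> basis V" "j \<in> basis V"
      "is1 \<in> listset (map basis Vs)" "js1 \<in> listset (map basis Vs)"
    using Cons.prems(2,3) by (auto simp: set_Cons_def)
  have "coef V (i, j) \<in> carrier A" using fun_rep_carrier[OF Cons.prems(1)[of V]] ij by simp
  moreover have "tensor_coef A Vs is1 js1 \<in> carrier A"
    using Cons.prems(1) ij by (intro tensor_coef_carrier) auto
  moreover have "tensor_coef A (Vs @ Ws) (is1 @ is') (js1 @ js') \<in> carrier A"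
    using Cons.prems(1) ij assms(4,5) by (intro tensor_coef_carrier) (auto simp: listset_append)
  moreover have "fun_of (tensor_coef A (Vs @ Ws) (is1 @ is') (js1 @ js')) =
      fun_of (tensor_coef A Vs is1 js1) * fun_of (tensor_coef A Ws is' js')"
    using Cons.prems(1) ij by (intro Cons.IH) auto
  ultimately show ?case by (simp add: ij mult.assoc)
qed simp

inductive_set mixed_span :: "('i, ('n, 'k) gl_dpoly set) rep \<Rightarrow> ('u^'n^'n \<Rightarrow> 'u) set" for V where
  incl: "x \<in> basis (mixed_tensor A V ps l) \<Longrightarrow> y \<in> basis (mixed_tensor A V ps l) \<Longrightarrow>
    fun_of (coef (mixed_tensor A V ps l) (x, y)) \<in> mixed_span V"
| add: "f \<in> mixed_span V \<Longrightarrow> f' \<in> mixed_span V \<Longrightarrow> (\<lambda>g. f g + f' g) \<in> mixed_span V"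
| scale: "f \<in> mixed_span V \<Longrightarrow> (\<lambda>g. \<iota> c * f g) \<in> mixed_span V"

lemma mixed_span_list:
  "f \<in> mixed_span V \<Longrightarrow> \<exists>ts. (\<forall>(ps, l, x, y, c)\<in>set ts. x \<in> basis (mixed_tensor A V ps l) \<and>
      y \<in> basis (mixed_tensor A V ps l)) \<and>
    (\<forall>g. f g = (\<Sum>(ps, l, x, y, c)\<leftarrow>ts. \<iota> c * fun_of (coef (mixed_tensor A V ps l) (x, y)) g))"
  (is "_ \<Longrightarrow> \<exists>ts. ?mem ts \<and> (\<forall>g. f g = ?sum ts g)")
proof (induction rule: mixed_span.induct)
  case (incl x ps l y)
  then show ?case by (intro exI[of _ "[(ps, l, x, y, 1)]"]) (simp add: hom_one)
next
  case (add f f')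
  then obtain ts ts' where "?mem ts" "\<forall>g. f g = ?sum ts g" "?mem ts'" "\<forall>g. f' g = ?sum ts' g" by blast
  then show ?case by (intro exI[of _ "ts @ ts'"]) auto
next
  case (scale f a)
  then obtain ts where ts: "?mem ts" "\<forall>g. f g = ?sum ts g" by blast
  let ?ts = "map (\<lambda>(ps, l, x, y, c). (ps, l, x, y, a * c)) ts"
  have "?sum ?ts g = \<iota> a * ?sum ts g" for g
    by (induction ts) (auto simp: hom_mult algebra_simps)
  moreover have "?mem ?ts" using ts(1) by auto
  ultimately show ?case using ts(2) by (intro exI[of _ ?ts]) simp
qed

end

locale mixed_rep = diff_group d du \<iota> G
  for d :: "'k::field_char_0 \<Rightarrow> 'k" and du :: "'u::field \<Rightarrow> 'u" and \<iota> and G :: "('u^'n^'n) set" +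
  fixes V :: "('i, ('n, 'k) gl_dpoly set) rep" and b :: "'i \<times> 'i \<Rightarrow> ('n, 'k) gl_dpoly set"
  assumes V: "fun_rep V"
    and b_carrier: "i \<in> basis V \<Longrightarrow> j \<in> basis V \<Longrightarrow> b (i, j) \<in> carrier A"
    and b_right: "i \<in> basis V \<Longrightarrow> j \<in> basis V \<Longrightarrow>
      (\<Sum>k\<in>basis V. fun_of (coef V (i, k)) * fun_of (b (k, j))) = (if i = j then 1 else 0)"
    and b_left: "i \<in> basis V \<Longrightarrow> j \<in> basis V \<Longrightarrow>
      (\<Sum>k\<in>basis V. fun_of (b (i, k)) * fun_of (coef V (k, j))) = (if i = j then 1 else 0)"
    and dual: "i \<in> basis V \<Longrightarrow> j \<in> basis V \<Longrightarrow> coef (dual_rep A V) (i, j) = b (j, i)"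
begin

sublocale invertible_mat_fun d du \<iota> G "basis V" "\<lambda>p. fun_of (coef V p)" "\<lambda>p. fun_of (b p)"
proof unfold_locales
  have point: "(\<Sum>k\<in>S. f k g * f' k g) = (if P then 1 else 0)"
    if "(\<Sum>k\<in>S. f k * f' k) = (if P then 1 else 0)" for S :: "'i set" and f f' :: "'i \<Rightarrow> 'u^'n^'n \<Rightarrow> 'u" and P g
    using fun_cong[OF that, of g] by (simp add: fun_sum_apply split: if_splits)
  show "mat_fun (basis V) (\<lambda>p. fun_of (coef V p))" by (rule fun_rep_mat_fun[OF V])
  fix i j assume ij: "i \<in> basis V" "j \<in> basis V"
  show "fun_of (b (i, j)) \<in> range fn" using b_carrier[OF ij] by (rule fun_of_range)
  show "(\<Sum>k\<in>basis V. fun_of (coef V (i, k)) g * fun_of (b (k, j)) g) = (if i = j then 1 else 0)" for g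
    by (rule point[OF b_right[OF ij]])
  show "(\<Sum>k\<in>basis V. fun_of (b (i, k)) g * fun_of (coef V (k, j)) g) = (if i = j then 1 else 0)" for g
    by (rule point[OF b_left[OF ij]])
qed

lemma fun_rep_dual: "fun_rep (dual_rep A V)"
proof (rule fun_repI)
  have B: "basis (dual_rep A V) = basis V" by (simp add: dual_rep_def)
  show "finite (basis (dual_rep A V))" by (simp add: B fun_rep_finite[OF V])
  fix i j assume "i \<in> basis (dual_rep A V)" "j \<in> basis (dual_rep A V)"
  then have ij: "i \<in> basis V" "j \<in> basis V" by (simp_all add: B)
  show "coef (dual_rep A V) (i, j) \<in> carrier A" using ij by (simp add: dual b_carrier)
  show "fun_of (coef (dual_rep A V) (i, j)) (mat 1) = (if i = j then 1 else 0)"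
    using b_one[OF ij(2,1)] by (simp add: dual ij)
  fix g h assume gh: "g \<in> G" "h \<in> G"
  show "fun_of (coef (dual_rep A V) (i, j)) (g ** h) = (\<Sum>k\<in>basis (dual_rep A V).
      fun_of (coef (dual_rep A V) (i, k)) g * fun_of (coef (dual_rep A V) (k, j)) h)"
    using b_mult[OF ij(2,1) gh] ij by (simp add: B dual cong: sum.cong)
qed

abbreviation "prolongs \<equiv> map (\<lambda>p. prolong A p V)"
abbreviation "duals l \<equiv> replicate l (dual_rep A V)"

lemma fun_rep_prolongs: "W \<in> set (prolongs ps) \<Longrightarrow> fun_rep W"
  using fun_rep_prolong[OF V] by auto

lemma fun_rep_duals: "W \<in> set (duals l) \<Longrightarrow> fun_rep W"
  using fun_rep_dual by (auto simp: in_set_replicate)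

lemma fun_rep_mixed: "fun_rep (mixed_tensor A V ps l)"
  unfolding mixed_tensor_def
  by (intro fun_rep_tensor fun_rep_tensor_list fun_rep_prolongs fun_rep_duals)

lemma basis_mixed: "basis (mixed_tensor A V ps l) =
    listset (map basis (prolongs ps)) \<times> listset (map basis (duals l))"
  by (simp add: mixed_tensor_def tensor_def tensor_list_def)

lemma coef_mixed: "coef (mixed_tensor A V ps l) ((x, x'), (y, y')) =
    tensor_coef A (prolongs ps) x y \<otimes>\<^bsub>A\<^esub> tensor_coef A (duals l) x' y'"
  by (simp add: mixed_tensor_def tensor_def tensor_list_def)

lemma fun_coef_mixed:
  assumes "(x, x') \<in> basis (mixed_tensor A V ps l)" "(y, y') \<in> basis (mixed_tensor A V ps l)"
  shows "fun_of (coef (mixed_tensor A V ps l) ((x, x'), (y, y'))) =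
    fun_of (tensor_coef A (prolongs ps) x y) * fun_of (tensor_coef A (duals l) x' y')"
  unfolding coef_mixed
  by (rule fun_of_simps(1); rule tensor_coef_carrier)
    (use assms fun_rep_prolongs fun_rep_duals in \<open>auto simp: basis_mixed\<close>)

text \<open>The product is a coefficient of the mixed tensor module with concatenated lists.
  Concatenating prolongations and duals separately keeps the prescribed order of the factors, which
  is harmless since \<open>A\<close> is commutative.\<close>

lemma coef_mixed_mult:
  assumes "x \<in> basis (mixed_tensor A V ps l)" "y \<in> basis (mixed_tensor A V ps l)"
    and "z \<in> basis (mixed_tensor A V ps' l')" "w \<in> basis (mixed_tensor A V ps' l')"
  shows "fun_of (coef (mixed_tensor A V ps l) (x, y)) * fun_of (coef (mixed_tensor A V ps' l') (z, w)) \<in> mixed_span V"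
proof -
  obtain x1 x2 y1 y2 z1 z2 w1 w2 where eqs: "x = (x1, x2)" "y = (y1, y2)" "z = (z1, z2)" "w = (w1, w2)"
    by (cases x, cases y, cases z, cases w)
  note mem = assms[unfolded eqs]
  note mem' = mem[unfolded basis_mixed mem_Times_iff fst_conv snd_conv]
  let ?M = "mixed_tensor A V (ps @ ps') (l + l')"
  have bas: "(x1 @ z1, x2 @ z2) \<in> basis ?M" "(y1 @ w1, y2 @ w2) \<in> basis ?M"
    using mem' by (simp_all add: basis_mixed replicate_add listset_append)
  have "fun_of (coef ?M ((x1 @ z1, x2 @ z2), (y1 @ w1, y2 @ w2))) =
      fun_of (tensor_coef A (prolongs ps @ prolongs ps') (x1 @ z1) (y1 @ w1)) *
      fun_of (tensor_coef A (duals l @ duals l') (x2 @ z2) (y2 @ w2))"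
    using fun_coef_mixed[OF bas] by (simp add: replicate_add)
  also have "fun_of (tensor_coef A (prolongs ps @ prolongs ps') (x1 @ z1) (y1 @ w1)) =
      fun_of (tensor_coef A (prolongs ps) x1 y1) * fun_of (tensor_coef A (prolongs ps') z1 w1)"
    using mem' fun_rep_prolongs by (intro tensor_coef_append) auto
  also have "fun_of (tensor_coef A (duals l @ duals l') (x2 @ z2) (y2 @ w2)) =
      fun_of (tensor_coef A (duals l) x2 y2) * fun_of (tensor_coef A (duals l') z2 w2)"
    using mem' fun_rep_duals by (intro tensor_coef_append) auto
  finally have "fun_of (coef (mixed_tensor A V ps l) (x, y)) * fun_of (coef (mixed_tensor A V ps' l') (z, w)) =
      fun_of (coef ?M ((x1 @ z1, x2 @ z2), (y1 @ w1, y2 @ w2)))"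
    unfolding eqs fun_coef_mixed[OF mem(1,2)] fun_coef_mixed[OF mem(3,4)] by (simp only: mult_ac)
  then show ?thesis using mixed_span.incl[OF bas] by simp
qed

lemma mixed_span_mult:
  assumes f: "f \<in> mixed_span V" and f': "f' \<in> mixed_span V"
  shows "f * f' \<in> mixed_span V"
  using f
proof induction
  case (incl x ps l y)
  show ?case
    using f'
  proof induction
    case (incl z ps' l' w)
    then show ?case using coef_mixed_mult \<open>x \<in> _\<close> \<open>y \<in> _\<close> by blast
  next
    case (add f f')
    from mixed_span.add[OF add.IH] show ?case by (simp add: times_fun_def distrib_left)
  next
    case (scale f c)
    from mixed_span.scale[OF scale.IH, of c] show ?case by (simp add: times_fun_def mult.left_commute)
  qed
next
  case (add h h')
  from mixed_span.add[OF add.IH] show ?case by (simp add: times_fun_def distrib_right)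
next
  case (scale h c)
  from mixed_span.scale[OF scale.IH, of c] show ?case by (simp add: times_fun_def mult.assoc)
qed

lemma gen_ring_mixed_span: "f \<in> R \<Longrightarrow> f \<in> mixed_span V"
proof (induction rule: gen_ring.induct)
  case (const c)
  have bas: "([], []) \<in> basis (mixed_tensor A V [] 0)" by (simp add: basis_mixed)
  \<comment> \<open>Constants come from the empty tensor product, the trivial module.\<close>
  have "fun_of (coef (mixed_tensor A V [] 0) (([], []), ([], []))) = 1"
    by (simp add: coef_mixed)
  then show ?case using mixed_span.scale[OF mixed_span.incl[OF bas bas], of c] by simp
next
  case (der i j q)
  have bas: "([(0, i)], []) \<in> basis (mixed_tensor A V [q] 0)" "([(q, j)], []) \<in> basis (mixed_tensor A V [q] 0)"
    using der by (auto simp: basis_mixed prolong_def set_Cons_def)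
  have carr: "coef (prolong A q V) ((0, i), (q, j)) \<in> carrier A"
    by (rule prolong_coef(1)[OF V der])
  \<comment> \<open>In the coaction on the \<open>q\<close>-th derivative of basis vector
    \<open>j\<close>, the coefficient of the underived basis vector \<open>i\<close> is the full
    \<open>q\<close>-th derivative, with binomial coefficient \<open>q choose 0 = 1\<close>.\<close>
  have "fun_of (coef (mixed_tensor A V [q] 0) (([(0, i)], []), ([(q, j)], []))) =
      (\<lambda>g. (du ^^ q) (fun_of (coef V (i, j)) g))"
    using carr by (simp add: coef_mixed fun_eq_iff prolong_coef(2)[OF V der])
  then show ?case using mixed_span.incl[OF bas] by simp
next
  case (inv i j)
  \<comment> \<open>The indices are exchanged because the dual is given by the transposed
    inverse.\<close>
  have bas: "([], [j]) \<in> basis (mixed_tensor A V [] 1)" "([], [i]) \<in> basis (mixed_tensor A V [] 1)"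
    using inv by (auto simp: basis_mixed dual_rep_def set_Cons_def)
  have "fun_of (coef (mixed_tensor A V [] 1) (([], [j]), ([], [i]))) = fun_of (b (i, j))"
    using inv by (simp add: coef_mixed dual b_carrier)
  then show ?case using mixed_span.incl[OF bas] by simp
next
  case (add f f')
  then show ?case using mixed_span.add by (simp add: plus_fun_def)
next
  case (mult f f')
  then show ?case by (intro mixed_span_mult)
qed

end

text \<open>The expansions of all entries of \<open>U\<close> are merged into one list labelled by
  the entries; selecting a label recovers the expansion of that entry.\<close>

lemma sum_list_labelled:
  fixes F :: "'t \<Rightarrow> 'a::comm_monoid_add"
  assumes "distinct js"
  shows "(\<Sum>(q, t)\<leftarrow>concat (map (\<lambda>q. map (Pair q) (ts q)) js). if q = p then F t else 0) =
    (if p \<in> set js then \<Sum>t\<leftarrow>ts p. F t else 0)"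
  using assms
proof (induction js)
  case (Cons q js)
  have "(\<Sum>(q, t)\<leftarrow>map (Pair q) us. if q = p then F t else 0) = (if q = p then \<Sum>t\<leftarrow>us. F t else 0)" for us
    by (induction us) auto
  then show ?case using Cons by auto
qed simp

theorem proposition2:
  fixes d :: "'k::field_char_0 \<Rightarrow> 'k"
    and du :: "'u::field \<Rightarrow> 'u"
    and \<iota> :: "'k \<Rightarrow> 'u"
    and G :: "('u^'n^'n) set"
    and V :: "('i, ('n, 'k) gl_dpoly set) rep"
    and U :: "('j, ('n, 'k) gl_dpoly set) rep"
  defines "A \<equiv> coord_ring d du \<iota> G"
    and "x \<equiv> coord_mat du \<iota> G"
  assumes "derivation cring_class_ops d"
    and "semi_universal d (type_dalg du \<iota>)"
    and "lin_diff_alg_group du \<iota> G"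
    and "diff_rep d A x V"
    and "faithful_rep d A x V"
    and "diff_rep d A x U"
  shows "\<exists>ts :: (nat list \<times> nat) list.
    subquotient A U (direct_sum A (map (\<lambda>(ps, l). mixed_tensor A V ps l) ts))"
proof -
  interpret diff_group d du \<iota> G by unfold_locales fact+
  note rep_V = assms(6)[unfolded A_def x_def] and faithful = assms(7)[unfolded A_def x_def]
    and U = assms(8)[unfolded A_def x_def]
  let ?A = "coord_ring d du \<iota> G" and ?J = "basis U \<times> basis U"
  note fun_rep_V = diff_rep_fun_rep[OF rep_V] and fun_rep_U = diff_rep_fun_rep[OF U]
  obtain b where b: "\<And>i j. i \<in> basis V \<Longrightarrow> j \<in> basis V \<Longrightarrow> b (i, j) \<in> carrier ?A"
      "\<And>i j. i \<in> basis V \<Longrightarrow> j \<in> basis V \<Longrightarrow>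
        (\<Sum>k\<in>basis V. fun_of (coef V (i, k)) * fun_of (b (k, j))) = (if i = j then 1 else 0)"
      "\<And>i j. i \<in> basis V \<Longrightarrow> j \<in> basis V \<Longrightarrow>
        (\<Sum>k\<in>basis V. fun_of (b (i, k)) * fun_of (coef V (k, j))) = (if i = j then 1 else 0)"
    using rep_inverse[OF rep_V] by blast
  interpret mixed_rep d du \<iota> G V b
    by unfold_locales (use fun_rep_V b dual_coef[OF rep_V b] in auto)
  let ?M = "mixed_tensor ?A V"
  let ?mem = "\<lambda>ts. \<forall>(ps, l, x, y, c)\<in>set ts. x \<in> basis (?M ps l) \<and> y \<in> basis (?M ps l)"
  let ?F = "\<lambda>g (ps, l, x, y, c). \<iota> c * fun_of (coef (?M ps l) (x, y)) g"
  have "\<exists>ts. ?mem ts \<and> (\<forall>g. fun_of (coef U p) g = (\<Sum>t\<leftarrow>ts. ?F g t))" if "p \<in> ?J" for p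
  proof -
    have "fun_of (coef U p) \<in> mixed_span V"
      using that coef_in_gen_ring[OF rep_V faithful U invertible_mat_fun_axioms]
      by (auto intro: gen_ring_mixed_span)
    then show ?thesis by (rule mixed_span_list)
  qed
  then have "\<forall>p\<in>?J. \<exists>ts. ?mem ts \<and> (\<forall>g. fun_of (coef U p) g = (\<Sum>t\<leftarrow>ts. ?F g t))" by blast
  then obtain ts where ts: "\<forall>p\<in>?J. ?mem (ts p) \<and> (\<forall>g. fun_of (coef U p) g = (\<Sum>t\<leftarrow>ts p. ?F g t))"
    by (rule bchoice[THEN exE])
  obtain js where js: "set js = ?J" "distinct js"
    using finite_distinct_list[of ?J] fun_rep_finite[OF fun_rep_U] by auto
  \<comment> \<open>Each term of each expansion gets its own summand of the direct sum
    \<open>W\<close>. Item \<open>s\<close> records the entry \<open>(ri s, ci s)\<close> of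
    \<open>U\<close>, the module given by \<open>ps s\<close> and \<open>l s\<close>, the position
    \<open>(x0 s, y0 s)\<close> of the coefficient used in it, and the scalar
    \<open>c s\<close>.\<close>
  define L where "L = concat (map (\<lambda>q. map (Pair q) (ts q)) js)"
  define ri ci where "ri s = fst (fst (L ! s))" and "ci s = snd (fst (L ! s))" for s
  define ps l where "ps s = fst (snd (L ! s))" and "l s = fst (snd (snd (L ! s)))" for s
  define x0 y0 c where "x0 s = fst (snd (snd (snd (L ! s))))"
    and "y0 s = fst (snd (snd (snd (snd (L ! s)))))"
    and "c s = snd (snd (snd (snd (snd (L ! s)))))" for s
  have L_nth: "L ! s = ((ri s, ci s), ps s, l s, x0 s, y0 s, c s)" for s
    by (simp add: ri_def ci_def ps_def l_def x0_def y0_def c_def)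
  let ?n = "length L"
  have L_mem: "ri s \<in> basis U" "x0 s \<in> basis (?M (ps s) (l s))" "y0 s \<in> basis (?M (ps s) (l s))"
    if "s < ?n" for s
  proof -
    have "L ! s \<in> set L" using that by simp
    then obtain q t where qt: "q \<in> ?J" "t \<in> set (ts q)" "L ! s = (q, t)"
      by (auto simp: L_def js)
    have "?mem (ts q)" using ts qt(1) by blast
    then have "case t of (ps, l, x, y, c) \<Rightarrow> x \<in> basis (?M ps l) \<and> y \<in> basis (?M ps l)"
      using qt(2) by (rule bspec)
    then show "ri s \<in> basis U" "x0 s \<in> basis (?M (ps s) (l s))" "y0 s \<in> basis (?M (ps s) (l s))"
      using qt(1,3) unfolding L_nth by auto
  qed
  define types where "types = map (\<lambda>s. (ps s, l s)) [0..<?n]"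
  define Vs where "Vs = map (\<lambda>(ps, l). ?M ps l) types"
  define W where "W = direct_sum ?A Vs"
  have Vs: "length Vs = ?n" "\<And>s. s < ?n \<Longrightarrow> Vs ! s = ?M (ps s) (l s)"
    by (simp_all add: Vs_def types_def)
  have W: "fun_rep W"
    unfolding W_def by (rule fun_rep_direct_sum) (auto simp: Vs_def fun_rep_mixed)
  have basis_W: "basis W = (SIGMA s:{..<?n}. basis (?M (ps s) (l s)))"
    by (auto simp: W_def direct_sum_def Vs)
  have coef_W: "coef W ((s, i), (s, j)) = coef (?M (ps s) (l s)) (i, j)" if "s < ?n" for s i j
    using that by (simp add: W_def direct_sum_def Vs)
  have fin_W: "finite (basis W)" by (rule fun_rep_finite[OF W])
  \<comment> \<open>Row \<open>x0 s\<close> of summand \<open>s\<close> contributes to row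
    \<open>ri s\<close> of \<open>U\<close>, while \<open>\<kappa> j\<close> places the scalar
    \<open>c s\<close> at index \<open>y0 s\<close> of exactly those summands labelled with column
    \<open>j\<close>. Pairing the two returns the terms labelled \<open>(i, j)\<close>.\<close>
  define sel where "sel = (\<lambda>s. (s, x0 s)) ` {..<?n}"
  define \<kappa> where "\<kappa> j z = (if fst z < ?n \<and> ci (fst z) = j \<and> snd z = y0 (fst z) then c (fst z) else 0)" for j z
  have "subquotient ?A U W"
  proof (rule subquotientI[OF W fun_rep_U])
    show "sel \<subseteq> basis W" by (auto simp: sel_def basis_W L_mem)
    show "ri (fst r) \<in> basis U" if "r \<in> sel" for r using that by (auto simp: sel_def L_mem)
    show "\<kappa> j \<in> vecs W" if "j \<in> basis U" for j
      by (auto simp: vecs_def \<kappa>_def basis_W L_mem split: prod.splits)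
    fix i j g assume ij: "i \<in> basis U" "j \<in> basis U"
    have inner: "(\<Sum>z\<in>basis W. \<iota> (\<kappa> j z) * fun_of (coef W ((s, x0 s), z)) g) =
        (if ci s = j then ?F g (ps s, l s, x0 s, y0 s, c s) else 0)" if row: "s < ?n" "ri s = i" for s
    proof -
      have off: "fun_of (coef W ((s, x0 s), (t, z))) g = 0" if "t \<noteq> s" for t z
        using that by (simp add: W_def direct_sum_def)
      have "(\<Sum>z\<in>basis W. \<iota> (\<kappa> j z) * fun_of (coef W ((s, x0 s), z)) g) =
          (\<Sum>z\<in>basis W. if z = (s, y0 s) then \<iota> (\<kappa> j z) * fun_of (coef W ((s, x0 s), z)) g else 0)"
      proof (rule sum.cong[OF refl])
        fix z
        show "\<iota> (\<kappa> j z) * fun_of (coef W ((s, x0 s), z)) g =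
            (if z = (s, y0 s) then \<iota> (\<kappa> j z) * fun_of (coef W ((s, x0 s), z)) g else 0)"
          by (cases z; cases "fst z = s") (auto simp: \<kappa>_def hom_zero off)
      qed
      also have "\<dots> = \<iota> (\<kappa> j (s, y0 s)) * fun_of (coef W ((s, x0 s), (s, y0 s))) g"
        using row(1) L_mem(3) fin_W by (simp add: basis_W)
      also have "\<dots> = (if ci s = j then ?F g (ps s, l s, x0 s, y0 s, c s) else 0)"
        using row(1) by (simp add: \<kappa>_def coef_W hom_zero)
      finally show ?thesis .
    qed
    have "(\<Sum>r\<in>{r \<in> sel. ri (fst r) = i}. \<Sum>z\<in>basis W. \<iota> (\<kappa> j z) * fun_of (coef W (r, z)) g) =
        (\<Sum>r\<in>(\<lambda>s. (s, x0 s)) ` {s. s < ?n \<and> ri s = i}. \<Sum>z\<in>basis W. \<iota> (\<kappa> j z) * fun_of (coef W (r, z)) g)"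
      by (rule sum.cong) (auto simp: sel_def)
    also have "\<dots> = (\<Sum>s\<in>{s. s < ?n \<and> ri s = i}. \<Sum>z\<in>basis W. \<iota> (\<kappa> j z) * fun_of (coef W ((s, x0 s), z)) g)"
      by (subst sum.reindex) (simp_all add: inj_on_def)
    also have "\<dots> = (\<Sum>s\<in>{s. s < ?n \<and> ri s = i}. if ci s = j then ?F g (ps s, l s, x0 s, y0 s, c s) else 0)"
      by (rule sum.cong) (simp_all add: inner)
    also have "\<dots> = (\<Sum>s<?n. if (ri s, ci s) = (i, j) then ?F g (ps s, l s, x0 s, y0 s, c s) else 0)"
      by (rule sum.mono_neutral_cong_left) auto
    also have "\<dots> = (\<Sum>(q, t)\<leftarrow>L. if q = (i, j) then ?F g t else 0)"
      unfolding sum_list_sum_nth length_map atLeast0LessThan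
      by (rule sum.cong) (simp_all add: L_nth)
    also have "\<dots> = (\<Sum>t\<leftarrow>ts (i, j). ?F g t)"
      using sum_list_labelled[OF js(2), where F = "?F g" and p = "(i, j)" and ts = ts] ij
      by (simp add: L_def js(1))
    also have "\<dots> = fun_of (coef U (i, j)) g" using ts ij by simp
    finally show "fun_of (coef U (i, j)) g = (\<Sum>r\<in>{r \<in> sel. ri (fst r) = i}.
        \<Sum>z\<in>basis W. \<iota> (\<kappa> j z) * fun_of (coef W (r, z)) g)" ..
  qed
  then show ?thesis unfolding A_def W_def Vs_def by blast
qed

end
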